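(* Let $r\in(0,1)$ and $t=\sqrt{1-r^2}$. Let $\mu$ be a probability measure on $\mathbb T=\mathbb R/2\pi\mathbb Z$ that is absolutely continuous, $d\mu(\omega)=\tau(\omega)\,d\omega$, with density $\tau\in L^\infty(\mathbb T)$, and suppose that the support of $\mu$ contains a non-empty open set. Let $\{\omega_k^\uparrow\}_{k\in\mathbb Z}\cup\{\omega_k^\downarrow\}_{k\in\mathbb Z}$ be i.i.d. $\mathbb T$-valued random variables with law $\mu$, and let $U_\omega$ be the associated random quantum walk operator on $\mathbb C^2\otimes l^2(\mathbb Z)$ (defined in the context). Then there exists a set $\Omega_0$ of probability one such that for any $\omega\in\Omega_0$, any $L>0$ and any $\Psi\in\mathbb C^2\otimes l^2(\mathbb Z)$ of finite support, there exists $C_\omega<\infty$ (which may depend on $\omega$, $L$, $\Psi$) with $$\sup_{n\in\mathbb Z}\ \langle |X|^L\rangle_\Psi(n)<C_\omega .$$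
   Context: Let $\{|\!\uparrow\rangle,|\!\downarrow\rangle\}$ be the canonical orthonormal basis of $\mathbb C^2$ and $\{|n\rangle\}_{n\in\mathbb Z}$ the canonical basis of $l^2(\mathbb Z)$. The random unitary operator $U_\omega$ on $\mathbb C^2\otimes l^2(\mathbb Z)$ is determined by $$U_\omega|\!\uparrow\rangle\otimes|n\rangle = e^{-i\omega_n^\uparrow}t\,|\!\uparrow\rangle\otimes|n+1\rangle+e^{-i\omega_n^\downarrow}r\,|\!\downarrow\rangle\otimes|n-1\rangle,$$ $$U_\omega|\!\downarrow\rangle\otimes|n\rangle = -e^{-i\omega_n^\uparrow}r\,|\!\uparrow\rangle\otimes|n+1\rangle+e^{-i\omega_n^\downarrow}t\,|\!\downarrow\rangle\otimes|n-1\rangle .$$ The probability space is $\Omega=\mathbb T^{\mathbb Z}$ with the cylinder $\sigma$-algebra and $\mathbb P=\otimes_{k\in\mathbb Z}\mu$, with $\omega_k^\uparrow=\omega_{2k}$, $\omega_k^\downarrow=\omega_{2k+1}$. The position operator is $X=\mathbb I\otimes x$ with $x|k\rangle=k|k\rangle$, on its maximal domain, and $\langle |X|^L\rangle_\Psi(n)=\langle\Psi, U_\omega^{-n}|X|^LU_\omega^n\Psi\rangle$. A vector has finite support if it is a finite linear combination of the vectors $|\sigma\rangle\otimes|k\rangle$, $\sigma\in\{\uparrow,\downarrow\}$, $k\in\mathbb Z$. *)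

theory Defs
  imports "HOL-Probability.Probability"
begin

section \<open>The circle as a quotient of the real line\<close>

quotient_type circle = real / "\<lambda>x y. \<exists>k::int. x - y = 2 * pi * of_int k"
  morphisms rep_circle circle_of
proof (rule equivpI)
  show "reflp (\<lambda>x y. \<exists>k::int. x - y = 2 * pi * of_int k)"
    by (auto intro!: reflpI exI[of _ 0])
  show "symp (\<lambda>x y. \<exists>k::int. x - y = 2 * pi * of_int k)"
  proof (rule sympI)
    fix x y :: real assume "\<exists>k::int. x - y = 2 * pi * of_int k"
    then obtain k :: int where "x - y = 2 * pi * of_int k" by blast
    then have "y - x = 2 * pi * of_int (- k)" by simp
    then show "\<exists>k::int. y - x = 2 * pi * of_int k" by blast
  qed
  show "transp (\<lambda>x y. \<exists>k::int. x - y = 2 * pi * of_int k)"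
  proof (rule transpI)
    fix x y z :: real
    assume "\<exists>k::int. x - y = 2 * pi * of_int k" "\<exists>k::int. y - z = 2 * pi * of_int k"
    then obtain k l :: int where "x - y = 2 * pi * of_int k" "y - z = 2 * pi * of_int l" by blast
    then have "x - z = 2 * pi * of_int (k + l)" by (simp add: algebra_simps)
    then show "\<exists>k::int. x - z = 2 * pi * of_int k" by blast
  qed
qed

instantiation circle :: topological_space
begin

definition open_circle :: "circle set \<Rightarrow> bool" where
  "open_circle V \<longleftrightarrow> open (circle_of -` V)"

instance
proof
  show "open (UNIV :: circle set)" by (simp add: open_circle_def)
  show "open (S \<inter> T)" if "open S" "open T" for S T :: "circle set"
    using that by (auto simp: open_circle_def)
  show "open (\<Union>K)" if "\<forall>S\<in>K. open S" for K :: "circle set set"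
    using that by (auto simp: open_circle_def vimage_Union)
qed

end

lemma continuous_circle_of: "continuous_on UNIV circle_of"
  by (auto simp: continuous_on_open_vimage open_circle_def)

lemma measurable_circle_of [measurable]: "circle_of \<in> borel_measurable borel"
  by (rule borel_measurable_continuous_onI[OF continuous_circle_of])

text \<open>The measure \<open>d\<omega>\<close>, of total mass \<open>2 \<pi>\<close>, obtained from the fundamental domain.\<close>

definition circle_lebesgue :: "circle measure" where
  "circle_lebesgue = distr (restrict_space lborel {0..<2 * pi}) borel circle_of"

lemma sets_circle_lebesgue [measurable_cong, simp]: "sets circle_lebesgue = sets borel"
  by (simp add: circle_lebesgue_def)

lemma emeasure_circle_lebesgue: "emeasure circle_lebesgue UNIV = ennreal (2 * pi)"
proof -
  have "circle_of \<in> measurable (restrict_space lborel {0..<2 * pi}) borel"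
    by (intro measurable_restrict_space1) simp
  then show ?thesis
    unfolding circle_lebesgue_def
    by (subst emeasure_distr) (auto simp: emeasure_restrict_space space_restrict_space)
qed

lift_definition circle_phase :: "circle \<Rightarrow> complex" is "\<lambda>x. exp (- (\<i> * of_real x))"
proof -
  fix x y :: real assume "\<exists>k::int. x - y = 2 * pi * of_int k"
  then obtain k :: int where "x - y = 2 * pi * of_int k" by blast
  then have "x = y + 2 * pi * of_int k" by simp
  then have "- (\<i> * of_real x) = - (\<i> * of_real y) + of_real (of_int (2 * (- k)) * pi) * \<i>"
    by (simp add: algebra_simps)
  then show "exp (- (\<i> * complex_of_real x)) = exp (- (\<i> * complex_of_real y))"
    unfolding exp_eq by (intro exI[of _ "- k"]) (simp add: algebra_simps)
qed

lemma norm_circle_phase [simp]: "norm (circle_phase a) = 1"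
  by transfer simp

definition measure_support :: "'a::topological_space measure \<Rightarrow> 'a set" where
  "measure_support M = {x. \<forall>V. open V \<longrightarrow> x \<in> V \<longrightarrow> emeasure M V > 0}"

text \<open>Both families of phases are stored in one sequence: \<open>\<omega> (2 * k)\<close> is the phase at site \<open>k\<close> for
  spin up and \<open>\<omega> (2 * k + 1)\<close> the one for spin down.\<close>

definition phase_space :: "circle measure \<Rightarrow> (int \<Rightarrow> circle) measure" where
  "phase_space \<mu> = Pi\<^sub>M UNIV (\<lambda>_. \<mu>)"


section \<open>The Hilbert space\<close>

datatype spin = Up | Down

text \<open>The tensor product of \<open>\<complex>\<^sup>2\<close> and \<open>l\<^sup>2(\<int>)\<close> is identified with the square summable functions
  on \<open>{Up, Down} \<times> \<int>\<close>.\<close>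

type_synonym wave = "spin \<times> int \<Rightarrow> complex"

definition l2 :: "wave set" where
  "l2 = {\<psi>. (\<lambda>x. (norm (\<psi> x))\<^sup>2) summable_on UNIV}"

definition l2_inner :: "wave \<Rightarrow> wave \<Rightarrow> complex" where
  "l2_inner \<phi> \<psi> = (\<Sum>\<^sub>\<infinity>x. cnj (\<phi> x) * \<psi> x)"

definition ket :: "spin \<Rightarrow> int \<Rightarrow> wave" where
  "ket \<sigma> k = (\<lambda>x. if x = (\<sigma>, k) then 1 else 0)"

definition finite_support :: "wave \<Rightarrow> bool" where
  "finite_support \<psi> \<longleftrightarrow>
     (\<exists>F c. finite F \<and> \<psi> = (\<lambda>x. \<Sum>(\<sigma>, k)\<in>F. c (\<sigma>, k) * ket \<sigma> k x))"


section \<open>The walk operator\<close>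

text \<open>The coordinate form of the operator. Its action on the basis is given by
  \<open>walk_ket_Up\<close> and \<open>walk_ket_Down\<close>, its unitarity by \<open>bij_betw_walk\<close> and \<open>l2_inner_walk\<close>;
  by \<open>walk_unique\<close> these properties determine it.\<close>

fun walk :: "real \<Rightarrow> real \<Rightarrow> (int \<Rightarrow> circle) \<Rightarrow> wave \<Rightarrow> wave" where
  "walk r t \<omega> \<psi> (Up, n) =
     circle_phase (\<omega> (2 * (n - 1))) * (t * \<psi> (Up, n - 1) - r * \<psi> (Down, n - 1))"
| "walk r t \<omega> \<psi> (Down, n) =
     circle_phase (\<omega> (2 * (n + 1) + 1)) * (r * \<psi> (Up, n + 1) + t * \<psi> (Down, n + 1))"

text \<open>Integer powers; the inverse is that of the bijection of \<open>l2\<close>.\<close>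

definition walk_power :: "real \<Rightarrow> real \<Rightarrow> (int \<Rightarrow> circle) \<Rightarrow> int \<Rightarrow> wave \<Rightarrow> wave" where
  "walk_power r t \<omega> n =
     (if n \<ge> 0 then walk r t \<omega> ^^ nat n else inv_into l2 (walk r t \<omega>) ^^ nat (- n))"

text \<open>The operator \<open>|X|\<^sup>L\<close>, where \<open>X\<close> is multiplication by the position, with its maximal domain.\<close>

definition abs_position_powr :: "real \<Rightarrow> wave \<Rightarrow> wave" where
  "abs_position_powr L \<psi> = (\<lambda>(\<sigma>, k). of_real (\<bar>of_int k\<bar> powr L) * \<psi> (\<sigma>, k))"

definition abs_position_powr_domain :: "real \<Rightarrow> wave set" where
  "abs_position_powr_domain L = {\<psi>\<in>l2. abs_position_powr L \<psi> \<in> l2}"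

text \<open>The real part only converts the type; see \<open>of_real_position_moment\<close>. For
  finitely supported \<open>\<psi>\<close> the domain condition holds by \<open>walk_power_in_domain\<close>.\<close>

definition position_moment ::
    "real \<Rightarrow> real \<Rightarrow> (int \<Rightarrow> circle) \<Rightarrow> real \<Rightarrow> wave \<Rightarrow> int \<Rightarrow> real" where
  "position_moment r t \<omega> L \<psi> n =
     Re (l2_inner \<psi> (walk_power r t \<omega> (- n) (abs_position_powr L (walk_power r t \<omega> n \<psi>))))"


section \<open>Basic properties\<close>

lemma finite_support_iff: "finite_support \<psi> \<longleftrightarrow> finite {x. \<psi> x \<noteq> 0}"
proof
  assume "finite_support \<psi>"
  then obtain F c where F: "finite F"
    and eq: "\<psi> = (\<lambda>x. \<Sum>(\<sigma>, k)\<in>F. c (\<sigma>, k) * ket \<sigma> k x)"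
    unfolding finite_support_def by blast
  have "\<psi> x = 0" if "x \<notin> F" for x
    unfolding eq by (rule sum.neutral) (use that in \<open>auto simp: ket_def\<close>)
  then have "{x. \<psi> x \<noteq> 0} \<subseteq> F" by auto
  then show "finite {x. \<psi> x \<noteq> 0}" using F by (rule finite_subset)
next
  assume fin: "finite {x. \<psi> x \<noteq> 0}"
  have "\<psi> x = (\<Sum>(\<sigma>, k)\<in>{x. \<psi> x \<noteq> 0}. \<psi> (\<sigma>, k) * ket \<sigma> k x)" for x
  proof -
    have "(\<Sum>(\<sigma>, k)\<in>{x. \<psi> x \<noteq> 0}. \<psi> (\<sigma>, k) * ket \<sigma> k x)
        = (\<Sum>y\<in>{x. \<psi> x \<noteq> 0}. if x = y then \<psi> y else 0)"
      by (rule sum.cong) (auto simp: ket_def)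
    also have "\<dots> = \<psi> x" using fin by simp
    finally show ?thesis by simp
  qed
  then show "finite_support \<psi>" unfolding finite_support_def using fin by blast
qed

lemma finite_support_l2: "finite_support \<psi> \<Longrightarrow> \<psi> \<in> l2"
  unfolding finite_support_iff l2_def mem_Collect_eq
  by (rule finite_nonzero_values_imp_summable_on) simp

lemma l2_dominated:
  assumes "\<phi> \<in> l2" "\<psi> \<in> l2" and "\<And>x. norm (\<xi> x) \<le> norm (\<phi> x) + norm (\<psi> x)"
  shows "\<xi> \<in> l2"
proof -
  have "(\<lambda>x. 2 * (norm (\<phi> x))\<^sup>2 + 2 * (norm (\<psi> x))\<^sup>2) summable_on UNIV"
    using assms(1,2) by (intro summable_on_add summable_on_cmult_right) (auto simp: l2_def)
  moreover have "(norm (\<xi> x))\<^sup>2 \<le> 2 * (norm (\<phi> x))\<^sup>2 + 2 * (norm (\<psi> x))\<^sup>2" for x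
  proof -
    have "(norm (\<xi> x))\<^sup>2 \<le> (norm (\<phi> x) + norm (\<psi> x))\<^sup>2"
      by (rule power_mono[OF assms(3)]) simp
    also have "\<dots> \<le> 2 * (norm (\<phi> x))\<^sup>2 + 2 * (norm (\<psi> x))\<^sup>2"
      using sum_squares_ge_zero[of "norm (\<phi> x) - norm (\<psi> x)" 0]
      by (simp add: power2_eq_square algebra_simps)
    finally show ?thesis .
  qed
  ultimately show ?thesis unfolding l2_def mem_Collect_eq
    by (rule summable_on_comparison_test) auto
qed

lemma l2_reindex:
  assumes "\<psi> \<in> l2" "inj h"
  shows "(\<lambda>x. \<psi> (h x)) \<in> l2"
proof -
  have "(\<lambda>x. (norm (\<psi> x))\<^sup>2) summable_on range h"
    using assms(1) unfolding l2_def by (auto intro: summable_on_subset_banach)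
  then show ?thesis
    using summable_on_reindex[OF assms(2), of "\<lambda>x. (norm (\<psi> x))\<^sup>2"]
    by (simp add: l2_def o_def)
qed

lemma l2_inner_summable:
  assumes "\<phi> \<in> l2" "\<psi> \<in> l2"
  shows "(\<lambda>x. cnj (\<phi> x) * \<psi> x) summable_on UNIV"
proof -
  have "(\<lambda>x. (norm (\<phi> x))\<^sup>2 + (norm (\<psi> x))\<^sup>2) summable_on UNIV"
    using assms by (intro summable_on_add) (auto simp: l2_def)
  moreover have "norm (cnj (\<phi> x) * \<psi> x) \<le> (norm (\<phi> x))\<^sup>2 + (norm (\<psi> x))\<^sup>2" for x
  proof -
    have "2 * (norm (\<phi> x) * norm (\<psi> x)) \<le> (norm (\<phi> x))\<^sup>2 + (norm (\<psi> x))\<^sup>2"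
      using sum_squares_bound[of "norm (\<phi> x)" "norm (\<psi> x)"] by simp
    moreover have "0 \<le> norm (\<phi> x) * norm (\<psi> x)" by simp
    ultimately show ?thesis unfolding norm_mult complex_mod_cnj by linarith
  qed
  ultimately have "(\<lambda>x. norm (cnj (\<phi> x) * \<psi> x)) summable_on UNIV"
    by (rule summable_on_comparison_test) auto
  then show ?thesis by (rule abs_summable_summable)
qed

lemma walk_ket_Up:
  "walk r t \<omega> (ket Up n) =
     (\<lambda>x. circle_phase (\<omega> (2 * n)) * t * ket Up (n + 1) x
        + circle_phase (\<omega> (2 * n + 1)) * r * ket Down (n - 1) x)"
proof
  fix x :: "spin \<times> int"
  obtain \<sigma> m where "x = (\<sigma>, m)" by (cases x)
  then show "walk r t \<omega> (ket Up n) x = circle_phase (\<omega> (2 * n)) * t * ket Up (n + 1) x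
        + circle_phase (\<omega> (2 * n + 1)) * r * ket Down (n - 1) x"
    by (cases \<sigma>) (auto simp: ket_def add.commute)
qed

lemma walk_ket_Down:
  "walk r t \<omega> (ket Down n) =
     (\<lambda>x. - circle_phase (\<omega> (2 * n)) * r * ket Up (n + 1) x
        + circle_phase (\<omega> (2 * n + 1)) * t * ket Down (n - 1) x)"
proof
  fix x :: "spin \<times> int"
  obtain \<sigma> m where "x = (\<sigma>, m)" by (cases x)
  then show "walk r t \<omega> (ket Down n) x = - circle_phase (\<omega> (2 * n)) * r * ket Up (n + 1) x
        + circle_phase (\<omega> (2 * n + 1)) * t * ket Down (n - 1) x"
    by (cases \<sigma>) (auto simp: ket_def add.commute)
qed

fun walk_adj :: "real \<Rightarrow> real \<Rightarrow> (int \<Rightarrow> circle) \<Rightarrow> wave \<Rightarrow> wave" where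
  "walk_adj r t \<omega> \<phi> (Up, n) =
     cnj (circle_phase (\<omega> (2 * n))) * t * \<phi> (Up, n + 1)
   + cnj (circle_phase (\<omega> (2 * n + 1))) * r * \<phi> (Down, n - 1)"
| "walk_adj r t \<omega> \<phi> (Down, n) =
   - cnj (circle_phase (\<omega> (2 * n))) * r * \<phi> (Up, n + 1)
   + cnj (circle_phase (\<omega> (2 * n + 1))) * t * \<phi> (Down, n - 1)"

lemma phase_cnj: "circle_phase a * cnj (circle_phase a) = 1"
  by (simp add: complex_mult_cnj cmod_power2[symmetric])

lemma rt_complex: "r\<^sup>2 + t\<^sup>2 = (1::real) \<Longrightarrow> complex_of_real r * r + complex_of_real t * t = 1"
  by (metis of_real_1 of_real_add of_real_mult power2_eq_square)

lemma walk_cancel: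
  fixes a a' b b' p q u v :: complex
  assumes "a * a' = 1" "b * b' = 1" and pq: "p * p + q * q = 1"
  shows "a' * q * (a * (q * u - p * v)) + b' * p * (b * (p * u + q * v)) = u"
    and "- a' * p * (a * (q * u - p * v)) + b' * q * (b * (p * u + q * v)) = v"
    and "a * (q * (a' * q * u + b' * p * v) - p * (- a' * p * u + b' * q * v)) = u"
    and "b * (p * (a' * q * u + b' * p * v) + q * (- a' * p * u + b' * q * v)) = v"
proof -
  have "a' * q * (a * (q * u - p * v)) + b' * p * (b * (p * u + q * v))
      = (a * a') * (q * (q * u - p * v)) + (b * b') * (p * (p * u + q * v))"
    by (simp only: ac_simps)
  also have "\<dots> = (p * p + q * q) * u" unfolding assms(1,2) by (simp add: algebra_simps)
  finally show "a' * q * (a * (q * u - p * v)) + b' * p * (b * (p * u + q * v)) = u"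
    unfolding pq by simp
  have "- a' * p * (a * (q * u - p * v)) + b' * q * (b * (p * u + q * v))
      = - (a * a') * (p * (q * u - p * v)) + (b * b') * (q * (p * u + q * v))"
    by (simp add: ac_simps)
  also have "\<dots> = (p * p + q * q) * v" unfolding assms(1,2) by (simp add: algebra_simps)
  finally show "- a' * p * (a * (q * u - p * v)) + b' * q * (b * (p * u + q * v)) = v"
    unfolding pq by simp
  have "a * (q * (a' * q * u + b' * p * v) - p * (- a' * p * u + b' * q * v))
      = (a * a') * ((p * p + q * q) * u)"
    by (simp add: algebra_simps)
  then show "a * (q * (a' * q * u + b' * p * v) - p * (- a' * p * u + b' * q * v)) = u"
    unfolding assms by simp
  have "b * (p * (a' * q * u + b' * p * v) + q * (- a' * p * u + b' * q * v))
      = (b * b') * ((p * p + q * q) * v)"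
    by (simp add: algebra_simps)
  then show "b * (p * (a' * q * u + b' * p * v) + q * (- a' * p * u + b' * q * v)) = v"
    unfolding assms by simp
qed

lemma walk_inner_cancel:
  fixes a a' b b' p q u v u' v' :: complex
  assumes "a * a' = 1" "b * b' = 1" and pq: "p * p + q * q = 1"
  shows "a' * (q * u' - p * v') * (a * (q * u - p * v))
       + b' * (p * u' + q * v') * (b * (p * u + q * v)) = u' * u + v' * v"
proof -
  have "a' * (q * u' - p * v') * (a * (q * u - p * v))
       + b' * (p * u' + q * v') * (b * (p * u + q * v))
      = (a * a') * ((q * u' - p * v') * (q * u - p * v))
       + (b * b') * ((p * u' + q * v') * (p * u + q * v))"
    by (simp only: ac_simps)
  also have "\<dots> = (p * p + q * q) * (u' * u + v' * v)"
    unfolding assms(1,2) by (simp add: algebra_simps)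
  finally show ?thesis unfolding pq by simp
qed

lemma walk_adj_walk:
  assumes "r\<^sup>2 + t\<^sup>2 = 1"
  shows "walk_adj r t \<omega> (walk r t \<omega> \<psi>) = \<psi>"
proof
  fix x :: "spin \<times> int"
  obtain \<sigma> n where x: "x = (\<sigma>, n)" by (cases x)
  note c = walk_cancel(1,2)[OF phase_cnj phase_cnj rt_complex[OF assms]]
  have "n + 1 - 1 = n" "n - 1 + 1 = n" by simp_all
  then show "walk_adj r t \<omega> (walk r t \<omega> \<psi>) x = \<psi> x"
    unfolding x by (cases \<sigma>) (simp_all only: walk.simps walk_adj.simps c)
qed

lemma walk_walk_adj:
  assumes "r\<^sup>2 + t\<^sup>2 = 1"
  shows "walk r t \<omega> (walk_adj r t \<omega> \<phi>) = \<phi>"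
proof
  fix x :: "spin \<times> int"
  obtain \<sigma> n where x: "x = (\<sigma>, n)" by (cases x)
  note c = walk_cancel(3,4)[OF phase_cnj phase_cnj rt_complex[OF assms]]
  have "n + 1 - 1 = n" "n - 1 + 1 = n" by simp_all
  then show "walk r t \<omega> (walk_adj r t \<omega> \<phi>) x = \<phi> x"
    unfolding x by (cases \<sigma>) (simp_all only: walk.simps walk_adj.simps c)
qed

lemma walk_l2:
  assumes "\<psi> \<in> l2" and rt: "\<bar>r\<bar> \<le> 1" "\<bar>t\<bar> \<le> 1"
  shows "walk r t \<omega> \<psi> \<in> l2"
proof -
  let ?h = "\<lambda>(\<sigma>, n::int). (\<sigma>, if \<sigma> = Up then n - 1 else n + 1)"
  let ?g = "\<lambda>(\<sigma>, n::int). (if \<sigma> = Up then Down else Up, if \<sigma> = Up then n - 1 else n + 1)"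
  have "inj ?h" "inj ?g" by (auto simp: inj_on_def split: if_splits) (metis spin.exhaust)+
  then have "(\<lambda>x. \<psi> (?h x)) \<in> l2" "(\<lambda>x. \<psi> (?g x)) \<in> l2"
    using l2_reindex[OF assms(1)] by blast+
  then show ?thesis
  proof (rule l2_dominated)
    fix x :: "spin \<times> int"
    obtain \<sigma> n where x: "x = (\<sigma>, n)" by (cases x)
    have b: "norm (complex_of_real a * z) \<le> norm z" if "\<bar>a\<bar> \<le> 1" for a z
      using that by (simp add: norm_mult mult_left_le_one_le)
    show "norm (walk r t \<omega> \<psi> x) \<le> norm (\<psi> (?h x)) + norm (\<psi> (?g x))"
    proof (cases \<sigma>)
      case Up
      have "norm (t * \<psi> (Up, n - 1) - r * \<psi> (Down, n - 1))
            \<le> norm (\<psi> (Up, n - 1)) + norm (\<psi> (Down, n - 1))"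
        by (rule order_trans[OF norm_triangle_ineq4 add_mono[OF b b]]) (use rt in auto)
      then show ?thesis using Up x by (simp add: norm_mult)
    next
      case Down
      have "norm (r * \<psi> (Up, n + 1) + t * \<psi> (Down, n + 1))
            \<le> norm (\<psi> (Up, n + 1)) + norm (\<psi> (Down, n + 1))"
        by (rule order_trans[OF norm_triangle_ineq add_mono[OF b b]]) (use rt in auto)
      then show ?thesis using Down x by (simp add: norm_mult)
    qed
  qed
qed

lemma walk_adj_l2:
  assumes "\<phi> \<in> l2" and rt: "\<bar>r\<bar> \<le> 1" "\<bar>t\<bar> \<le> 1"
  shows "walk_adj r t \<omega> \<phi> \<in> l2"
proof -
  let ?s = "\<lambda>(\<sigma>, n::int). (\<sigma>, if \<sigma> = Up then n + 1 else n - 1)"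
  let ?g = "\<lambda>(\<sigma>, n::int). (if \<sigma> = Up then Down else Up, if \<sigma> = Up then n - 1 else n + 1)"
  have "inj ?s" "inj ?g" by (auto simp: inj_on_def split: if_splits) (metis spin.exhaust)+
  then have "(\<lambda>x. \<phi> (?s x)) \<in> l2" "(\<lambda>x. \<phi> (?g x)) \<in> l2"
    using l2_reindex[OF assms(1)] by blast+
  then show ?thesis
  proof (rule l2_dominated)
    fix x :: "spin \<times> int"
    obtain \<sigma> n where x: "x = (\<sigma>, n)" by (cases x)
    have b: "norm (cnj (circle_phase c) * complex_of_real a * z) \<le> norm z" if "\<bar>a\<bar> \<le> 1" for a z c
      using that by (simp add: norm_mult mult_left_le_one_le)
    have b': "norm (- cnj (circle_phase c) * complex_of_real a * z) \<le> norm z" if "\<bar>a\<bar> \<le> 1" for a z c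
      using that by (simp add: norm_mult mult_left_le_one_le)
    show "norm (walk_adj r t \<omega> \<phi> x) \<le> norm (\<phi> (?s x)) + norm (\<phi> (?g x))"
    proof (cases \<sigma>)
      case Up
      have "norm (walk_adj r t \<omega> \<phi> (Up, n)) \<le> norm (\<phi> (Up, n + 1)) + norm (\<phi> (Down, n - 1))"
        unfolding walk_adj.simps
        by (rule order_trans[OF norm_triangle_ineq add_mono[OF b b]]) (use rt in auto)
      then show ?thesis using Up x by simp
    next
      case Down
      have "norm (walk_adj r t \<omega> \<phi> (Down, n)) \<le> norm (\<phi> (Up, n + 1)) + norm (\<phi> (Down, n - 1))"
        unfolding walk_adj.simps
        by (rule order_trans[OF norm_triangle_ineq add_mono[OF b' b]]) (use rt in auto)
      then show ?thesis using Down x by simp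
    qed
  qed
qed

lemma rt_le_one: "r\<^sup>2 + t\<^sup>2 = (1::real) \<Longrightarrow> \<bar>r\<bar> \<le> 1 \<and> \<bar>t\<bar> \<le> 1"
  unfolding abs_square_le_1[symmetric] using zero_le_power2[of r] zero_le_power2[of t] by linarith

lemma bij_betw_walk:
  assumes "r\<^sup>2 + t\<^sup>2 = 1"
  shows "bij_betw (walk r t \<omega>) l2 l2"
proof (rule bij_betw_byWitness[where f' = "walk_adj r t \<omega>"])
  note le = rt_le_one[OF assms, THEN conjunct1] rt_le_one[OF assms, THEN conjunct2]
  show "\<forall>\<psi>\<in>l2. walk_adj r t \<omega> (walk r t \<omega> \<psi>) = \<psi>"
    using walk_adj_walk[OF assms] by blast
  show "\<forall>\<phi>\<in>l2. walk r t \<omega> (walk_adj r t \<omega> \<phi>) = \<phi>"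
    using walk_walk_adj[OF assms] by blast
  show "walk r t \<omega> ` l2 \<subseteq> l2" using walk_l2[OF _ le] by blast
  show "walk_adj r t \<omega> ` l2 \<subseteq> l2" using walk_adj_l2[OF _ le] by blast
qed

lemma UNIV_spin_int: "(UNIV :: (spin \<times> int) set) = range (Pair Up) \<union> range (Pair Down)"
  by (auto simp: image_iff) (metis spin.exhaust)

lemma infsum_spin_int:
  fixes f :: "spin \<times> int \<Rightarrow> complex"
  assumes "f summable_on UNIV"
  shows "infsum f UNIV = (\<Sum>\<^sub>\<infinity>n. f (Up, n + a) + f (Down, n + b))"
proof -
  have s: "f summable_on A" for A using assms by (rule summable_on_subset_banach) simp
  have r: "range (Pair \<sigma>) = range (\<lambda>n. (\<sigma>, n + c))" for \<sigma> :: spin and c :: int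
    by (auto simp: image_iff) (metis diff_add_cancel)
  have i: "inj (\<lambda>n. (\<sigma>, n + c))" for \<sigma> :: spin and c :: int by (auto simp: inj_on_def)
  have "infsum f UNIV = infsum f (range (Pair Up)) + infsum f (range (Pair Down))"
    unfolding UNIV_spin_int by (rule infsum_Un_disjoint) (auto intro: s)
  also have "\<dots> = infsum (\<lambda>n. f (Up, n + a)) UNIV + infsum (\<lambda>n. f (Down, n + b)) UNIV"
    unfolding r[of Up a] r[of Down b] by (simp add: infsum_reindex[OF i] o_def)
  also have "\<dots> = (\<Sum>\<^sub>\<infinity>n. f (Up, n + a) + f (Down, n + b))"
    by (rule infsum_add[symmetric])
      (use s[of "range (\<lambda>n. (Up, n + a))"] s[of "range (\<lambda>n. (Down, n + b))"] in
        \<open>simp_all add: summable_on_reindex[OF i] o_def\<close>)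
  finally show ?thesis .
qed

lemma l2_inner_walk:
  assumes rt: "r\<^sup>2 + t\<^sup>2 = 1" and "\<phi> \<in> l2" "\<psi> \<in> l2"
  shows "l2_inner (walk r t \<omega> \<phi>) (walk r t \<omega> \<psi>) = l2_inner \<phi> \<psi>"
proof -
  let ?f = "\<lambda>x. cnj (walk r t \<omega> \<phi> x) * walk r t \<omega> \<psi> x"
  let ?g = "\<lambda>x. cnj (\<phi> x) * \<psi> x"
  have "?f summable_on UNIV" "?g summable_on UNIV"
    using assms rt_le_one[OF rt] by (auto intro!: l2_inner_summable walk_l2)
  note * = infsum_spin_int[OF this(1), of 1 "-1"] infsum_spin_int[OF this(2), of 0 0]
  have "?f (Up, n + 1) + ?f (Down, n + -1) = ?g (Up, n + 0) + ?g (Down, n + 0)" for n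
    using walk_inner_cancel[OF phase_cnj phase_cnj rt_complex[OF rt],
        of "\<omega> (2 * n)" "cnj (\<phi> (Up, n))" "cnj (\<phi> (Down, n))" "\<psi> (Up, n)" "\<psi> (Down, n)"
          "\<omega> (2 * n + 1)"]
    by simp
  then show ?thesis unfolding l2_inner_def * by simp
qed

lemma l2_inner_ket: "l2_inner (ket \<sigma> k) \<psi> = \<psi> (\<sigma>, k)"
proof -
  have "(\<Sum>\<^sub>\<infinity>x. cnj (ket \<sigma> k x) * \<psi> x) = (\<Sum>\<^sub>\<infinity>x\<in>{(\<sigma>, k)}. cnj (ket \<sigma> k x) * \<psi> x)"
    by (rule infsum_cong_neutral) (auto simp: ket_def)
  then show ?thesis by (simp add: l2_inner_def ket_def)
qed

lemma ket_l2: "ket \<sigma> k \<in> l2"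
  by (rule finite_support_l2) (simp add: finite_support_iff ket_def)

lemma walk_unique:
  assumes rt: "r\<^sup>2 + t\<^sup>2 = 1"
    and V: "V ` l2 \<subseteq> l2" "\<And>\<phi> \<psi>. \<phi> \<in> l2 \<Longrightarrow> \<psi> \<in> l2 \<Longrightarrow> l2_inner (V \<phi>) (V \<psi>) = l2_inner \<phi> \<psi>"
    and ket: "\<And>\<sigma> k. V (ket \<sigma> k) = walk r t \<omega> (ket \<sigma> k)"
    and \<psi>: "\<psi> \<in> l2"
  shows "V \<psi> = walk r t \<omega> \<psi>"
proof -
  let ?\<xi> = "walk_adj r t \<omega> (V \<psi>)"
  have "V \<psi> \<in> l2" using V(1) \<psi> by blast
  then have \<xi>: "?\<xi> \<in> l2" "walk r t \<omega> ?\<xi> = V \<psi>"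
    using rt rt_le_one[OF rt] by (auto intro!: walk_adj_l2 simp: walk_walk_adj)
  have "\<psi> (\<sigma>, k) = ?\<xi> (\<sigma>, k)" for \<sigma> k
  proof -
    have "\<psi> (\<sigma>, k) = l2_inner (V (ket \<sigma> k)) (V \<psi>)"
      using V(2) ket_l2 \<psi> by (simp add: l2_inner_ket)
    also have "\<dots> = l2_inner (walk r t \<omega> (ket \<sigma> k)) (walk r t \<omega> ?\<xi>)"
      using \<xi>(2) ket by simp
    also have "\<dots> = ?\<xi> (\<sigma>, k)"
      using l2_inner_walk[OF rt ket_l2 \<xi>(1)] by (simp add: l2_inner_ket)
    finally show ?thesis .
  qed
  then have "\<psi> = ?\<xi>" by auto
  then show ?thesis using \<xi>(2) by simp
qed

lemma inv_into_walk:
  assumes "r\<^sup>2 + t\<^sup>2 = 1" "\<psi> \<in> l2"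
  shows "inv_into l2 (walk r t \<omega>) \<psi> = walk_adj r t \<omega> \<psi>"
  using assms rt_le_one[OF assms(1)] bij_betw_walk[OF assms(1), of \<omega>]
  by (intro inv_into_f_eq) (auto intro!: walk_adj_l2 simp: bij_betw_def walk_walk_adj)

lemma inv_into_walk_l2:
  assumes "r\<^sup>2 + t\<^sup>2 = 1" "\<psi> \<in> l2"
  shows "inv_into l2 (walk r t \<omega>) \<psi> \<in> l2"
  using assms rt_le_one[OF assms(1)] by (simp add: inv_into_walk walk_adj_l2)

lemma walk_power_l2:
  assumes "r\<^sup>2 + t\<^sup>2 = 1" "\<psi> \<in> l2"
  shows "walk_power r t \<omega> n \<psi> \<in> l2"
proof -
  have "(walk r t \<omega> ^^ m) \<psi> \<in> l2" for m
    using assms rt_le_one[OF assms(1)] by (induction m) (auto intro: walk_l2)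
  moreover have "(inv_into l2 (walk r t \<omega>) ^^ m) \<psi> \<in> l2" for m
    using assms by (induction m) (auto intro: inv_into_walk_l2)
  ultimately show ?thesis by (simp add: walk_power_def)
qed

lemma l2_inner_walk_power:
  assumes rt: "r\<^sup>2 + t\<^sup>2 = 1" and "\<phi> \<in> l2" "\<psi> \<in> l2"
  shows "l2_inner \<phi> (walk_power r t \<omega> (- n) \<psi>) = l2_inner (walk_power r t \<omega> n \<phi>) \<psi>"
proof -
  let ?U = "walk r t \<omega>" and ?V = "inv_into l2 (walk r t \<omega>)"
  have U: "(?U ^^ m) \<xi> \<in> l2" if "\<xi> \<in> l2" for m \<xi>
    using walk_power_l2[OF rt that, of \<omega> "int m"] by (simp add: walk_power_def)
  have V: "(?V ^^ m) \<xi> \<in> l2" if "\<xi> \<in> l2" for m \<xi>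
    using that rt by (induction m) (auto intro: inv_into_walk_l2)
  have UV: "?U (?V \<xi>) = \<xi>" if "\<xi> \<in> l2" for \<xi>
    using that rt by (simp add: inv_into_walk walk_walk_adj)
  have 1: "l2_inner \<phi> (?V \<psi>) = l2_inner (?U \<phi>) \<psi>" if "\<phi> \<in> l2" "\<psi> \<in> l2" for \<phi> \<psi>
    using l2_inner_walk[OF rt that(1) inv_into_walk_l2[OF rt that(2)], of \<omega> \<omega>] UV that by simp
  have 2: "l2_inner \<phi> (?U \<psi>) = l2_inner (?V \<phi>) \<psi>" if "\<phi> \<in> l2" "\<psi> \<in> l2" for \<phi> \<psi>
    using l2_inner_walk[OF rt inv_into_walk_l2[OF rt that(1)] that(2), of \<omega> \<omega>] UV that by simp
  have "l2_inner \<phi> ((?V ^^ m) \<psi>) = l2_inner ((?U ^^ m) \<phi>) \<psi>" if "\<phi> \<in> l2" for m \<phi>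
    using that
  proof (induction m arbitrary: \<phi>)
    case (Suc m)
    then show ?case using 1[OF Suc.prems V[OF assms(3)]] U[OF Suc.prems, of 1]
      by (simp add: funpow_swap1)
  qed simp
  moreover have "l2_inner \<phi> ((?U ^^ m) \<psi>) = l2_inner ((?V ^^ m) \<phi>) \<psi>" if "\<phi> \<in> l2" for m \<phi>
    using that
  proof (induction m arbitrary: \<phi>)
    case (Suc m)
    then show ?case using 2[OF Suc.prems U[OF assms(3)]] V[OF Suc.prems, of 1]
      by (simp add: funpow_swap1)
  qed simp
  ultimately show ?thesis using assms(2) by (cases "n > 0"; cases "n = 0") (auto simp: walk_power_def)
qed

lemma finite_support_walk:
  assumes "finite_support \<psi>"
  shows "finite_support (walk r t \<omega> \<psi>)"
proof -
  let ?S = "{x. \<psi> x \<noteq> 0}"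
  have "{x. walk r t \<omega> \<psi> x \<noteq> 0} \<subseteq> (\<lambda>(\<sigma>, n). (Up, n + 1)) ` ?S \<union> (\<lambda>(\<sigma>, n). (Down, n - 1)) ` ?S"
    (is "_ \<subseteq> ?T")
  proof
    fix x assume "x \<in> {x. walk r t \<omega> \<psi> x \<noteq> 0}"
    then have nz: "walk r t \<omega> \<psi> x \<noteq> 0" by simp
    obtain \<sigma> n where x: "x = (\<sigma>, n)" by (cases x)
    define m where "m = (if \<sigma> = Up then n - 1 else n + 1)"
    have "(Up, m) \<in> ?S \<or> (Down, m) \<in> ?S"
      using nz unfolding x m_def by (cases \<sigma>) auto
    then show "x \<in> ?T"
      unfolding x by (cases \<sigma>) (force simp: m_def)+
  qed
  then show ?thesis
    using assms unfolding finite_support_iff by (auto intro: finite_subset)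
qed

lemma finite_support_walk_adj:
  assumes "finite_support \<psi>"
  shows "finite_support (walk_adj r t \<omega> \<psi>)"
proof -
  let ?S = "{x. \<psi> x \<noteq> 0}"
  let ?T = "(\<lambda>x. (Up, snd x + 1)) ` ?S \<union> (\<lambda>x. (Up, snd x - 1)) ` ?S
    \<union> (\<lambda>x. (Down, snd x + 1)) ` ?S \<union> (\<lambda>x. (Down, snd x - 1)) ` ?S"
  have "{x. walk_adj r t \<omega> \<psi> x \<noteq> 0} \<subseteq> ?T"
  proof
    fix x assume "x \<in> {x. walk_adj r t \<omega> \<psi> x \<noteq> 0}"
    then have nz: "walk_adj r t \<omega> \<psi> x \<noteq> 0" by simp
    obtain \<sigma> n where x: "x = (\<sigma>, n)" by (cases x)
    have "(Up, n + 1) \<in> ?S \<or> (Down, n - 1) \<in> ?S"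
      using nz unfolding x by (cases \<sigma>) auto
    then show "x \<in> ?T"
      unfolding x by (cases \<sigma>) (force simp: image_iff)+
  qed
  then show ?thesis
    using assms unfolding finite_support_iff by (auto intro: finite_subset)
qed

lemma finite_support_walk_power:
  assumes rt: "r\<^sup>2 + t\<^sup>2 = 1" and "finite_support \<psi>"
  shows "finite_support (walk_power r t \<omega> n \<psi>)"
proof -
  have "finite_support ((walk r t \<omega> ^^ m) \<psi>)" for m
    using assms(2) by (induction m) (auto intro: finite_support_walk)
  moreover have "finite_support ((inv_into l2 (walk r t \<omega>) ^^ m) \<psi>)" for m
    by (induction m)
      (use assms in \<open>auto simp: inv_into_walk finite_support_l2 intro: finite_support_walk_adj\<close>)
  ultimately show ?thesis by (simp add: walk_power_def)
qed

lemma finite_support_abs_position_powr: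
  "finite_support \<psi> \<Longrightarrow> finite_support (abs_position_powr L \<psi>)"
  unfolding finite_support_iff abs_position_powr_def by (erule rev_finite_subset) auto

lemma walk_power_in_domain:
  assumes "r\<^sup>2 + t\<^sup>2 = 1" "finite_support \<psi>"
  shows "walk_power r t \<omega> n \<psi> \<in> abs_position_powr_domain L"
  using assms unfolding abs_position_powr_domain_def
  by (auto intro!: finite_support_l2 finite_support_abs_position_powr finite_support_walk_power)

lemma of_real_position_moment:
  assumes rt: "r\<^sup>2 + t\<^sup>2 = 1" and "finite_support \<psi>"
  shows "of_real (position_moment r t \<omega> L \<psi> n) =
     l2_inner \<psi> (walk_power r t \<omega> (- n) (abs_position_powr L (walk_power r t \<omega> n \<psi>)))"
proof -
  let ?\<phi> = "walk_power r t \<omega> n \<psi>"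
  have "?\<phi> \<in> abs_position_powr_domain L" using assms by (rule walk_power_in_domain)
  then have "l2_inner \<psi> (walk_power r t \<omega> (- n) (abs_position_powr L ?\<phi>))
      = l2_inner ?\<phi> (abs_position_powr L ?\<phi>)"
    using assms by (intro l2_inner_walk_power)
      (auto simp: abs_position_powr_domain_def finite_support_l2)
  also have "\<dots> = (\<Sum>\<^sub>\<infinity>x. of_real (\<bar>of_int (snd x)\<bar> powr L * (norm (?\<phi> x))\<^sup>2))"
    unfolding l2_inner_def
  proof (rule infsum_cong)
    fix x :: "spin \<times> int"
    show "cnj (?\<phi> x) * abs_position_powr L ?\<phi> x
        = of_real (\<bar>of_int (snd x)\<bar> powr L * (norm (?\<phi> x))\<^sup>2)"
      using complex_norm_square[of "?\<phi> x"]
      by (cases x) (simp add: abs_position_powr_def mult_ac)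
  qed
  also have "\<dots> = (\<Sum>\<^sub>\<infinity>x\<in>{x. ?\<phi> x \<noteq> 0}. of_real (\<bar>of_int (snd x)\<bar> powr L * (norm (?\<phi> x))\<^sup>2))"
    by (rule infsum_cong_neutral) auto
  also have "\<dots> = of_real (\<Sum>x\<in>{x. ?\<phi> x \<noteq> 0}. \<bar>of_int (snd x)\<bar> powr L * (norm (?\<phi> x))\<^sup>2)"
    using finite_support_walk_power[OF assms, of \<omega> n] by (simp add: finite_support_iff)
  finally show ?thesis unfolding position_moment_def by simp
qed

end

(* Cut open at the source, the walk falls apart into two half lines. Their reflection coefficients
   R_k(s), as functions of the reciprocal s of the spectral parameter, are obtained from R_(k+1)(s)
   by a disc automorphism composed with rotations by two random phases, and the transmission
   amplitude over k sites is, in modulus, the square root of the derivative of the composition of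
   these automorphisms. Averaging such half-densities over independent phases with bounded density
   is a contraction on L^2 of the circle: the averaging over rotations has a spectral gap, and the
   constants are not invariant under the automorphism. Hence the expected amplitude decays
   exponentially in k.

   If phi_s is the wave emitted by the source, f(s) the amplitude returning to it, and lambda the
   phase at the source, then the resolvent is phi_s / (1 - lambda f(s)), and U^n is its n-th Taylor
   coefficient in s. On |s| = 1 the function f has modulus one (behind a distant site the wave is
   totally reflected) and cnj(phi_s) f is the boundary value of an analytic function vanishing at 0.
   The factor 1 / (1 - lambda f) may therefore be replaced by the Poisson kernel at lambda f, which
   is positive and has mean one in lambda. This bounds the mean over lambda of sup_n |<y, U^n x>|
   by the integral of |phi_s(y)| over the circle. *)

theory Submission
  imports Defs "HOL-Complex_Analysis.Cauchy_Integral_Formula"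
begin

text \<open>The distant reflector makes all amplitudes rational in s with no pole in the closed
  disc, and it gives |f| = 1 on the whole circle. The value of U^n x at y agrees with that on the
  infinite line as long as n and the distance of y from the source are small against the number M of
  sites, and no bound depends on M.

  The supremum over n has to be taken before the expectation. Absolute values in 1 / (1 - lambda f)
  would be useless, because 1 / |1 - lambda| is not integrable over the circle; adding an
  antianalytic term without constant part alters no Taylor coefficient in s and leaves an integrable
  kernel. This calculus needs |lambda| < 1, so lambda is approached from inside the disc. Neither
  phi_s nor f contains the phase at the source, which lets the mean over lambda be taken first.

  The gap of one average acts only on functions orthogonal to the constants. A site therefore uses
  both of its averages: one shortens what is orthogonal to the constants, and since the automorphism
  turns constants partly into such functions, the other shortens the rest.\<close>

section \<open>The uniform distribution on the unit circle\<close>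

text \<open>A measure on the whole plane, carried by the circle: products of phases and analytic
  functions then need no coercion, and identities valid for \<open>norm z = 1\<close> hold almost
  everywhere.\<close>

definition haar :: "complex measure" where
  "haar = distr (density lborel (indicator {0..<1})) borel (\<lambda>x. cis (2 * pi * x))"

lemma sets_haar [simp, measurable_cong]: "sets haar = sets borel"
  by (simp add: haar_def)

lemma space_haar [simp]: "space haar = UNIV"
  by (simp add: haar_def)

lemma measurable_cis_2pi [measurable]: "(\<lambda>x::real. cis (2 * pi * x)) \<in> borel_measurable borel"
  by (intro borel_measurable_continuous_onI continuous_intros)

lemma measurable_cnj [measurable]: "cnj \<in> borel_measurable borel"
  by (intro borel_measurable_continuous_onI continuous_intros)

lemma nn_integral_haar:
  assumes [measurable]: "F \<in> borel_measurable borel"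
  shows "(\<integral>\<^sup>+z. F z \<partial>haar) = (\<integral>\<^sup>+x. F (cis (2 * pi * x)) * indicator {0..<1} x \<partial>lborel)"
  unfolding haar_def
  by (subst nn_integral_distr, measurable, subst nn_integral_density) (auto intro!: nn_integral_cong simp: indicator_def)

lemma prob_space_haar: "prob_space haar"
proof
  have "emeasure haar (space haar) = (\<integral>\<^sup>+z. 1 \<partial>haar)" by simp
  also have "\<dots> = (\<integral>\<^sup>+x. indicator {0..<1::real} x \<partial>lborel)"
    by (subst nn_integral_haar) auto
  also have "\<dots> = 1" by (simp add: nn_integral_indicator)
  finally show "emeasure haar (space haar) = 1" .
qed

interpretation haar: prob_space haar by (rule prob_space_haar)

lemma AE_haar_norm: "AE z in haar. norm z = 1"
  unfolding haar_def by (subst AE_distr_iff) auto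

lemma nn_integral_haar_cong:
  "(\<And>z. norm z = 1 \<Longrightarrow> F z = G z) \<Longrightarrow> (\<integral>\<^sup>+z. F z \<partial>haar) = (\<integral>\<^sup>+z. G z \<partial>haar)"
  using AE_haar_norm by (intro nn_integral_cong_AE) auto

lemma nn_integral_haar_rotate:
  assumes [measurable]: "F \<in> borel_measurable borel" and c: "norm c = 1"
  shows "(\<integral>\<^sup>+z. F (c * z) \<partial>haar) = (\<integral>\<^sup>+z. F z \<partial>haar)"
proof -
  define d where "d = frac (Arg c / (2 * pi))"
  have d: "0 \<le> d" "d < 1" by (auto simp: d_def frac_lt_1)
  have "c = cis (Arg c)" using c cis_Arg[of c] by (cases "c = 0") (auto simp: sgn_div_norm)
  also have "\<dots> = cis (2 * pi * d)"
  proof -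
    have "Arg c = 2 * pi * d + 2 * pi * of_int \<lfloor>Arg c / (2 * pi)\<rfloor>"
      by (simp add: d_def frac_def field_simps)
    then have "cis (Arg c) = cis (2 * pi * d) * cis (2 * pi * of_int \<lfloor>Arg c / (2 * pi)\<rfloor>)"
      by (metis cis_mult)
    then show ?thesis by (simp add: cis_multiple_2pi)
  qed
  finally have cd: "c = cis (2 * pi * d)" .
  define G where "G = (\<lambda>x. F (cis (2 * pi * x)))"
  have [measurable]: "G \<in> borel_measurable borel" unfolding G_def by measurable
  have per: "G (x + 1) = G x" for x
    by (simp add: G_def distrib_left cis_mult[symmetric])
  have "(\<integral>\<^sup>+z. F (c * z) \<partial>haar) = (\<integral>\<^sup>+x. G (d + x) * indicator {0..<1} x \<partial>lborel)"
    by (subst nn_integral_haar) (auto simp: G_def cd cis_mult distrib_left)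
  also have "\<dots> = (\<integral>\<^sup>+x. G (d + x) * indicator {d..<d + 1} (d + x) \<partial>lborel)"
    by (rule nn_integral_cong) (auto simp: indicator_def)
  also have "\<dots> = (\<integral>\<^sup>+x. G x * indicator {d..<d + 1} x \<partial>lborel)"
    by (subst (2) nn_integral_real_affine[where c = 1 and t = d]) auto
  \<comment> \<open>The window of length one is cut at 1; the piece beyond 1 is moved back by one
    period and fills \<open>{0..<d}\<close>.\<close>
  also have "\<dots> = (\<integral>\<^sup>+x. G x * indicator {d..<1} x + G x * indicator {1..<d + 1} x \<partial>lborel)"
    using d by (intro nn_integral_cong) (auto simp: indicator_def)
  also have "\<dots> = (\<integral>\<^sup>+x. G x * indicator {d..<1} x \<partial>lborel) + (\<integral>\<^sup>+x. G x * indicator {1..<d + 1} x \<partial>lborel)"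
    by (rule nn_integral_add) auto
  also have "(\<integral>\<^sup>+x. G x * indicator {1..<d + 1} x \<partial>lborel) = (\<integral>\<^sup>+x. G (1 + x) * indicator {1..<d + 1} (1 + x) \<partial>lborel)"
    by (subst nn_integral_real_affine[where c = 1 and t = 1]) auto
  also have "\<dots> = (\<integral>\<^sup>+x. G x * indicator {0..<d} x \<partial>lborel)"
    using per by (intro nn_integral_cong) (auto simp: indicator_def add.commute)
  also have "(\<integral>\<^sup>+x. G x * indicator {d..<1} x \<partial>lborel) + \<dots>
      = (\<integral>\<^sup>+x. G x * indicator {d..<1} x + G x * indicator {0..<d} x \<partial>lborel)"
    by (rule nn_integral_add[symmetric]) auto
  also have "\<dots> = (\<integral>\<^sup>+x. G x * indicator {0..<1} x \<partial>lborel)"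
    using d by (intro nn_integral_cong) (auto simp: indicator_def)
  also have "\<dots> = (\<integral>\<^sup>+z. F z \<partial>haar)"
    by (subst nn_integral_haar) (auto simp: G_def)
  finally show ?thesis .
qed

text \<open>Rotation invariance characterises the uniform distribution, so it is preserved by every
  map that intertwines a transitive family of rotations with rotations.\<close>

lemma nn_integral_haar_equivariant:
  assumes [measurable]: "F \<in> borel_measurable borel" "h \<in> borel_measurable borel"
    and h: "\<And>z. norm z = 1 \<Longrightarrow> norm (h z) = 1"
    and eq: "\<And>w. norm w = 1 \<Longrightarrow> \<exists>e. norm e = 1 \<and> (\<forall>z. norm z = 1 \<longrightarrow> h (e * z) = w * h z)"
  shows "(\<integral>\<^sup>+z. F (h z) \<partial>haar) = (\<integral>\<^sup>+z. F z \<partial>haar)"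
proof -
  interpret pair_sigma_finite haar haar ..
  \<comment> \<open>An idle average over \<open>w\<close> is inserted. After Fubini \<open>w\<close>
    is the uniform variable, and \<open>h z\<close>, of modulus one, merely rotates it.\<close>
  have "(\<integral>\<^sup>+z. F (h z) \<partial>haar) = (\<integral>\<^sup>+w. (\<integral>\<^sup>+z. F (h z) \<partial>haar) \<partial>haar)"
    by (simp add: haar.emeasure_space_1[simplified])
  also have "\<dots> = (\<integral>\<^sup>+w. (\<integral>\<^sup>+z. F (w * h z) \<partial>haar) \<partial>haar)"
  proof (rule nn_integral_haar_cong)
    fix w :: complex assume "norm w = 1"
    from eq[OF this] obtain e where e: "norm e = 1" "\<And>z. norm z = 1 \<Longrightarrow> h (e * z) = w * h z"
      by blast
    have "(\<integral>\<^sup>+z. F (h z) \<partial>haar) = (\<integral>\<^sup>+z. F (h (e * z)) \<partial>haar)"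
      by (rule nn_integral_haar_rotate[OF _ e(1), symmetric]) measurable
    also have "\<dots> = (\<integral>\<^sup>+z. F (w * h z) \<partial>haar)"
      by (rule nn_integral_haar_cong) (simp add: e)
    finally show "(\<integral>\<^sup>+z. F (h z) \<partial>haar) = (\<integral>\<^sup>+z. F (w * h z) \<partial>haar)" .
  qed
  also have "\<dots> = (\<integral>\<^sup>+z. (\<integral>\<^sup>+w. F (w * h z) \<partial>haar) \<partial>haar)"
    by (rule Fubini') measurable
  also have "\<dots> = (\<integral>\<^sup>+z. (\<integral>\<^sup>+w. F w \<partial>haar) \<partial>haar)"
    by (rule nn_integral_haar_cong, subst mult.commute, rule nn_integral_haar_rotate) (auto simp: h)
  also have "\<dots> = (\<integral>\<^sup>+z. F z \<partial>haar)"
    by (simp add: haar.emeasure_space_1[simplified])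
  finally show ?thesis .
qed

lemma nn_integral_haar_cnj:
  assumes [measurable]: "F \<in> borel_measurable borel"
  shows "(\<integral>\<^sup>+z. F (cnj z) \<partial>haar) = (\<integral>\<^sup>+z. F z \<partial>haar)"
proof (rule nn_integral_haar_equivariant)
  show "\<exists>e. norm e = 1 \<and> (\<forall>z. norm z = 1 \<longrightarrow> cnj (e * z) = w * cnj z)" if "norm w = 1" for w
    using that by (intro exI[of _ "cnj w"]) auto
qed auto

lemma nn_integral_haar_power:
  assumes [measurable]: "F \<in> borel_measurable borel" and N: "N > 0"
  shows "(\<integral>\<^sup>+z. F (z ^ N) \<partial>haar) = (\<integral>\<^sup>+z. F z \<partial>haar)"
proof (rule nn_integral_haar_equivariant)
  show "\<exists>e. norm e = 1 \<and> (\<forall>z. norm z = 1 \<longrightarrow> (e * z) ^ N = w * z ^ N)" if "norm w = 1" for w :: complex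
  proof -
    have "cis (Arg w / N) ^ N = cis (Arg w)" unfolding Complex.DeMoivre using N by simp
    also have "\<dots> = w" using that cis_Arg[of w] by (cases "w = 0") (auto simp: sgn_div_norm)
    finally show ?thesis by (intro exI[of _ "cis (Arg w / N)"]) (simp add: power_mult_distrib)
  qed
qed (auto simp: norm_power)

lemma integrable_haar_bounded:
  fixes F :: "complex \<Rightarrow> 'a::{banach, second_countable_topology}"
  assumes "F \<in> borel_measurable borel" "\<And>z. norm z = 1 \<Longrightarrow> norm (F z) \<le> B"
  shows "integrable haar F"
  using AE_haar_norm assms by (intro haar.integrable_const_bound[of _ B]) auto

text \<open>Analyticity enters through this mean value property: it identifies Taylor coefficients
  with means over the circle, makes antianalytic terms without constant part vanish, and gives the
  Poisson kernel mean one.\<close>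

lemma integral_haar_mean_value:
  assumes [measurable]: "F \<in> borel_measurable borel"
    and cont: "continuous_on (cball 0 1) F" and hol: "F holomorphic_on ball 0 1"
  shows "(LINT z|haar. F z) = F 0"
proof -
  define G where "G = (\<lambda>x. F (cis (2 * pi * x)))"
  have cG: "continuous_on {0..1} G"
    unfolding G_def by (rule continuous_on_compose2[OF cont]) (auto intro!: continuous_intros)
  have "((\<lambda>u. F u / (u - 0)) has_contour_integral (2 * of_real pi * \<i> * F 0)) (circlepath 0 1)"
    by (rule Cauchy_integral_circlepath[OF cont hol]) simp
  then have "((\<lambda>x. F (circlepath 0 1 x) / circlepath 0 1 x *
      vector_derivative (circlepath 0 1) (at x within {0..1})) has_integral 2 * of_real pi * \<i> * F 0) {0..1}"
    by (simp add: has_contour_integral_def)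
  then have "((\<lambda>x. 2 * of_real pi * \<i> * G x) has_integral 2 * of_real pi * \<i> * F 0) {0..1}"
  proof (rule has_integral_eq[rotated])
    fix x :: real assume "x \<in> {0..1}"
    then have vd: "vector_derivative (circlepath 0 1) (at x within {0..1})
        = 2 * of_real pi * \<i> * exp (2 * of_real pi * \<i> * x)"
      by (subst vector_derivative_circlepath01) auto
    show "F (circlepath 0 1 x) / circlepath 0 1 x *
        vector_derivative (circlepath 0 1) (at x within {0..1}) = 2 * of_real pi * \<i> * G x"
      unfolding vd by (simp add: G_def circlepath cis_conv_exp mult_ac)
  qed
  then have "((\<lambda>x. inverse (2 * of_real pi * \<i>) * (2 * of_real pi * \<i> * G x))
      has_integral inverse (2 * of_real pi * \<i>) * (2 * of_real pi * \<i> * F 0)) {0..1}"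
    by (rule has_integral_mult_right)
  moreover have "inverse (2 * of_real pi * \<i>) * (2 * of_real pi * \<i> * y) = y" for y :: complex
    by (subst mult.assoc[symmetric], subst left_inverse) simp_all
  ultimately have hG: "(G has_integral F 0) {0..1}" by (simp only:)
  have "set_integrable lborel {0..1} G"
    using cG by (rule borel_integrable_atLeastAtMost')
  then have "(LINT x:{0..1}|lborel. G x) = integral {0..1} G"
    by (rule set_borel_integral_eq_integral)
  also have "\<dots> = F 0" using hG by (rule integral_unique)
  also have "(LINT x:{0..1}|lborel. G x) = (LINT x|lborel. indicator {0..<1} x *\<^sub>R G x)"
  proof -
    have "AE x in lborel. x \<noteq> (1::real)" by (rule AE_lborel_singleton)
    then show ?thesis unfolding set_lebesgue_integral_def
      by (intro integral_cong_AE) (auto simp: indicator_def G_def)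
  qed
  also have "\<dots> = (LINT x|density lborel (\<lambda>x. ennreal (indicat_real {0..<1} x)). G x)"
    by (rule integral_density[symmetric]) (auto simp: G_def)
  also have "\<dots> = (LINT z|haar. F z)"
    unfolding haar_def G_def ennreal_indicator by (rule integral_distr[symmetric]) auto
  finally show ?thesis by simp
qed

section \<open>A disc automorphism and its derivative on the circle\<close>

text \<open>The reflection of one site in front of a reflector \<open>w\<close>: with t^2 = 1 - r^2,
  direct reflection plus the geometric series of round trips is r + t^2 w / (1 + r w) = (r + w) / (1
  + r w).\<close>

definition disc_auto :: "real \<Rightarrow> complex \<Rightarrow> complex" where
  "disc_auto r w = (of_real r + w) / (1 + of_real r * w)"

text \<open>The square root of the modulus of the derivative of \<open>disc_auto r\<close> at a point of the circle.\<close>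

definition rootderiv :: "real \<Rightarrow> complex \<Rightarrow> real" where
  "rootderiv r w = sqrt (1 - r\<^sup>2) / norm (1 + of_real r * w)"

lemma disc_auto_denom_nonzero:
  assumes "\<bar>r\<bar> < 1" "norm w \<le> 1" shows "1 + of_real r * w \<noteq> (0::complex)"
proof
  assume "1 + of_real r * w = 0"
  then have "norm (of_real r * w) = 1" by (metis add_eq_0_iff norm_minus_cancel norm_one)
  moreover have "\<bar>r\<bar> * norm w \<le> \<bar>r\<bar> * 1" using assms by (intro mult_left_mono) auto
  ultimately show False using assms by (simp add: norm_mult)
qed

lemma norm_one_add_sq: "norm w = 1 \<Longrightarrow> (norm (1 + of_real r * w))\<^sup>2 = 1 + 2 * r * Re w + r\<^sup>2"
proof -
  assume "norm w = 1"
  then have "(Re w)\<^sup>2 + (Im w)\<^sup>2 = 1" using cmod_power2[of w] by simp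
  then have "r\<^sup>2 * (Re w)\<^sup>2 + r\<^sup>2 * (Im w)\<^sup>2 = r\<^sup>2" by (metis distrib_left mult.right_neutral)
  then show ?thesis unfolding cmod_power2 by (simp add: power2_eq_square algebra_simps)
qed

lemma rootderiv_nonneg: "\<bar>r\<bar> < 1 \<Longrightarrow> 0 \<le> rootderiv r w"
  by (simp add: rootderiv_def abs_square_le_1)

lemma measurable_disc_auto [measurable]: "disc_auto r \<in> borel_measurable borel"
  unfolding disc_auto_def[abs_def] by measurable

lemma measurable_rootderiv [measurable]: "rootderiv r \<in> borel_measurable borel"
  unfolding rootderiv_def[abs_def] by measurable

lemma norm_disc_auto:
  assumes "\<bar>r\<bar> < 1" "norm w = 1" shows "norm (disc_auto r w) = 1"
proof -
  have "of_real r + w = w * cnj (1 + of_real r * w)"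
    using assms(2) complex_norm_square[of w] by (simp add: algebra_simps)
  then have "norm (of_real r + w) = norm (1 + of_real r * w)"
    using assms(2) by (metis complex_mod_cnj mult_1 norm_mult)
  then show ?thesis using disc_auto_denom_nonzero[of r w] assms by (simp add: disc_auto_def norm_divide)
qed

lemma rootderiv_sq:
  assumes "\<bar>r\<bar> < 1" "norm w = 1"
  shows "(rootderiv r w)\<^sup>2 = (1 - r\<^sup>2) / (1 + 2 * r * Re w + r\<^sup>2)"
  using assms norm_one_add_sq[of w r]
  by (simp add: rootderiv_def power_divide abs_square_le_1)

text \<open>Chain rule for the inverse map: the inverse of \<open>disc_auto r\<close> is
  \<open>disc_auto (- r)\<close>, and \<open>rootderiv (- r) z\<close> equals
  \<open>rootderiv r (- z)\<close>.\<close>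

lemma rootderiv_disc_auto:
  assumes r: "\<bar>r\<bar> < 1" and w: "norm w = 1"
  shows "rootderiv r w * rootderiv r (- disc_auto r w) = 1"
proof -
  have nz: "1 + of_real r * w \<noteq> 0" using disc_auto_denom_nonzero[of r w] assms by simp
  have r2: "r\<^sup>2 < 1" using r by (simp add: abs_square_less_1)
  have "1 + of_real r * (- disc_auto r w) = of_real (1 - r\<^sup>2) / (1 + of_real r * w)"
    using nz by (simp add: disc_auto_def field_simps power2_eq_square)
  then have "norm (1 + of_real r * (- disc_auto r w)) = (1 - r\<^sup>2) / norm (1 + of_real r * w)" (is "_ = _ / ?n")
    using r2 by (metis abs_of_pos diff_gt_0_iff_gt norm_divide norm_of_real)
  moreover have "sqrt (1 - r\<^sup>2) / n * (sqrt (1 - r\<^sup>2) / ((1 - r\<^sup>2) / n)) = 1" if "n > 0" for n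
  proof -
    have "sqrt (1 - r\<^sup>2) * sqrt (1 - r\<^sup>2) = 1 - r\<^sup>2" using r2 by simp
    then show ?thesis using that r2 by (simp add: field_simps del: real_sqrt_mult_self)
  qed
  moreover have "?n > 0" using nz by simp
  ultimately show ?thesis unfolding rootderiv_def by (simp only:)
qed

lemma nn_integral_haar_disc_auto:
  assumes r: "\<bar>r\<bar> < 1" and F [measurable]: "F \<in> borel_measurable borel"
  shows "(\<integral>\<^sup>+w. F (disc_auto r w) * ennreal ((rootderiv r w)\<^sup>2) \<partial>haar) = (\<integral>\<^sup>+z. F z \<partial>haar)"
proof -
  \<comment> \<open>With d = 1 + r w one has r + w = w * cnj d on the circle, so the automorphism
    subtracts twice the argument of d. Here \<open>p\<close> is Re d, always positive, and
    \<open>arctan (q x)\<close> is that argument; in units of a full turn, \<open>g\<close> is a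
    continuous lift of the map.\<close>
  define p where "p x = 1 + r * cos (2 * pi * x)" for x :: real
  define q where "q x = r * sin (2 * pi * x) / p x" for x
  define g where "g x = x - arctan (q x) / pi" for x
  define g' where "g' x = (1 - r\<^sup>2) / (1 + 2 * r * cos (2 * pi * x) + r\<^sup>2)" for x :: real
  have r2: "r\<^sup>2 < 1" using r by (simp add: abs_square_less_1)
  have p_pos: "p x > 0" for x
  proof -
    have "\<bar>r * cos (2 * pi * x)\<bar> \<le> \<bar>r\<bar> * 1" unfolding abs_mult by (intro mult_left_mono) auto
    then show ?thesis using r by (simp add: p_def)
  qed
  have pq: "(p x)\<^sup>2 + (r * sin (2 * pi * x))\<^sup>2 = 1 + 2 * r * cos (2 * pi * x) + r\<^sup>2" for x
  proof -
    have "(p x)\<^sup>2 + (r * sin (2 * pi * x))\<^sup>2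
        = 1 + 2 * r * cos (2 * pi * x) + r\<^sup>2 * ((sin (2 * pi * x))\<^sup>2 + (cos (2 * pi * x))\<^sup>2)"
      by (simp only: p_def power2_eq_square) algebra
    then show ?thesis by simp
  qed
  have s_pos: "1 + 2 * r * cos (2 * pi * x) + r\<^sup>2 > 0" for x
    unfolding pq[symmetric] using p_pos[of x] by (simp add: add_pos_nonneg)
  have dg: "(g has_real_derivative g' x) (at x)" for x
  proof -
    have dq: "(q has_real_derivative 2 * pi * (r * cos (2 * pi * x) + r\<^sup>2) / (p x)\<^sup>2) (at x)"
    proof -
      let ?c = "cos (2 * pi * x)" and ?s = "sin (2 * pi * x)"
      have "(q has_real_derivative (r * (?c * (2 * pi)) * p x - r * ?s * (- (r * (?s * (2 * pi))))) / (p x * p x)) (at x)"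
        unfolding q_def[abs_def] p_def[abs_def] using p_pos[of x]
        by (auto intro!: derivative_eq_intros simp: p_def)
      also have "r * (?c * (2 * pi)) * p x - r * ?s * (- (r * (?s * (2 * pi))))
          = 2 * pi * (r * ?c + r\<^sup>2 * (?s\<^sup>2 + ?c\<^sup>2))"
        unfolding p_def by (simp only: power2_eq_square) algebra
      finally show ?thesis unfolding sin_cos_squared_add by (simp add: power2_eq_square)
    qed
    have q1: "1 + (q x)\<^sup>2 = (1 + 2 * r * cos (2 * pi * x) + r\<^sup>2) / (p x)\<^sup>2"
      unfolding q_def power_divide pq[symmetric] using p_pos[of x] by (simp add: field_simps)
    have "((\<lambda>x. x - arctan (q x) / pi) has_real_derivative
        1 - inverse (1 + (q x)\<^sup>2) * (2 * pi * (r * cos (2 * pi * x) + r\<^sup>2) / (p x)\<^sup>2) / pi) (at x)"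
      by (auto intro!: derivative_eq_intros dq)
    also have "1 - inverse (1 + (q x)\<^sup>2) * (2 * pi * (r * cos (2 * pi * x) + r\<^sup>2) / (p x)\<^sup>2) / pi = g' x"
    proof -
      have "1 - inverse (S / P) * (2 * pi * m / P) / pi = (S - 2 * m) / S" if "S > 0" "P > 0" for S P m :: real
        using that by (simp add: field_simps)
      moreover have "1 - r\<^sup>2 = 1 + 2 * r * cos (2 * pi * x) + r\<^sup>2 - 2 * (r * cos (2 * pi * x) + r\<^sup>2)"
        by simp
      moreover have "(p x)\<^sup>2 > 0" using p_pos[of x] by simp
      ultimately show ?thesis unfolding q1 g'_def using s_pos[of x] by presburger
    qed
    finally show ?thesis by (simp add: g_def[abs_def])
  qed
  have cg': "continuous_on {0..1} g'"
    unfolding g'_def using s_pos by (intro continuous_intros) (auto simp: less_imp_neq[symmetric])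
  have g'_nonneg: "g' x \<ge> 0" for x using s_pos[of x] r2 by (simp add: g'_def)
  have g01: "g 0 = 0" "g 1 = 1" by (simp_all add: g_def q_def)
  have cis_g: "cis (2 * pi * g x) = disc_auto r (cis (2 * pi * x))" for x
  proof -
    let ?w = "cis (2 * pi * x)"
    have nz: "1 + of_real r * ?w \<noteq> 0" using disc_auto_denom_nonzero[of r ?w] r by simp
    have c: "cis (arctan y) * sqrt (1 + y\<^sup>2) = 1 + \<i> * y" for y
      using add_pos_nonneg[of 1 "y\<^sup>2"] by (auto simp: complex_eq_iff cos_arctan sin_arctan)
    have cc: "cis (- arctan y) * sqrt (1 + y\<^sup>2) = 1 - \<i> * y" for y
      using c[of "- y"] by (simp add: arctan_minus)
    have "cis (2 * pi * g x) * (1 + \<i> * q x) = ?w * cis (- arctan (q x)) * cis (- arctan (q x)) * (cis (arctan (q x)) * sqrt (1 + (q x)\<^sup>2))"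
    proof -
      have "2 * pi * g x = 2 * pi * x + - arctan (q x) + - arctan (q x)"
        by (simp add: g_def field_simps)
      then have "cis (2 * pi * g x) = ?w * cis (- arctan (q x)) * cis (- arctan (q x))"
        by (simp only: cis_mult)
      then show ?thesis by (simp only: c)
    qed
    also have "\<dots> = ?w * (cis (- arctan (q x)) * cis (arctan (q x))) * (cis (- arctan (q x)) * sqrt (1 + (q x)\<^sup>2))"
      by (simp only: mult_ac)
    also have "\<dots> = ?w * (1 - \<i> * q x)" unfolding cc by (simp add: cis_mult)
    finally have "cis (2 * pi * g x) * ((1 + \<i> * q x) * p x) = ?w * ((1 - \<i> * q x) * p x)"
      by (simp add: mult.assoc[symmetric])
    moreover have "(1 + \<i> * q x) * p x = 1 + of_real r * ?w"
      using p_pos[of x] by (simp add: q_def complex_eq_iff p_def)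
    moreover have "(1 - \<i> * q x) * p x = 1 + of_real r * cnj ?w"
      using p_pos[of x] by (simp add: q_def complex_eq_iff p_def)
    moreover have "?w * (1 + of_real r * cnj ?w) = of_real r + ?w"
      by (simp add: algebra_simps cis_mult cis_cnj)
    ultimately have "cis (2 * pi * g x) * (1 + of_real r * ?w) = of_real r + ?w"
      by (simp only:)
    then show ?thesis unfolding disc_auto_def by (simp only: nonzero_eq_divide_eq[OF nz])
  qed
  have g'_eq: "g' x = (rootderiv r (cis (2 * pi * x)))\<^sup>2" for x
    using rootderiv_sq[OF r, of "cis (2 * pi * x)"] by (simp add: g'_def)
  have endpoint: "(\<integral>\<^sup>+x. h x * indicator {0..<1} x \<partial>lborel) = (\<integral>\<^sup>+x. h x * indicator {0..1} x \<partial>lborel)"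
    for h :: "real \<Rightarrow> ennreal"
    using AE_lborel_singleton[of 1] by (intro nn_integral_cong_AE) (auto simp: indicator_def)
  \<comment> \<open>\<open>F\<close> may be infinite, whereas the substitution handles real
    integrands. It is done for indicators and extended as an equality of measures.\<close>
  have "distr (density haar (\<lambda>w. ennreal ((rootderiv r w)\<^sup>2))) borel (disc_auto r) = haar"
  proof (rule measure_eqI)
    fix A assume "A \<in> sets (distr (density haar (\<lambda>w. ennreal ((rootderiv r w)\<^sup>2))) borel (disc_auto r))"
    then have [measurable]: "A \<in> sets borel" by simp
    have [measurable]: "disc_auto r -` A \<in> sets borel"
      using measurable_sets[OF measurable_disc_auto \<open>A \<in> sets borel\<close>] by simp
    let ?f = "\<lambda>x. indicat_real A (cis (2 * pi * x))"
    have "emeasure haar A = (\<integral>\<^sup>+z. indicator A z \<partial>haar)" by simp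
    also have "\<dots> = (\<integral>\<^sup>+x. indicator A (cis (2 * pi * x)) * indicator {0..1} x \<partial>lborel)"
      by (subst nn_integral_haar) (auto simp: endpoint)
    also have "\<dots> = (\<integral>\<^sup>+x. ennreal (?f x * indicator {g 0..g 1} x) \<partial>lborel)"
      by (rule nn_integral_cong) (auto simp: indicator_def g01)
    also have "\<dots> = (\<integral>\<^sup>+x. ennreal (?f (g x) * g' x * indicator {0..1} x) \<partial>lborel)"
    proof (rule nn_integral_substitution)
      show "set_borel_measurable borel {g 0..g 1} ?f"
        unfolding set_borel_measurable_def by measurable
    qed (use dg cg' g'_nonneg in auto)
    also have "\<dots> = (\<integral>\<^sup>+x. (indicator A (disc_auto r (cis (2 * pi * x))) *
        ennreal ((rootderiv r (cis (2 * pi * x)))\<^sup>2)) * indicator {0..1} x \<partial>lborel)"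
      by (rule nn_integral_cong) (auto simp: indicator_def cis_g g'_eq)
    also have "\<dots> = (\<integral>\<^sup>+w. indicator A (disc_auto r w) * ennreal ((rootderiv r w)\<^sup>2) \<partial>haar)"
      by (subst nn_integral_haar) (auto simp: endpoint)
    also have "\<dots> = (\<integral>\<^sup>+w. ennreal ((rootderiv r w)\<^sup>2) * indicator (disc_auto r -` A \<inter> space haar) w \<partial>haar)"
      by (rule nn_integral_cong) (auto simp: indicator_def)
    also have "\<dots> = emeasure (distr (density haar (\<lambda>w. ennreal ((rootderiv r w)\<^sup>2))) borel (disc_auto r)) A"
      by (subst emeasure_distr, simp, simp, subst emeasure_density) (auto intro: measurable_sets_borel)
    finally show "emeasure (distr (density haar (\<lambda>w. ennreal ((rootderiv r w)\<^sup>2))) borel (disc_auto r)) A = emeasure haar A"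
      by simp
  qed simp
  then have "(\<integral>\<^sup>+z. F z \<partial>haar) = (\<integral>\<^sup>+z. F z \<partial>distr (density haar (\<lambda>w. ennreal ((rootderiv r w)\<^sup>2))) borel (disc_auto r))"
    by simp
  also have "\<dots> = (\<integral>\<^sup>+w. ennreal ((rootderiv r w)\<^sup>2) * F (disc_auto r w) \<partial>haar)"
    by (subst nn_integral_distr, simp, simp, subst nn_integral_density) auto
  finally show ?thesis by (simp add: mult.commute)
qed

section \<open>A spectral gap for averages over rotations\<close>

text \<open>The cross term of two independent copies factorises, so this is twice the variance.
  Losses of L^2 norm under averaging thereby become mean distances between rotated
  functions.\<close>

lemma (in prob_space) nn_integral_square_diff:
  fixes f :: "'a \<Rightarrow> real"
  assumes [measurable]: "f \<in> borel_measurable M" and B: "AE a in M. \<bar>f a\<bar> \<le> B"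
  shows "(\<integral>\<^sup>+a. (\<integral>\<^sup>+b. ennreal ((f a - f b)\<^sup>2) \<partial>M) \<partial>M) =
    ennreal (2 * (LINT a|M. (f a)\<^sup>2) - 2 * (LINT a|M. f a)\<^sup>2)"
proof -
  have i1: "integrable M f" using B by (intro integrable_const_bound[of _ B]) auto
  have i2: "integrable M (\<lambda>a. (f a)\<^sup>2)"
    using B by (intro integrable_const_bound[of _ "B\<^sup>2"])
      (auto elim!: eventually_mono simp: abs_le_square_iff[symmetric])
  define m q where "m = (LINT a|M. f a)" and "q = (LINT a|M. (f a)\<^sup>2)"
  have sq: "(x - f b)\<^sup>2 = x\<^sup>2 - 2 * x * f b + (f b)\<^sup>2" for x b
    by (simp add: power2_eq_square algebra_simps)
  have I: "integrable M (\<lambda>b. (x - f b)\<^sup>2)" "(LINT b|M. (x - f b)\<^sup>2) = x\<^sup>2 - 2 * x * m + q" for x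
    unfolding sq using i1 i2 by (auto simp: m_def q_def prob_space)
  have inner: "(\<integral>\<^sup>+b. ennreal ((x - f b)\<^sup>2) \<partial>M) = ennreal (x\<^sup>2 - 2 * x * m + q)" for x
    using I[of x] by (subst nn_integral_eq_integral) auto
  have nonneg: "0 \<le> x\<^sup>2 - 2 * x * m + q" for x
    unfolding I(2)[symmetric] by simp
  have "(\<integral>\<^sup>+a. (\<integral>\<^sup>+b. ennreal ((f a - f b)\<^sup>2) \<partial>M) \<partial>M) = ennreal (LINT a|M. (f a)\<^sup>2 - 2 * f a * m + q)"
    unfolding inner using i1 i2 nonneg by (intro nn_integral_eq_integral) auto
  also have "(LINT a|M. (f a)\<^sup>2 - 2 * f a * m + q) = 2 * q - 2 * m\<^sup>2"
    using i1 i2 by (simp add: m_def[symmetric] q_def[symmetric] prob_space) (simp add: power2_eq_square)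
  finally show ?thesis by (simp add: m_def q_def)
qed

text \<open>The squared L^2 distance of two rotates of \<open>g\<close>. Because of the square the
  triangle inequality holds with a factor 2. The values are extended reals, so no integrability has
  to be carried along.\<close>

definition shift_dist :: "(complex \<Rightarrow> real) \<Rightarrow> complex \<Rightarrow> complex \<Rightarrow> ennreal" where
  "shift_dist g a b = (\<integral>\<^sup>+z. ennreal ((g (a * z) - g (b * z))\<^sup>2) \<partial>haar)"

lemma measurable_shift_dist [measurable]:
  assumes [measurable]: "g \<in> borel_measurable borel" "a \<in> borel_measurable M" "b \<in> borel_measurable M"
  shows "(\<lambda>x. shift_dist g (a x) (b x)) \<in> borel_measurable M"
  unfolding shift_dist_def by measurable

lemma shift_dist_commute: "shift_dist g a b = shift_dist g b a"
  unfolding shift_dist_def by (simp add: power2_commute)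

lemma shift_dist_triangle:
  assumes [measurable]: "g \<in> borel_measurable borel"
  shows "shift_dist g a b \<le> 2 * shift_dist g a c + 2 * shift_dist g c b"
proof -
  have *: "(x - y)\<^sup>2 \<le> 2 * (x - w)\<^sup>2 + 2 * (w - y)\<^sup>2" for x y w :: real
    using zero_le_power2[of "(x - w) - (w - y)"] by (simp add: power2_eq_square algebra_simps)
  have "shift_dist g a b \<le> (\<integral>\<^sup>+z. 2 * ennreal ((g (a * z) - g (c * z))\<^sup>2)
      + 2 * ennreal ((g (c * z) - g (b * z))\<^sup>2) \<partial>haar)"
    unfolding shift_dist_def
    by (intro nn_integral_mono)
      (auto simp: ennreal_numeral[symmetric] ennreal_mult[symmetric] ennreal_plus[symmetric] *
        simp del: ennreal_plus ennreal_numeral intro!: ennreal_leI)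
  also have "\<dots> = 2 * shift_dist g a c + 2 * shift_dist g c b"
    unfolding shift_dist_def by (subst nn_integral_add) (auto simp: nn_integral_cmult)
  finally show ?thesis .
qed

lemma shift_dist_rotate:
  assumes [measurable]: "g \<in> borel_measurable borel" and "norm c = 1"
  shows "shift_dist g (a * c) (b * c) = shift_dist g a b"
  unfolding shift_dist_def mult.assoc
  by (rule nn_integral_haar_rotate[OF _ assms(2)]) measurable

text \<open>The rotation \<open>c ^ m\<close> is reached in \<open>m\<close> steps of equal length.
  Cauchy-Schwarz on the telescoping sum costs one factor \<open>m\<close>, the number of equal terms
  the other.\<close>

lemma shift_dist_power:
  assumes [measurable]: "g \<in> borel_measurable borel" and c: "norm c = 1"
  shows "shift_dist g 1 (c ^ m) \<le> of_nat (m\<^sup>2) * shift_dist g 1 c"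
proof -
  have *: "(g z - g (c ^ m * z))\<^sup>2 \<le> real m * (\<Sum>i<m. (g (c ^ i * z) - g (c ^ Suc i * z))\<^sup>2)" for z
  proof -
    have "g z - g (c ^ m * z) = (\<Sum>i<m. g (c ^ i * z) - g (c ^ Suc i * z))"
      using sum_lessThan_telescope'[of "\<lambda>i. g (c ^ i * z)" m] by simp
    then show ?thesis
      using sum_squared_le_sum_of_squares[of "\<lambda>i. g (c ^ i * z) - g (c ^ Suc i * z)" "{..<m}"]
      by (simp add: mult.commute)
  qed
  have "shift_dist g 1 (c ^ m) \<le> (\<integral>\<^sup>+z. of_nat m * (\<Sum>i<m. ennreal ((g (c ^ i * z) - g (c ^ Suc i * z))\<^sup>2)) \<partial>haar)"
    unfolding shift_dist_def mult_1_left
  proof (rule nn_integral_mono)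
    fix z
    have "ennreal ((g z - g (c ^ m * z))\<^sup>2) \<le> ennreal (real m * (\<Sum>i<m. (g (c ^ i * z) - g (c ^ Suc i * z))\<^sup>2))"
      by (rule ennreal_leI[OF *])
    also have "\<dots> = of_nat m * (\<Sum>i<m. ennreal ((g (c ^ i * z) - g (c ^ Suc i * z))\<^sup>2))"
      by (simp add: ennreal_mult sum_nonneg ennreal_of_nat_eq_real_of_nat del: power_Suc)
    finally show "ennreal ((g z - g (c ^ m * z))\<^sup>2) \<le> of_nat m * (\<Sum>i<m. ennreal ((g (c ^ i * z) - g (c ^ Suc i * z))\<^sup>2))" .
  qed
  also have "\<dots> = of_nat m * (\<Sum>i<m. shift_dist g (c ^ i) (c ^ Suc i))"
    unfolding shift_dist_def by (subst nn_integral_cmult, measurable, subst nn_integral_sum) auto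
  also have "(\<Sum>i<m. shift_dist g (c ^ i) (c ^ Suc i)) = (\<Sum>i<m. shift_dist g 1 c)"
  proof (rule sum.cong)
    fix i
    show "shift_dist g (c ^ i) (c ^ Suc i) = shift_dist g 1 c"
      using shift_dist_rotate[OF assms(1), of "c ^ i" 1 c] c by (simp add: norm_power)
  qed simp
  finally show ?thesis by (simp add: power2_eq_square mult.assoc)
qed

text \<open>\<open>law_le\<close> is an upper bound on the density with respect to
  \<open>haar\<close>, in integrated form. There is no lower bound: the law may sit on a short arc,
  and a spectral gap has to come from combining several rotations.\<close>

locale circle_law = prob_space \<nu> for \<nu> :: "complex measure" +
  fixes K :: real
  assumes sets_law [simp, measurable_cong]: "sets \<nu> = sets borel"
    and law_le: "F \<in> borel_measurable borel \<Longrightarrow> (\<integral>\<^sup>+a. F a \<partial>\<nu>) \<le> ennreal K * (\<integral>\<^sup>+a. F a \<partial>haar)"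
begin

lemma space_law [simp]: "space \<nu> = UNIV"
  using sets_eq_imp_space_eq[OF sets_law] by simp

lemma prob_UNIV [simp]: "prob UNIV = 1"
  using prob_space by simp

lemma AE_law_norm: "AE a in \<nu>. norm a = 1"
proof -
  have "(\<integral>\<^sup>+a. indicator {a. norm a \<noteq> 1} a \<partial>\<nu>) \<le> ennreal K * (\<integral>\<^sup>+a. indicator {a. norm a \<noteq> 1} a \<partial>haar)"
    by (rule law_le) measurable
  also have "(\<integral>\<^sup>+a. indicator {a. norm a \<noteq> 1} a \<partial>haar) = (0::ennreal)"
    using AE_haar_norm by (subst nn_integral_0_iff_AE) (auto simp: indicator_def)
  finally have "(\<integral>\<^sup>+a. indicator {a. norm a \<noteq> 1} a \<partial>\<nu>) = (0::ennreal)" by simp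
  then show ?thesis by (subst (asm) nn_integral_0_iff_AE) (auto simp: indicator_def)
qed

lemma K_ge_1: "1 \<le> K"
proof -
  have "(\<integral>\<^sup>+a. 1 \<partial>\<nu>) \<le> ennreal K * (\<integral>\<^sup>+a. 1 \<partial>haar)" by (rule law_le) measurable
  then have "ennreal 1 \<le> ennreal K"
    using emeasure_space_1 haar.emeasure_space_1 by simp
  then show ?thesis by (metis ennreal_le_iff2 not_one_le_zero)
qed

definition avg :: "(complex \<Rightarrow> real) \<Rightarrow> complex \<Rightarrow> real" where
  "avg g z = (LINT a|\<nu>. g (a * z))"

lemma measurable_avg [measurable]:
  assumes [measurable]: "g \<in> borel_measurable borel"
  shows "avg g \<in> borel_measurable borel"
  unfolding avg_def[abs_def] by measurable

lemma nn_integral_haar_law_rotate: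
  assumes [measurable]: "F \<in> borel_measurable borel"
  shows "(\<integral>\<^sup>+z. (\<integral>\<^sup>+a. F (a * z) \<partial>\<nu>) \<partial>haar) = (\<integral>\<^sup>+z. F z \<partial>haar)"
proof -
  interpret pair_sigma_finite haar \<nu> ..
  have "(\<integral>\<^sup>+z. (\<integral>\<^sup>+a. F (a * z) \<partial>\<nu>) \<partial>haar) = (\<integral>\<^sup>+a. (\<integral>\<^sup>+z. F (a * z) \<partial>haar) \<partial>\<nu>)"
    by (rule Fubini'[symmetric]) measurable
  also have "\<dots> = (\<integral>\<^sup>+a. (\<integral>\<^sup>+z. F z \<partial>haar) \<partial>\<nu>)"
    using AE_law_norm by (intro nn_integral_cong_AE) (auto elim!: eventually_mono simp: nn_integral_haar_rotate)
  finally show ?thesis using emeasure_space_1 by simp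
qed

text \<open>The rotations that move \<open>g\<close> little have positive measure. By the pigeonhole principle every
  \<open>c\<close> has a power of bounded order that is a quotient of two of them, so \<open>c ^ fact n\<close> moves \<open>g\<close>
  little as well, and \<open>c ^ fact n\<close> is again uniformly distributed.\<close>

lemma avg_gap_aux:
  assumes [measurable]: "g \<in> borel_measurable borel"
    and e: "(\<integral>\<^sup>+a. (\<integral>\<^sup>+b. shift_dist g a b \<partial>\<nu>) \<partial>\<nu>) < ennreal e" and e0: "e > 0" and n: "2 * K < real n + 1"
  shows "(\<integral>\<^sup>+c. shift_dist g 1 c \<partial>haar) \<le> ennreal (8 * (fact n)\<^sup>2 * e)"
proof -
  have "\<exists>a. norm a = 1 \<and> (\<integral>\<^sup>+b. shift_dist g a b \<partial>\<nu>) < ennreal e"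
  proof (rule ccontr)
    assume "\<not> ?thesis"
    then have "AE a in \<nu>. ennreal e \<le> (\<integral>\<^sup>+b. shift_dist g a b \<partial>\<nu>)"
      using AE_law_norm by (auto elim!: eventually_mono simp: not_less)
    then have "(\<integral>\<^sup>+a. ennreal e \<partial>\<nu>) \<le> (\<integral>\<^sup>+a. (\<integral>\<^sup>+b. shift_dist g a b \<partial>\<nu>) \<partial>\<nu>)"
      by (rule nn_integral_mono_AE)
    then show False using e emeasure_space_1 by (simp add: not_le[symmetric])
  qed
  then obtain a where a: "norm a = 1" "(\<integral>\<^sup>+b. shift_dist g a b \<partial>\<nu>) < ennreal e" by blast
  define G where "G = {b. norm b = 1 \<and> shift_dist g a b \<le> 2 * ennreal e}"
  have G [measurable]: "G \<in> sets borel" unfolding G_def by measurable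
  have close: "shift_dist g b c \<le> 8 * ennreal e" if "b \<in> G" "c \<in> G" for b c
  proof -
    have "shift_dist g b c \<le> 2 * shift_dist g b a + 2 * shift_dist g a c"
      by (rule shift_dist_triangle) measurable
    also have "\<dots> \<le> 2 * (2 * ennreal e) + 2 * (2 * ennreal e)"
      using that by (intro add_mono mult_left_mono) (auto simp: G_def shift_dist_commute)
    also have "\<dots> = 8 * ennreal e"
      by (simp add: mult.assoc[symmetric] distrib_right[symmetric])
    finally show ?thesis .
  qed
  \<comment> \<open>Markov's inequality: the threshold in \<open>G\<close> is twice the bound on the
    mean.\<close>
  have half: "1 / 2 \<le> prob G"
  proof -
    have "AE b in \<nu>. 2 * ennreal e * indicator (- G) b \<le> shift_dist g a b"
      using AE_law_norm by eventually_elim (auto simp: G_def indicator_def)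
    then have "(\<integral>\<^sup>+b. 2 * ennreal e * indicator (- G) b \<partial>\<nu>) \<le> (\<integral>\<^sup>+b. shift_dist g a b \<partial>\<nu>)"
      by (rule nn_integral_mono_AE)
    also have "\<dots> \<le> ennreal e" using a by simp
    also have "(\<integral>\<^sup>+b. 2 * ennreal e * indicator (- G) b \<partial>\<nu>) = ennreal (2 * e * prob (- G))"
      using e0 by (subst nn_integral_cmult_indicator)
        (auto simp: emeasure_eq_measure ennreal_mult ennreal_numeral[symmetric] simp del: ennreal_numeral)
    finally have "2 * e * prob (- G) \<le> e" using e0 by (simp add: ennreal_le_iff)
    then have "prob (- G) \<le> 1 / 2" using e0 by (simp add: field_simps)
    moreover have "prob (- G) = 1 - prob G" using prob_compl[of G] by (simp add: Compl_eq_Diff_UNIV)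
    ultimately show ?thesis by simp
  qed
  \<comment> \<open>Probability 1/2 under the law forces uniform mass at least 1 / (2 K), so
    \<open>n + 1\<close> rotated copies of \<open>G\<close> exceed the total mass and must
    overlap.\<close>
  have big: "1 < (real n + 1) * measure haar G"
  proof -
    have "ennreal (prob G) = (\<integral>\<^sup>+b. indicator G b \<partial>\<nu>)" by (simp add: emeasure_eq_measure)
    also have "\<dots> \<le> ennreal K * (\<integral>\<^sup>+b. indicator G b \<partial>haar)" by (rule law_le) measurable
    also have "\<dots> = ennreal (K * measure haar G)"
      using K_ge_1 by (simp add: haar.emeasure_eq_measure ennreal_mult)
    finally have "1 \<le> 2 * K * measure haar G" using half K_ge_1
      by (simp add: ennreal_le_iff)
    moreover from this have "0 < measure haar G"
      by (metis measure_nonneg less_eq_real_def mult_zero_right not_one_le_zero)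
    moreover from this have "2 * K * measure haar G < (real n + 1) * measure haar G"
      using n by (intro mult_strict_right_mono) auto
    ultimately show ?thesis by linarith
  qed
  have close_power: "shift_dist g 1 (c ^ fact n) \<le> ennreal (8 * (fact n)\<^sup>2 * e)" if c: "norm c = 1" for c
  proof -
    define A where "A i = {z. cnj c ^ i * z \<in> G}" for i :: nat
    have [measurable]: "A i \<in> sets borel" for i
      unfolding A_def by measurable
    have mA: "measure haar (A i) = measure haar G" for i
    proof -
      have "emeasure haar (A i) = (\<integral>\<^sup>+z. indicator (A i) z \<partial>haar)" by simp
      also have "\<dots> = (\<integral>\<^sup>+z. indicator G (cnj c ^ i * z) \<partial>haar)"
        by (rule nn_integral_cong) (simp add: A_def indicator_def)
      also have "\<dots> = (\<integral>\<^sup>+z. indicator G z \<partial>haar)"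
        by (rule nn_integral_haar_rotate) (auto simp: norm_power c)
      finally show ?thesis by (simp add: measure_def)
    qed
    have "\<not> disjoint_family_on A {..n}"
    proof
      assume "disjoint_family_on A {..n}"
      then have "measure haar (\<Union>i\<in>{..n}. A i) = (\<Sum>i\<in>{..n}. measure haar (A i))"
        by (intro haar.finite_measure_finite_Union) auto
      then show False using big haar.prob_le_1[of "\<Union>i\<in>{..n}. A i"]
        by (simp add: mA add.commute)
    qed
    then obtain i j z where ij: "i \<le> n" "j \<le> n" "i \<noteq> j" "z \<in> A i" "z \<in> A j"
      unfolding disjoint_family_on_def by blast
    have "\<exists>i j. i < j \<and> j \<le> n \<and> z \<in> A i \<and> z \<in> A j"
      using ij by (metis nat_neq_iff)
    then obtain i j where ij: "i < j" "j \<le> n" "z \<in> A i" "z \<in> A j" by blast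
    define k w where "k = j - i" and "w = cnj c ^ j * z"
    have w: "w \<in> G" using ij by (simp add: A_def w_def)
    have cc: "c ^ m * cnj c ^ m = 1" for m
      using c complex_norm_square[of c] by (simp add: power_mult_distrib[symmetric])
    have "cnj c ^ i * z = c ^ k * (cnj c ^ k * cnj c ^ i) * z"
      using cc[of k] by (simp add: mult.assoc[symmetric])
    also have "cnj c ^ k * cnj c ^ i = cnj c ^ j"
      using ij by (simp add: k_def power_add[symmetric])
    finally have "c ^ k * w = cnj c ^ i * z" by (simp only: w_def mult.assoc)
    then have "c ^ k * w \<in> G" using ij by (simp add: A_def)
    then have "shift_dist g (1 * w) (c ^ k * w) \<le> 8 * ennreal e"
      using close w by simp
    moreover have "shift_dist g (1 * w) (c ^ k * w) = shift_dist g 1 (c ^ k)"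
      using w by (intro shift_dist_rotate) (auto simp: G_def)
    ultimately have k: "shift_dist g 1 (c ^ k) \<le> 8 * ennreal e"
      by (simp only:)
    \<comment> \<open>The exponent \<open>k\<close> depends on \<open>c\<close> but is at most
      \<open>n\<close>; passing to \<open>fact n\<close> makes the exponent the same for all
      \<open>c\<close>.\<close>
    have "k dvd fact n" using ij by (intro dvd_fact) (auto simp: k_def)
    then obtain l where l: "fact n = k * l" by blast
    have "l dvd fact n" using l by simp
    then have "l \<le> fact n" by (rule dvd_imp_le) simp
    have "shift_dist g 1 (c ^ fact n) \<le> of_nat (l\<^sup>2) * shift_dist g 1 (c ^ k)"
      unfolding l power_mult by (rule shift_dist_power) (auto simp: norm_power c)
    also have "\<dots> \<le> of_nat ((fact n)\<^sup>2) * (8 * ennreal e)"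
      using k \<open>l \<le> fact n\<close> by (intro mult_mono of_nat_mono power_mono) auto
    also have "\<dots> = ennreal (8 * (fact n)\<^sup>2 * e)"
      using e0 by (simp add: ennreal_of_nat_eq_real_of_nat ennreal_mult mult_ac)
    finally show ?thesis .
  qed
  have "(\<integral>\<^sup>+c. shift_dist g 1 c \<partial>haar) = (\<integral>\<^sup>+c. shift_dist g 1 (c ^ fact n) \<partial>haar)"
    by (rule nn_integral_haar_power[symmetric]) auto
  also have "\<dots> \<le> (\<integral>\<^sup>+c. ennreal (8 * (fact n)\<^sup>2 * e) \<partial>haar)"
    using AE_haar_norm close_power by (intro nn_integral_mono_AE) (auto elim!: eventually_mono)
  also have "\<dots> = ennreal (8 * (fact n)\<^sup>2 * e)"
    using haar.emeasure_space_1 by simp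
  finally show ?thesis .
qed

text \<open>The reciprocal of the loss in \<open>avg_gap_aux\<close>, for an \<open>n\<close> with
  \<open>2 * K < n + 1\<close>. The law enters only through its density bound
  \<open>K\<close>.\<close>

definition gap :: real where
  "gap = 1 / (8 * (fact (nat \<lceil>2 * K\<rceil>))\<^sup>2)"

lemma gap_bounds: "0 < gap" "gap \<le> 1"
proof -
  have "1 \<le> (fact (nat \<lceil>2 * K\<rceil>) :: real)\<^sup>2" by (intro one_le_power fact_ge_1)
  then have "1 \<le> 8 * (fact (nat \<lceil>2 * K\<rceil>) :: real)\<^sup>2" by linarith
  then show "0 < gap" "gap \<le> 1" by (simp_all add: gap_def)
qed

text \<open>Half the mean \<open>shift_dist\<close> of two rotations drawn from the law is the norm
  lost by averaging (\<open>E\<close>); half the mean over uniform rotations is the variance of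
  \<open>g\<close> (\<open>D\<close>). By \<open>avg_gap_aux\<close> the first is at least
  \<open>gap\<close> times the second.\<close>

lemma avg_gap:
  assumes [measurable]: "g \<in> borel_measurable borel" and B: "\<And>z. norm z = 1 \<Longrightarrow> \<bar>g z\<bar> \<le> B"
  shows "(LINT z|haar. (avg g z)\<^sup>2) \<le> (1 - gap) * (LINT z|haar. (g z)\<^sup>2) + gap * (LINT z|haar. g z)\<^sup>2"
proof -
  let ?N = "LINT z|haar. (g z)\<^sup>2" and ?m = "LINT z|haar. g z" and ?A = "LINT z|haar. (avg g z)\<^sup>2"
  interpret h\<nu>: pair_sigma_finite haar \<nu> ..
  interpret \<nu>h: pair_sigma_finite \<nu> haar ..
  interpret hh: pair_sigma_finite haar haar ..
  have B2: "(g z)\<^sup>2 \<le> B\<^sup>2" if "norm z = 1" for z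
    using B[OF that] by (simp add: abs_le_square_iff[symmetric])
  have bd: "AE a in \<nu>. \<bar>g (a * z)\<bar> \<le> B" if "norm z = 1" for z
    using AE_law_norm by eventually_elim (use B that in \<open>simp add: norm_mult\<close>)
  have avg_le: "\<bar>avg g z\<bar> \<le> B" if "norm z = 1" for z
  proof -
    have "integrable \<nu> (\<lambda>a. g (a * z))" using bd[OF that] by (intro integrable_const_bound[of _ B]) auto
    then have "\<bar>LINT a|\<nu>. g (a * z)\<bar> \<le> (LINT a|\<nu>. B)"
      using bd[OF that] by (intro order_trans[OF integral_abs_bound] integral_mono_AE) auto
    then show ?thesis by (simp add: avg_def)
  qed
  have iA: "integrable haar (\<lambda>z. (avg g z)\<^sup>2)"
    using order_trans[OF avg_le abs_ge_self]
    by (intro integrable_haar_bounded[of _ "B\<^sup>2"]) (auto simp: abs_le_square_iff[symmetric])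
  define q where "q z = (LINT a|\<nu>. (g (a * z))\<^sup>2)" for z
  have [measurable]: "q \<in> borel_measurable borel" unfolding q_def[abs_def] by measurable
  have iq': "integrable \<nu> (\<lambda>a. (g (a * z))\<^sup>2)" if "norm z = 1" for z
    using AE_law_norm by (intro integrable_const_bound[of _ "B\<^sup>2"])
      (auto elim!: eventually_mono simp: B2 that norm_mult)
  have q_nonneg: "0 \<le> q z" for z unfolding q_def by simp
  have q_nn: "ennreal (q z) = (\<integral>\<^sup>+a. ennreal ((g (a * z))\<^sup>2) \<partial>\<nu>)" if "norm z = 1" for z
    unfolding q_def using iq'[OF that] by (intro nn_integral_eq_integral[symmetric]) auto
  have q_le: "q z \<le> B\<^sup>2" if "norm z = 1" for z
  proof -
    have "q z \<le> (LINT a|\<nu>. B\<^sup>2)" unfolding q_def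
      using iq'[OF that] AE_law_norm
      by (intro integral_mono_AE) (auto elim!: eventually_mono simp: B2 that norm_mult)
    then show ?thesis by simp
  qed
  have iq: "integrable haar q"
    using q_le q_nonneg by (intro integrable_haar_bounded[of _ "B\<^sup>2"]) auto
  have avg_sq_le: "(avg g z)\<^sup>2 \<le> q z" if z: "norm z = 1" for z
  proof -
    have i: "integrable \<nu> (\<lambda>a. g (a * z))" using bd[OF z] by (intro integrable_const_bound[of _ B]) auto
    have "0 \<le> (LINT a|\<nu>. (g (a * z) - avg g z)\<^sup>2)" by simp
    also have "\<dots> = (LINT a|\<nu>. (g (a * z))\<^sup>2 - 2 * avg g z * g (a * z) + (avg g z)\<^sup>2)"
      by (simp add: power2_eq_square algebra_simps)
    also have "\<dots> = q z - (avg g z)\<^sup>2"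
      using i iq'[OF z] by (simp add: q_def avg_def[symmetric]) (simp add: power2_eq_square)
    finally show ?thesis by simp
  qed
  have Iq: "(LINT z|haar. q z) = ?N"
  proof -
    have "(\<integral>\<^sup>+z. ennreal (q z) \<partial>haar) = (\<integral>\<^sup>+z. (\<integral>\<^sup>+a. ennreal ((g (a * z))\<^sup>2) \<partial>\<nu>) \<partial>haar)"
      by (rule nn_integral_haar_cong) (rule q_nn)
    also have "\<dots> = (\<integral>\<^sup>+z. ennreal ((g z)\<^sup>2) \<partial>haar)"
      by (rule nn_integral_haar_law_rotate) measurable
    finally show ?thesis using q_nonneg by (simp add: integral_eq_nn_integral)
  qed
  have E: "(\<integral>\<^sup>+a. (\<integral>\<^sup>+b. shift_dist g a b \<partial>\<nu>) \<partial>\<nu>) = ennreal (2 * ?N - 2 * ?A)"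
  proof -
    have "(\<integral>\<^sup>+a. (\<integral>\<^sup>+b. shift_dist g a b \<partial>\<nu>) \<partial>\<nu>)
        = (\<integral>\<^sup>+a. (\<integral>\<^sup>+z. (\<integral>\<^sup>+b. ennreal ((g (a * z) - g (b * z))\<^sup>2) \<partial>\<nu>) \<partial>haar) \<partial>\<nu>)"
      unfolding shift_dist_def by (intro nn_integral_cong h\<nu>.Fubini') measurable
    also have "\<dots> = (\<integral>\<^sup>+z. (\<integral>\<^sup>+a. (\<integral>\<^sup>+b. ennreal ((g (a * z) - g (b * z))\<^sup>2) \<partial>\<nu>) \<partial>\<nu>) \<partial>haar)"
      by (rule h\<nu>.Fubini') measurable
    also have "\<dots> = (\<integral>\<^sup>+z. ennreal (2 * q z - 2 * (avg g z)\<^sup>2) \<partial>haar)"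
      by (rule nn_integral_haar_cong, subst nn_integral_square_diff[OF _ bd])
        (auto simp: q_def avg_def)
    also have "\<dots> = ennreal (LINT z|haar. 2 * q z - 2 * (avg g z)\<^sup>2)"
      using AE_haar_norm avg_sq_le iq iA by (intro nn_integral_eq_integral) (auto elim!: eventually_mono)
    also have "(LINT z|haar. 2 * q z - 2 * (avg g z)\<^sup>2) = 2 * ?N - 2 * ?A"
      using iq iA by (simp add: Iq)
    finally show ?thesis .
  qed
  have D: "(\<integral>\<^sup>+c. shift_dist g 1 c \<partial>haar) = ennreal (2 * ?N - 2 * ?m\<^sup>2)"
  proof -
    have "(\<integral>\<^sup>+c. shift_dist g 1 c \<partial>haar) = (\<integral>\<^sup>+z. (\<integral>\<^sup>+c. ennreal ((g z - g (c * z))\<^sup>2) \<partial>haar) \<partial>haar)"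
      unfolding shift_dist_def mult_1_left by (rule hh.Fubini') measurable
    also have "\<dots> = (\<integral>\<^sup>+z. (\<integral>\<^sup>+c. ennreal ((g z - g c)\<^sup>2) \<partial>haar) \<partial>haar)"
      by (rule nn_integral_haar_cong, subst mult.commute, rule nn_integral_haar_rotate) auto
    also have "\<dots> = ennreal (2 * ?N - 2 * ?m\<^sup>2)"
      using AE_haar_norm B by (intro haar.nn_integral_square_diff[of _ B]) (auto elim!: eventually_mono)
    finally show ?thesis .
  qed
  define n where "n = nat \<lceil>2 * K\<rceil>"
  have *: "2 * ?N - 2 * ?m\<^sup>2 \<le> 8 * (fact n)\<^sup>2 * e" if "max 0 (2 * ?N - 2 * ?A) < e" for e
  proof -
    have "ennreal (2 * ?N - 2 * ?m\<^sup>2) \<le> ennreal (8 * (fact n)\<^sup>2 * e)"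
      unfolding D[symmetric]
    proof (rule avg_gap_aux)
      show "2 * K < real n + 1" unfolding n_def using K_ge_1 by linarith
      show "(\<integral>\<^sup>+a. (\<integral>\<^sup>+b. shift_dist g a b \<partial>\<nu>) \<partial>\<nu>) < ennreal e"
        unfolding E using that by (intro ennreal_lessI) auto
    qed (use that in auto)
    then show ?thesis using that by (subst (asm) ennreal_le_iff) auto
  qed
  \<comment> \<open>\<open>avg_gap_aux\<close> asks for a strict and positive bound
    \<open>e\<close>. The loss itself may be zero, so it is approached from above.\<close>
  have "(2 * ?N - 2 * ?m\<^sup>2) / (8 * (fact n)\<^sup>2) \<le> max 0 (2 * ?N - 2 * ?A)"
  proof (rule dense_ge)
    fix e assume "max 0 (2 * ?N - 2 * ?A) < e"
    from *[OF this] have "2 * ?N - 2 * ?m\<^sup>2 \<le> e * (8 * (fact n)\<^sup>2)" by (simp only: mult.commute)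
    moreover have "0 < 8 * (fact n :: real)\<^sup>2" by simp
    ultimately show "(2 * ?N - 2 * ?m\<^sup>2) / (8 * (fact n)\<^sup>2) \<le> e" by (simp only: pos_divide_le_eq)
  qed
  moreover have "?A \<le> ?N"
  proof -
    have "?A \<le> (LINT z|haar. q z)"
      using AE_haar_norm avg_sq_le by (intro integral_mono_AE iA iq) (auto elim!: eventually_mono)
    then show ?thesis by (simp add: Iq)
  qed
  ultimately have "(2 * ?N - 2 * ?m\<^sup>2) * gap \<le> 2 * ?N - 2 * ?A"
    by (simp add: gap_def n_def)
  then show ?thesis by (simp add: algebra_simps)
qed

end

section \<open>Contraction of the averaged half-density action\<close>

text \<open>Nonnegativity everywhere allows free passage between Bochner and nonnegative integrals;
  the bound is confined to the circle, which carries \<open>haar\<close>, because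
  \<open>rootderiv\<close> has a pole off it.\<close>

definition nonneg_bdd :: "real \<Rightarrow> (complex \<Rightarrow> real) \<Rightarrow> bool" where
  "nonneg_bdd B h \<longleftrightarrow> h \<in> borel_measurable borel \<and> (\<forall>z. 0 \<le> h z) \<and> (\<forall>z. norm z = 1 \<longrightarrow> h z \<le> B)"

lemma nonneg_bddD:
  assumes "nonneg_bdd B h"
  shows "h \<in> borel_measurable borel" "0 \<le> h z" "norm z = 1 \<Longrightarrow> h z \<le> B" "norm z = 1 \<Longrightarrow> \<bar>h z\<bar> \<le> B"
  using assms by (auto simp: nonneg_bdd_def)

lemma nonneg_bdd_integrable:
  assumes "nonneg_bdd B h" "nonneg_bdd B' k"
  shows "integrable haar h" "integrable haar (\<lambda>z. h z * k z)"
proof -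
  note m [measurable] = nonneg_bddD(1)[OF assms(1)] nonneg_bddD(1)[OF assms(2)]
  show "integrable haar h"
    using nonneg_bddD(4)[OF assms(1)] by (intro integrable_haar_bounded[of _ B]) auto
  have "\<bar>h z * k z\<bar> \<le> B * B'" if "norm z = 1" for z
    unfolding abs_mult using nonneg_bddD(4)[OF assms(1) that] nonneg_bddD(4)[OF assms(2) that]
    by (intro mult_mono) auto
  then show "integrable haar (\<lambda>z. h z * k z)"
    by (intro integrable_haar_bounded[of _ "B * B'"]) auto
qed

lemma haar_Cauchy_Schwarz:
  assumes f: "nonneg_bdd B f" and g: "nonneg_bdd B' g"
  shows "(LINT z|haar. f z * g z)\<^sup>2 \<le> (LINT z|haar. (f z)\<^sup>2) * (LINT z|haar. (g z)\<^sup>2)"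
proof -
  let ?a = "LINT z|haar. (f z)\<^sup>2" and ?b = "LINT z|haar. (g z)\<^sup>2" and ?c = "LINT z|haar. f z * g z"
  have i: "integrable haar (\<lambda>z. (f z)\<^sup>2)" "integrable haar (\<lambda>z. (g z)\<^sup>2)" "integrable haar (\<lambda>z. f z * g z)"
    using nonneg_bdd_integrable(2)[OF f f] nonneg_bdd_integrable(2)[OF g g] nonneg_bdd_integrable(2)[OF f g]
    by (simp_all add: power2_eq_square)
  have pos: "0 \<le> ?a - 2 * x * ?c + x\<^sup>2 * ?b" for x
  proof -
    have "0 \<le> (LINT z|haar. (f z - x * g z)\<^sup>2)" by simp
    also have "\<dots> = (LINT z|haar. (f z)\<^sup>2 - 2 * x * (f z * g z) + x\<^sup>2 * (g z)\<^sup>2)"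
      by (simp add: power2_eq_square algebra_simps)
    also have "\<dots> = ?a - 2 * x * ?c + x\<^sup>2 * ?b" using i by simp
    finally show ?thesis .
  qed
  show ?thesis
  proof (cases "?b = 0")
    case True
    have "?c = 0"
    proof (rule ccontr)
      assume "?c \<noteq> 0"
      \<comment> \<open>With ?b = 0 the expression is affine in x, and this x gives it the value
        -1.\<close>
      then show False using pos[of "(?a + 1) / (2 * ?c)"] True by simp
    qed
    then show ?thesis using True by simp
  next
    case False
    moreover have "?b \<ge> 0" by simp
    ultimately have b: "?b > 0" by linarith
    have "0 \<le> (?a - 2 * (?c / ?b) * ?c + (?c / ?b)\<^sup>2 * ?b) * ?b"
      using pos[of "?c / ?b"] b by (intro mult_nonneg_nonneg) auto
    also have "\<dots> = ?a * ?b - ?c\<^sup>2" using b by (simp add: field_simps power2_eq_square)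
    finally show ?thesis by simp
  qed
qed

lemma haar_mean_sq_le:
  assumes f: "nonneg_bdd B f" shows "(LINT z|haar. f z)\<^sup>2 \<le> (LINT z|haar. (f z)\<^sup>2)"
  using haar_Cauchy_Schwarz[OF f, of 1 "\<lambda>_. 1"] haar.prob_space by (simp add: nonneg_bdd_def)

lemma integral_haar_transfer:
  fixes F G :: "complex \<Rightarrow> real"
  assumes "F \<in> borel_measurable borel" "G \<in> borel_measurable borel" "\<And>z. 0 \<le> F z" "\<And>z. 0 \<le> G z"
    and "(\<integral>\<^sup>+z. ennreal (F z) \<partial>haar) = (\<integral>\<^sup>+z. ennreal (G z) \<partial>haar)"
  shows "(LINT z|haar. F z) = (LINT z|haar. G z)"
  using assms by (simp add: integral_eq_nn_integral)

lemma integral_haar_rotate: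
  fixes F :: "complex \<Rightarrow> real"
  assumes [measurable]: "F \<in> borel_measurable borel" and "\<And>z. 0 \<le> F z" "norm c = 1"
  shows "(LINT z|haar. F (c * z)) = (LINT z|haar. F z)"
  by (rule integral_haar_transfer) (use assms nn_integral_haar_rotate[of "\<lambda>z. ennreal (F z)" c] in auto)

lemma integral_haar_cnj:
  fixes F :: "complex \<Rightarrow> real"
  assumes [measurable]: "F \<in> borel_measurable borel" and "\<And>z. 0 \<le> F z"
  shows "(LINT z|haar. F (cnj z)) = (LINT z|haar. F z)"
proof (rule integral_haar_transfer)
  show "(\<lambda>z. F (cnj z)) \<in> borel_measurable borel" by measurable
qed (use assms nn_integral_haar_cnj[of "\<lambda>z. ennreal (F z)"] in auto)

lemma integral_haar_disc_auto:
  fixes F :: "complex \<Rightarrow> real"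
  assumes [measurable]: "F \<in> borel_measurable borel" and "\<And>z. 0 \<le> F z" "\<bar>r\<bar> < 1"
  shows "(LINT w|haar. F (disc_auto r w) * (rootderiv r w)\<^sup>2) = (LINT z|haar. F z)"
  by (rule integral_haar_transfer)
    (use assms nn_integral_haar_disc_auto[of r "\<lambda>z. ennreal (F z)"] in \<open>auto simp: ennreal_mult\<close>)

text \<open>Only the square root of the Jacobian is present on the left. By
  \<open>rootderiv_disc_auto\<close> it equals the full Jacobian times a function of the image
  point, and the substitution applies.\<close>

lemma integral_haar_rootderiv_disc_auto:
  fixes F :: "complex \<Rightarrow> real"
  assumes [measurable]: "F \<in> borel_measurable borel" and F: "\<And>z. 0 \<le> F z" and r: "\<bar>r\<bar> < 1"
  shows "(LINT w|haar. rootderiv r w * F (disc_auto r w)) = (LINT z|haar. F z * rootderiv r (- z))"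
proof -
  have "(LINT w|haar. rootderiv r w * F (disc_auto r w))
      = (LINT w|haar. (F (disc_auto r w) * rootderiv r (- disc_auto r w)) * (rootderiv r w)\<^sup>2)"
  proof (rule integral_cong_AE)
    show "AE w in haar. rootderiv r w * F (disc_auto r w)
        = F (disc_auto r w) * rootderiv r (- disc_auto r w) * (rootderiv r w)\<^sup>2"
      using AE_haar_norm
    proof eventually_elim
      fix w :: complex assume "norm w = 1"
      from rootderiv_disc_auto[OF r this]
      show "rootderiv r w * F (disc_auto r w)
        = F (disc_auto r w) * rootderiv r (- disc_auto r w) * (rootderiv r w)\<^sup>2"
        by (simp add: power2_eq_square mult_ac)
    qed
  qed auto
  also have "\<dots> = (LINT z|haar. F z * rootderiv r (- z))"
    by (rule integral_haar_disc_auto) (auto simp: F r rootderiv_nonneg)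
  finally show ?thesis .
qed

lemma rootderiv_le:
  assumes r: "\<bar>r\<bar> < 1" and z: "norm z = 1" shows "rootderiv r z \<le> 1 / (1 - \<bar>r\<bar>)"
proof -
  have "1 - \<bar>r\<bar> \<le> norm (1 + of_real r * z)"
    using norm_triangle_ineq4[of "1 + of_real r * z" "of_real r * z"] z by (simp add: norm_mult)
  moreover have "sqrt (1 - r\<^sup>2) \<le> 1" using r by (simp add: abs_square_le_1)
  ultimately show ?thesis unfolding rootderiv_def using r by (intro frac_le) (auto simp: abs_square_le_1)
qed

lemma nonneg_bdd_rootderiv:
  assumes "\<bar>r\<bar> < 1" shows "nonneg_bdd (1 / (1 - \<bar>r\<bar>)) (rootderiv r)"
  using assms by (auto simp: nonneg_bdd_def rootderiv_nonneg rootderiv_le)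

definition rootderiv_mean :: "real \<Rightarrow> real" where
  "rootderiv_mean r = (LINT z|haar. rootderiv r z)"

lemma integral_haar_rootderiv_sq: "\<bar>r\<bar> < 1 \<Longrightarrow> (LINT z|haar. (rootderiv r z)\<^sup>2) = 1"
  using integral_haar_disc_auto[of "\<lambda>_. 1" r] haar.prob_space by simp

text \<open>Since \<open>rootderiv r\<close> has unit L^2 norm, its squared distance from 1 is 2 - 2
  * \<open>rootderiv_mean r\<close>. That distance is positive: of two antipodal points one
  satisfies r * Re z >= 0, and there \<open>rootderiv\<close> is at most sqrt (1 - r^2) < 1.\<close>

lemma rootderiv_mean_bounds:
  assumes r: "\<bar>r\<bar> < 1" "r \<noteq> 0" shows "0 \<le> rootderiv_mean r" "rootderiv_mean r < 1"
proof -
  let ?a = "rootderiv r" and ?t = "sqrt (1 - r\<^sup>2)"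
  show "0 \<le> rootderiv_mean r"
    using r by (auto simp: rootderiv_mean_def rootderiv_nonneg)
  note a = nonneg_bdd_integrable[OF nonneg_bdd_rootderiv[OF r(1)] nonneg_bdd_rootderiv[OF r(1)]]
  have sq: "(1 - ?a z)\<^sup>2 = 1 - 2 * ?a z + (?a z)\<^sup>2" for z by (simp add: power2_diff)
  have ia: "integrable haar (\<lambda>z. (1 - ?a z)\<^sup>2)"
    unfolding sq using a by (auto simp: power2_eq_square)
  have Ia: "(LINT z|haar. (1 - ?a z)\<^sup>2) = 2 - 2 * rootderiv_mean r"
    unfolding sq using a haar.prob_space
    by (simp add: power2_eq_square rootderiv_mean_def integral_haar_rootderiv_sq[OF r(1), unfolded power2_eq_square])
  have t: "?t < 1" "0 \<le> ?t" using r by (auto simp: abs_square_le_1)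
  have *: "(1 - ?t)\<^sup>2 \<le> (1 - ?a z)\<^sup>2" if "norm z = 1" "0 \<le> r * Re z" for z
  proof -
    have "1 \<le> (norm (1 + of_real r * z))\<^sup>2" using that by (simp add: norm_one_add_sq)
    then have "1 \<le> norm (1 + of_real r * z)" by (metis norm_ge_zero one_le_power power2_le_imp_le power_one)
    then have "?a z \<le> ?t / 1" unfolding rootderiv_def using t by (intro divide_left_mono) auto
    then show ?thesis using t by (intro power_mono) auto
  qed
  have "(1 - ?t)\<^sup>2 \<le> (1 - ?a z)\<^sup>2 + (1 - ?a (- z))\<^sup>2" if z: "norm z = 1" for z
  proof (cases "0 \<le> r * Re z")
    case True then show ?thesis using *[OF z] by (simp add: add_increasing2)
  next
    case False then show ?thesis using *[of "- z"] z by (simp add: add_increasing)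
  qed
  moreover have R: "(LINT z|haar. (1 - ?a (- z))\<^sup>2) = (LINT z|haar. (1 - ?a z)\<^sup>2)"
    using integral_haar_rotate[of "\<lambda>z. (1 - ?a z)\<^sup>2" "- 1"] by simp
  moreover have ia': "integrable haar (\<lambda>z. (1 - ?a (- z))\<^sup>2)"
  proof (rule integrable_haar_bounded)
    fix z :: complex assume z: "norm z = 1"
    have "\<bar>1 - ?a (- z)\<bar> \<le> 1 + 1 / (1 - \<bar>r\<bar>)"
    proof -
      have "norm (- z) = 1" using z by simp
      from rootderiv_le[OF r(1) this] rootderiv_nonneg[OF r(1), of "- z"] show ?thesis by linarith
    qed
    then have "\<bar>1 - ?a (- z)\<bar>\<^sup>2 \<le> (1 + 1 / (1 - \<bar>r\<bar>))\<^sup>2" by (intro power_mono) auto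
    then show "norm ((1 - ?a (- z))\<^sup>2) \<le> (1 + 1 / (1 - \<bar>r\<bar>))\<^sup>2" by simp
  qed auto
  ultimately have "(LINT z|haar. (1 - ?t)\<^sup>2) \<le> (LINT z|haar. (1 - ?a z)\<^sup>2 + (1 - ?a (- z))\<^sup>2)"
    using AE_haar_norm ia by (intro integral_mono_AE) (auto elim!: eventually_mono)
  also have "\<dots> = 2 * (2 - 2 * rootderiv_mean r)"
    using ia ia' R Ia by simp
  finally have "(1 - ?t)\<^sup>2 \<le> 2 * (2 - 2 * rootderiv_mean r)" using haar.prob_space by simp
  moreover have "0 < (1 - ?t)\<^sup>2" using t by simp
  ultimately have "0 < 2 * (2 - 2 * rootderiv_mean r)" by (rule order.strict_trans2[rotated])
  then show "rootderiv_mean r < 1" by simp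
qed

section \<open>One averaged scattering step as an operator on L^2 of the circle\<close>

context circle_law
begin

lemma nonneg_bdd_avg:
  assumes h: "nonneg_bdd B h" shows "nonneg_bdd B (avg h)"
proof -
  note hm [measurable] = nonneg_bddD(1)[OF h]
  have "avg h z \<le> B" if z: "norm z = 1" for z
  proof -
    have *: "AE a in \<nu>. \<bar>h (a * z)\<bar> \<le> B" "AE a in \<nu>. h (a * z) \<le> B"
      using AE_law_norm by (eventually_elim, use nonneg_bddD(3,4)[OF h] z in \<open>simp add: norm_mult\<close>)+
    have "avg h z \<le> (LINT a|\<nu>. B)"
      unfolding avg_def
    proof (rule integral_mono_AE)
      show "integrable \<nu> (\<lambda>a. h (a * z))" using * by (intro integrable_const_bound[of _ B]) auto
    qed (use * in auto)
    then show ?thesis by simp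
  qed
  then show ?thesis using nonneg_bddD(2)[OF h] by (auto simp: nonneg_bdd_def) (simp add: avg_def)
qed

lemma ennreal_avg:
  assumes h: "nonneg_bdd B h" and z: "norm z = 1"
  shows "ennreal (avg h z) = (\<integral>\<^sup>+a. ennreal (h (a * z)) \<partial>\<nu>)"
  unfolding avg_def
proof (rule nn_integral_eq_integral[symmetric])
  note [measurable] = nonneg_bddD(1)[OF h]
  show "integrable \<nu> (\<lambda>a. h (a * z))"
    using AE_law_norm nonneg_bddD(4)[OF h] z
    by (intro integrable_const_bound[of _ B]) (auto elim!: eventually_mono simp: norm_mult)
qed (auto simp: nonneg_bddD(2)[OF h])

lemma avg_contract:
  assumes h: "nonneg_bdd B h" shows "(LINT z|haar. (avg h z)\<^sup>2) \<le> (LINT z|haar. (h z)\<^sup>2)"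
proof -
  have "gap * (LINT z|haar. h z)\<^sup>2 \<le> gap * (LINT z|haar. (h z)\<^sup>2)"
    using haar_mean_sq_le[OF h] gap_bounds by (intro mult_left_mono) auto
  then show ?thesis using avg_gap[OF nonneg_bddD(1)[OF h] nonneg_bddD(4)[OF h]]
    by (simp add: algebra_simps)
qed

text \<open>The action on half-densities: the averaged \<open>h\<close> is pulled back along
  \<open>s * disc_auto r\<close> and weighted by the root of the Jacobian. With this weight the
  pull-back is an isometry of L^2.\<close>

definition weighted :: "real \<Rightarrow> complex \<Rightarrow> (complex \<Rightarrow> real) \<Rightarrow> complex \<Rightarrow> real" where
  "weighted r s h w = rootderiv r w * avg h (s * disc_auto r w)"

lemma nonneg_bdd_weighted:
  assumes h: "nonneg_bdd B h" and r: "\<bar>r\<bar> < 1" and s: "norm s = 1"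
  shows "nonneg_bdd (1 / (1 - \<bar>r\<bar>) * B) (weighted r s h)"
proof -
  note ah = nonneg_bdd_avg[OF h]
  have [measurable]: "h \<in> borel_measurable borel" by (rule nonneg_bddD(1)[OF h])
  have "weighted r s h z \<le> 1 / (1 - \<bar>r\<bar>) * B" if "norm z = 1" for z
    unfolding weighted_def using nonneg_bddD(2,3)[OF ah] rootderiv_le[OF r that] r
    by (intro mult_mono) (auto simp: norm_mult s norm_disc_auto[OF r that])
  then show ?thesis unfolding nonneg_bdd_def weighted_def[abs_def]
    using nonneg_bddD(2)[OF ah] rootderiv_nonneg[OF r] by auto
qed

lemma weighted_norm:
  assumes h: "nonneg_bdd B h" and r: "\<bar>r\<bar> < 1" and s: "norm s = 1"
  shows "(LINT z|haar. (weighted r s h z)\<^sup>2) \<le> (LINT z|haar. (h z)\<^sup>2)"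
proof -
  have [measurable]: "h \<in> borel_measurable borel" by (rule nonneg_bddD(1)[OF h])
  have "(LINT z|haar. (weighted r s h z)\<^sup>2) = (LINT w|haar. (avg h (s * disc_auto r w))\<^sup>2 * (rootderiv r w)\<^sup>2)"
    by (simp add: weighted_def power_mult_distrib mult.commute)
  also have "\<dots> = (LINT z|haar. (avg h (s * z))\<^sup>2)"
    by (rule integral_haar_disc_auto) (auto simp: r)
  also have "\<dots> = (LINT z|haar. (avg h z)\<^sup>2)"
    by (rule integral_haar_rotate) (auto simp: s)
  also have "\<dots> \<le> (LINT z|haar. (h z)\<^sup>2)" by (rule avg_contract[OF h])
  finally show ?thesis .
qed

lemma avg_adjoint:
  assumes f: "nonneg_bdd B f" and b: "nonneg_bdd B' b" and s: "norm s = 1"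
  shows "(LINT z|haar. avg f (s * z) * b z) = (LINT z|haar. f z * (LINT a|\<nu>. b (cnj a * (cnj s * z))))"
proof -
  note [measurable] = nonneg_bddD(1)[OF f] nonneg_bddD(1)[OF b]
  interpret h\<nu>: pair_sigma_finite haar \<nu> ..
  have avgb: "ennreal (LINT a|\<nu>. b (cnj a * z)) = (\<integral>\<^sup>+a. ennreal (b (cnj a * z)) \<partial>\<nu>)" if "norm z = 1" for z
  proof (rule nn_integral_eq_integral[symmetric])
    show "integrable \<nu> (\<lambda>a. b (cnj a * z))"
      using AE_law_norm nonneg_bddD(4)[OF b] that
      by (intro integrable_const_bound[of _ B']) (auto elim!: eventually_mono simp: norm_mult)
  qed (auto simp: nonneg_bddD(2)[OF b])
  show ?thesis
  proof (rule integral_haar_transfer)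
    have "(\<integral>\<^sup>+z. ennreal (avg f (s * z) * b z) \<partial>haar)
        = (\<integral>\<^sup>+z. (\<integral>\<^sup>+a. ennreal (f (a * (s * z)) * b z) \<partial>\<nu>) \<partial>haar)"
      by (rule nn_integral_haar_cong)
        (simp add: ennreal_mult nonneg_bddD(2)[OF f] nonneg_bddD(2)[OF b] ennreal_avg[OF f] norm_mult s nn_integral_multc
          nonneg_bddD(2)[OF nonneg_bdd_avg[OF f]])
    also have "\<dots> = (\<integral>\<^sup>+a. (\<integral>\<^sup>+z. ennreal (f (a * (s * z)) * b z) \<partial>haar) \<partial>\<nu>)"
      by (rule h\<nu>.Fubini'[symmetric]) measurable
    also have "\<dots> = (\<integral>\<^sup>+a. (\<integral>\<^sup>+z. ennreal (f z * b (cnj a * (cnj s * z))) \<partial>haar) \<partial>\<nu>)"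
    proof (rule nn_integral_cong_AE, use AE_law_norm in eventually_elim)
      fix a :: complex assume a: "norm a = 1"
      have as: "cnj a * (cnj s * (a * s * z)) = z" for z
      proof -
        have "cnj a * (cnj s * (a * s * z)) = (a * cnj a) * (s * cnj s) * z" by (simp only: mult_ac)
        moreover have "a * cnj a = 1" "s * cnj s = 1"
          using complex_norm_square[of a] complex_norm_square[of s] a s by simp_all
        ultimately show ?thesis by (simp only: mult_1)
      qed
      have "(\<integral>\<^sup>+z. ennreal (f z * b (cnj a * (cnj s * z))) \<partial>haar)
          = (\<integral>\<^sup>+z. ennreal (f (a * s * z) * b (cnj a * (cnj s * (a * s * z)))) \<partial>haar)"
        by (rule nn_integral_haar_rotate[symmetric]) (auto simp: norm_mult a s)
      then show "(\<integral>\<^sup>+z. ennreal (f (a * (s * z)) * b z) \<partial>haar)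
          = (\<integral>\<^sup>+z. ennreal (f z * b (cnj a * (cnj s * z))) \<partial>haar)"
        by (simp only: as) (simp only: mult.assoc)
    qed
    also have "\<dots> = (\<integral>\<^sup>+z. (\<integral>\<^sup>+a. ennreal (f z * b (cnj a * (cnj s * z))) \<partial>\<nu>) \<partial>haar)"
      by (rule h\<nu>.Fubini') measurable
    also have "\<dots> = (\<integral>\<^sup>+z. ennreal (f z * (LINT a|\<nu>. b (cnj a * (cnj s * z)))) \<partial>haar)"
      by (rule nn_integral_haar_cong)
        (simp add: ennreal_mult nonneg_bddD(2)[OF f] nonneg_bddD(2)[OF b] avgb norm_mult s nn_integral_cmult)
    finally show "(\<integral>\<^sup>+z. ennreal (avg f (s * z) * b z) \<partial>haar)
        = (\<integral>\<^sup>+z. ennreal (f z * (LINT a|\<nu>. b (cnj a * (cnj s * z)))) \<partial>haar)" .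
  qed (auto simp: nonneg_bddD(2)[OF f] nonneg_bddD(2)[OF b] nonneg_bddD(2)[OF nonneg_bdd_avg[OF f]])
qed

text \<open>Moved to the other side of the pairing, the average no longer acts on the unknown
  \<open>h\<close> but on the fixed function \<open>b\<close>, of unit norm and mean
  \<open>rootderiv_mean r\<close>. The gap shortens \<open>b\<close> by a known factor, and
  Cauchy-Schwarz gives a bound uniform in \<open>h\<close>.\<close>

lemma weighted_mean:
  assumes h: "nonneg_bdd B h" and r: "\<bar>r\<bar> < 1" and s: "norm s = 1"
  shows "(LINT z|haar. weighted r s h z)\<^sup>2
    \<le> (1 - gap + gap * (rootderiv_mean r)\<^sup>2) * (LINT z|haar. (h z)\<^sup>2)"
proof -
  define b where "b z = rootderiv r (- z)" for z
  note [measurable] = nonneg_bddD(1)[OF h]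
  have b: "nonneg_bdd (1 / (1 - \<bar>r\<bar>)) b"
    using nonneg_bdd_rootderiv[OF r] by (auto simp: nonneg_bdd_def b_def[abs_def])
  note [measurable] = nonneg_bddD(1)[OF b]
  \<comment> \<open>The adjoint averages over conjugate phases; this symmetry of \<open>b\<close>
    turns it back into \<open>avg\<close>.\<close>
  have b_cnj: "b (cnj z) = b z" for z
  proof -
    have "1 + of_real r * (- cnj z) = cnj (1 + of_real r * (- z))" by simp
    then show ?thesis unfolding b_def rootderiv_def by (metis complex_mod_cnj)
  qed
  have c: "(LINT a|\<nu>. b (cnj a * (cnj s * z))) = avg b (s * cnj z)" for z
    unfolding avg_def using b_cnj[of "a * (s * cnj z)" for a] by simp
  have ab: "nonneg_bdd (1 / (1 - \<bar>r\<bar>)) (\<lambda>z. avg b (s * cnj z))"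
    using nonneg_bdd_avg[OF b] s by (auto simp: nonneg_bdd_def norm_mult)
  have "(LINT z|haar. weighted r s h z) = (LINT z|haar. avg h (s * z) * b z)"
    unfolding weighted_def b_def
    using nonneg_bddD(2)[OF nonneg_bdd_avg[OF h]] r
    by (intro integral_haar_rootderiv_disc_auto) auto
  also have "\<dots> = (LINT z|haar. h z * avg b (s * cnj z))"
    unfolding avg_adjoint[OF h b s] c ..
  finally have 1: "(LINT z|haar. weighted r s h z)\<^sup>2
      \<le> (LINT z|haar. (h z)\<^sup>2) * (LINT z|haar. (avg b (s * cnj z))\<^sup>2)"
    using haar_Cauchy_Schwarz[OF h ab] by simp
  have "(LINT z|haar. (avg b (s * cnj z))\<^sup>2) = (LINT z|haar. (avg b (s * z))\<^sup>2)"
    using integral_haar_cnj[of "\<lambda>z. (avg b (s * z))\<^sup>2"] by simp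
  also have "\<dots> = (LINT z|haar. (avg b z)\<^sup>2)"
    by (rule integral_haar_rotate) (auto simp: s)
  also have "\<dots> \<le> (1 - gap) * (LINT z|haar. (b z)\<^sup>2) + gap * (LINT z|haar. b z)\<^sup>2"
    by (rule avg_gap[OF nonneg_bddD(1)[OF b] nonneg_bddD(4)[OF b]])
  also have "(LINT z|haar. (b z)\<^sup>2) = 1"
    using integral_haar_rotate[of "\<lambda>z. (rootderiv r z)\<^sup>2" "- 1"]
    by (simp add: b_def integral_haar_rootderiv_sq[OF r])
  also have "(LINT z|haar. b z) = rootderiv_mean r"
    using integral_haar_rotate[of "rootderiv r" "- 1"] r by (simp add: b_def rootderiv_mean_def rootderiv_nonneg)
  finally have "(LINT z|haar. (h z)\<^sup>2) * (LINT z|haar. (avg b (s * cnj z))\<^sup>2)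
      \<le> (LINT z|haar. (h z)\<^sup>2) * ((1 - gap) * 1 + gap * (rootderiv_mean r)\<^sup>2)"
    by (intro mult_left_mono) auto
  with 1 show ?thesis by (simp add: mult.commute)
qed

text \<open>Its square results from \<open>avg_gap\<close> when the two terms on the right are
  bounded by \<open>weighted_norm\<close> and \<open>weighted_mean\<close>. It is below 1 because
  \<open>rootderiv_mean r\<close> is.\<close>

definition rate :: "real \<Rightarrow> real" where
  "rate r = sqrt (1 - gap + gap * (1 - gap + gap * (rootderiv_mean r)\<^sup>2))"

lemma rate_bounds:
  assumes r: "\<bar>r\<bar> < 1" "r \<noteq> 0" shows "0 \<le> rate r" "rate r < 1"
    and "(rate r)\<^sup>2 = 1 - gap + gap * (1 - gap + gap * (rootderiv_mean r)\<^sup>2)"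
proof -
  note g = gap_bounds and m = rootderiv_mean_bounds[OF r]
  have "(rootderiv_mean r)\<^sup>2 < 1" using m by (simp add: abs_square_less_1)
  then have "gap * (rootderiv_mean r)\<^sup>2 < gap * 1" using g by (intro mult_strict_left_mono) auto
  then have "gap * (1 - gap + gap * (rootderiv_mean r)\<^sup>2) < gap * 1"
    using g by (intro mult_strict_left_mono) auto
  moreover have "0 \<le> gap * (1 - gap + gap * (rootderiv_mean r)\<^sup>2)" using g by simp
  ultimately show "0 \<le> rate r" "rate r < 1"
    "(rate r)\<^sup>2 = 1 - gap + gap * (1 - gap + gap * (rootderiv_mean r)\<^sup>2)"
    using g by (simp_all add: rate_def)
qed

text \<open>What is left of \<open>cascade\<close> once both phases of each of \<open>j\<close>
  sites are integrated out, see \<open>expected_cascade\<close>. The outer \<open>avg\<close>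
  belongs to the phase in front of \<open>disc_auto\<close>, the one inside \<open>weighted\<close>
  to the phase behind it.\<close>

fun moment :: "real \<Rightarrow> complex \<Rightarrow> nat \<Rightarrow> complex \<Rightarrow> real" where
  "moment r s 0 z = 1"
| "moment r s (Suc j) z = avg (weighted r s (moment r s j)) (s * z)"

lemma moment_bdd:
  assumes r: "\<bar>r\<bar> < 1" and s: "norm s = 1"
  shows "\<exists>B. nonneg_bdd B (moment r s j)"
proof (induction j)
  case 0
  show ?case by (intro exI[of _ 1]) (simp add: nonneg_bdd_def)
next
  case (Suc j)
  then obtain B where "nonneg_bdd B (moment r s j)" by blast
  then have "nonneg_bdd (1 / (1 - \<bar>r\<bar>) * B) (avg (weighted r s (moment r s j)))"
    by (intro nonneg_bdd_avg nonneg_bdd_weighted r s)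
  note g = this and [measurable] = nonneg_bddD(1)[OF this]
  have "moment r s (Suc j) = (\<lambda>z. avg (weighted r s (moment r s j)) (s * z))" by (rule ext) simp
  then have "moment r s (Suc j) \<in> borel_measurable borel" by simp
  then have "nonneg_bdd (1 / (1 - \<bar>r\<bar>) * B) (moment r s (Suc j))"
    using nonneg_bddD(2,3)[OF g] s by (auto simp: nonneg_bdd_def norm_mult)
  then show ?case by blast
qed

lemma moment_norm:
  assumes r: "\<bar>r\<bar> < 1" "r \<noteq> 0" and s: "norm s = 1"
  shows "(LINT z|haar. (moment r s j z)\<^sup>2) \<le> (rate r)\<^sup>2 ^ j"
proof (induction j)
  case 0 then show ?case using haar.prob_space by simp
next
  case (Suc j)
  let ?h = "moment r s j" let ?g = "weighted r s ?h"
  obtain B where h: "nonneg_bdd B ?h" using moment_bdd[OF r(1) s] by blast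
  note g = nonneg_bdd_weighted[OF h r(1) s]
  note [measurable] = nonneg_bddD(1)[OF g]
  have "(LINT z|haar. (moment r s (Suc j) z)\<^sup>2) = (LINT z|haar. (avg ?g z)\<^sup>2)"
    using integral_haar_rotate[of "\<lambda>z. (avg ?g z)\<^sup>2" s] s by simp
  also have "\<dots> \<le> (1 - gap) * (LINT z|haar. (?g z)\<^sup>2) + gap * (LINT z|haar. ?g z)\<^sup>2"
    by (rule avg_gap[OF nonneg_bddD(1)[OF g] nonneg_bddD(4)[OF g]])
  also have "\<dots> \<le> (1 - gap) * (LINT z|haar. (?h z)\<^sup>2)
      + gap * ((1 - gap + gap * (rootderiv_mean r)\<^sup>2) * (LINT z|haar. (?h z)\<^sup>2))"
    using gap_bounds weighted_norm[OF h r(1) s] weighted_mean[OF h r(1) s]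
    by (intro add_mono mult_left_mono) auto
  also have "\<dots> = (rate r)\<^sup>2 * (LINT z|haar. (?h z)\<^sup>2)"
    unfolding rate_bounds(3)[OF r] by (simp add: algebra_simps)
  also have "\<dots> \<le> (rate r)\<^sup>2 * (rate r)\<^sup>2 ^ j"
    using Suc by (intro mult_left_mono) auto
  finally show ?case by simp
qed

text \<open>The contraction is in L^2, but the reflection coefficient at the far end is not
  uniformly distributed, so a pointwise bound is required. The outermost average has density at most
  \<open>K\<close>, hence is at most \<open>K\<close> times an L^1 norm; one site is spent on
  this.\<close>

lemma moment_le:
  assumes r: "\<bar>r\<bar> < 1" "r \<noteq> 0" and s: "norm s = 1" and z: "norm z = 1"
  shows "moment r s (Suc j) z \<le> K * rate r ^ j"
proof -
  let ?h = "moment r s j" let ?g = "weighted r s ?h"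
  obtain B where h: "nonneg_bdd B ?h" using moment_bdd[OF r(1) s] by blast
  note g = nonneg_bdd_weighted[OF h r(1) s]
  note [measurable] = nonneg_bddD(1)[OF g]
  have sz: "norm (s * z) = 1" using s z by (simp add: norm_mult)
  have ig: "integrable \<nu> (\<lambda>a. ?g (a * (s * z)))"
    using AE_law_norm nonneg_bddD(4)[OF g] sz
    by (intro integrable_const_bound[of _ "1 / (1 - \<bar>r\<bar>) * B"]) (auto elim!: eventually_mono simp: norm_mult)
  have "ennreal (moment r s (Suc j) z) = (\<integral>\<^sup>+a. ennreal (?g (a * (s * z))) \<partial>\<nu>)"
    using ig nonneg_bddD(2)[OF g] by (simp add: avg_def nn_integral_eq_integral)
  also have "\<dots> \<le> ennreal K * (\<integral>\<^sup>+a. ennreal (?g (a * (s * z))) \<partial>haar)"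
    by (rule law_le) measurable
  also have "(\<integral>\<^sup>+a. ennreal (?g (a * (s * z))) \<partial>haar) = (\<integral>\<^sup>+a. ennreal (?g a) \<partial>haar)"
    by (subst mult.commute, rule nn_integral_haar_rotate) (auto simp: sz)
  also have "\<dots> = ennreal (LINT a|haar. ?g a)"
    using nonneg_bdd_integrable(1)[OF g g] nonneg_bddD(2)[OF g] by (intro nn_integral_eq_integral) auto
  finally have 1: "moment r s (Suc j) z \<le> K * (LINT a|haar. ?g a)"
    using K_ge_1 nonneg_bddD(2)[OF g] by (simp add: ennreal_mult[symmetric] ennreal_le_iff)
  have "(LINT a|haar. ?g a)\<^sup>2 \<le> (LINT a|haar. (?g a)\<^sup>2)" by (rule haar_mean_sq_le[OF g])
  also have "\<dots> \<le> (LINT a|haar. (?h a)\<^sup>2)" by (rule weighted_norm[OF h r(1) s])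
  also have "\<dots> \<le> (rate r)\<^sup>2 ^ j" by (rule moment_norm[OF r s])
  also have "\<dots> = (rate r ^ j)\<^sup>2" by (simp add: power_mult[symmetric] mult.commute)
  finally have "(LINT a|haar. ?g a) \<le> rate r ^ j"
    by (rule power2_le_imp_le) (use rate_bounds(1)[OF r] in simp)
  then show ?thesis using 1 K_ge_1 by (meson mult_left_mono order_trans zero_le_one)
qed

end

section \<open>Scattering by a half line\<close>

text \<open>Membership includes Borel measurability on the whole plane, where \<open>haar\<close> is
  defined; continuity on the closed disc does not control the values outside.\<close>

definition disc_algebra :: "(complex \<Rightarrow> complex) set" where
  "disc_algebra = {F. F \<in> borel_measurable borel \<and> continuous_on (cball 0 1) F \<and> F holomorphic_on ball 0 1}"

lemma disc_algebra_measurable: "F \<in> disc_algebra \<Longrightarrow> F \<in> borel_measurable borel"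
  by (simp add: disc_algebra_def)

lemma disc_algebra_mean_value: "F \<in> disc_algebra \<Longrightarrow> (LINT z|haar. F z) = F 0"
  by (intro integral_haar_mean_value) (auto simp: disc_algebra_def)

lemma disc_algebra_const [intro!, simp]: "(\<lambda>z. c) \<in> disc_algebra"
  by (auto simp: disc_algebra_def)

lemma disc_algebra_ident [intro!, simp]: "(\<lambda>z. z) \<in> disc_algebra"
  by (auto simp: disc_algebra_def)

lemma disc_algebra_add:
  "F \<in> disc_algebra \<Longrightarrow> G \<in> disc_algebra \<Longrightarrow> (\<lambda>z. F z + G z) \<in> disc_algebra"
  by (auto simp: disc_algebra_def intro!: continuous_intros holomorphic_intros)

lemma disc_algebra_diff:
  "F \<in> disc_algebra \<Longrightarrow> G \<in> disc_algebra \<Longrightarrow> (\<lambda>z. F z - G z) \<in> disc_algebra"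
  by (auto simp: disc_algebra_def intro!: continuous_intros holomorphic_intros)

lemma disc_algebra_mult:
  "F \<in> disc_algebra \<Longrightarrow> G \<in> disc_algebra \<Longrightarrow> (\<lambda>z. F z * G z) \<in> disc_algebra"
  by (auto simp: disc_algebra_def intro!: continuous_intros holomorphic_intros)

lemma disc_algebra_power: "F \<in> disc_algebra \<Longrightarrow> (\<lambda>z. F z ^ n) \<in> disc_algebra"
  by (auto simp: disc_algebra_def intro!: continuous_intros holomorphic_intros)

lemma disc_algebra_divide:
  "F \<in> disc_algebra \<Longrightarrow> G \<in> disc_algebra \<Longrightarrow> (\<And>z. norm z \<le> 1 \<Longrightarrow> G z \<noteq> 0) \<Longrightarrow> (\<lambda>z. F z / G z) \<in> disc_algebra"
  by (auto simp: disc_algebra_def intro!: continuous_intros holomorphic_intros)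

lemma disc_algebra_prod:
  "(\<And>i. i \<in> A \<Longrightarrow> F i \<in> disc_algebra) \<Longrightarrow> (\<lambda>z. \<Prod>i\<in>A. F i z) \<in> disc_algebra"
  by (induction A rule: infinite_finite_induct) (auto intro: disc_algebra_mult)

lemmas disc_algebra_intros =
  disc_algebra_add disc_algebra_diff disc_algebra_mult disc_algebra_power disc_algebra_prod

lemma disc_algebra_bounded:
  assumes "F \<in> disc_algebra" shows "\<exists>B. \<forall>z. norm z \<le> 1 \<longrightarrow> norm (F z) \<le> B"
proof -
  have "compact (F ` cball 0 1)"
    using assms by (intro compact_continuous_image) (auto simp: disc_algebra_def)
  then have "bounded (F ` cball 0 1)" by (rule compact_imp_bounded)
  then obtain B where "\<forall>x\<in>F ` cball 0 1. norm x \<le> B" unfolding bounded_iff by blast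
  then show ?thesis by (intro exI[of _ B]) auto
qed

lemma disc_algebra_integrable:
  assumes "F \<in> disc_algebra" shows "integrable haar F"
proof -
  obtain B where B: "\<forall>z. norm z \<le> 1 \<longrightarrow> norm (F z) \<le> B"
    using disc_algebra_bounded[OF assms] by (elim exE)
  show ?thesis
  proof (rule integrable_haar_bounded[OF disc_algebra_measurable[OF assms]])
    show "norm (F z) \<le> B" if "norm z = 1" for z using B that by simp
  qed
qed

lemma norm_disc_auto_le:
  assumes r: "\<bar>r\<bar> < 1" and w: "norm w \<le> 1" shows "norm (disc_auto r w) \<le> 1"
proof -
  have "(norm (1 + of_real r * w))\<^sup>2 - (norm (of_real r + w))\<^sup>2 = (1 - r\<^sup>2) * (1 - (norm w)\<^sup>2)"
    unfolding cmod_power2 by (simp add: power2_eq_square algebra_simps)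
  moreover have "0 \<le> (1 - r\<^sup>2) * (1 - (norm w)\<^sup>2)"
    using r w by (intro mult_nonneg_nonneg) (auto simp: abs_square_le_1)
  ultimately have "(norm (of_real r + w))\<^sup>2 \<le> (norm (1 + of_real r * w))\<^sup>2" by linarith
  then have "norm (of_real r + w) \<le> norm (1 + of_real r * w)"
    by (rule power2_le_imp_le) simp
  then show ?thesis using disc_auto_denom_nonzero[OF r w]
    by (simp add: disc_auto_def norm_divide)
qed

text \<open>The reflection coefficient of \<open>n\<close> sites starting at site \<open>k\<close>, behind which the wave is
  totally reflected; \<open>s\<close> is the reciprocal of the spectral parameter.\<close>

fun reflection :: "real \<Rightarrow> (nat \<Rightarrow> complex) \<Rightarrow> (nat \<Rightarrow> complex) \<Rightarrow> nat \<Rightarrow> nat \<Rightarrow> complex \<Rightarrow> complex" where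
  "reflection r u v 0 k s = 1"
| "reflection r u v (Suc n) k s = s * v k * disc_auto r (s * u k * reflection r u v n (Suc k) s)"

text \<open>The denominator sums the round trips between site \<open>i\<close> and the line behind
  it, where \<open>M - Suc i\<close> sites precede the reflector. The phase of the transmitted wave
  is left out, so that a path and its reverse share the same factor.\<close>

definition hop :: "real \<Rightarrow> (nat \<Rightarrow> complex) \<Rightarrow> (nat \<Rightarrow> complex) \<Rightarrow> nat \<Rightarrow> nat \<Rightarrow> complex \<Rightarrow> complex" where
  "hop r u v M i s = s * of_real (sqrt (1 - r\<^sup>2)) /
     (1 + of_real r * (s * u i * reflection r u v (M - Suc i) (Suc i) s))"

text \<open>With \<open>p = u\<close> this is the amplitude of the wave transmitted from site \<open>0\<close> to site \<open>k\<close>, with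
  \<open>p = v\<close> that of the reversed path.\<close>

definition amplitude :: "real \<Rightarrow> (nat \<Rightarrow> complex) \<Rightarrow> (nat \<Rightarrow> complex) \<Rightarrow> nat \<Rightarrow> (nat \<Rightarrow> complex) \<Rightarrow> nat \<Rightarrow> complex \<Rightarrow> complex" where
  "amplitude r u v M p k s = (\<Prod>i<k. p i * hop r u v M i s)"

text \<open>The modulus of the transmission amplitude on the unit circle, as a function of the reflection
  coefficient \<open>z\<close> at the far end.\<close>

fun cascade :: "real \<Rightarrow> complex \<Rightarrow> (nat \<Rightarrow> complex) \<Rightarrow> (nat \<Rightarrow> complex) \<Rightarrow> nat \<Rightarrow> complex \<Rightarrow> real" where
  "cascade r s u v 0 z = 1"
| "cascade r s u v (Suc j) z = rootderiv r (s * u j * z) * cascade r s u v j (s * v j * disc_auto r (s * u j * z))"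

lemma measurable_reflection [measurable (raw)]:
  assumes "\<And>i. (\<lambda>x. u x i) \<in> borel_measurable N" "\<And>i. (\<lambda>x. v x i) \<in> borel_measurable N"
    "s \<in> borel_measurable N"
  shows "(\<lambda>x. reflection r (u x) (v x) n k (s x)) \<in> borel_measurable N"
  by (induction n arbitrary: k) (use assms in \<open>auto intro!: measurable_compose[OF _ measurable_disc_auto]\<close>)

lemma measurable_cascade [measurable (raw)]:
  assumes "\<And>i. (\<lambda>x. u x i) \<in> borel_measurable N" "\<And>i. (\<lambda>x. v x i) \<in> borel_measurable N"
    "s \<in> borel_measurable N" "z \<in> borel_measurable N"
  shows "(\<lambda>x. cascade r (s x) (u x) (v x) j (z x)) \<in> borel_measurable N"
  using assms(4)
proof (induction j arbitrary: z)
  case (Suc j)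
  have "(\<lambda>x. s x * v x j * disc_auto r (s x * u x j * z x)) \<in> borel_measurable N"
    by (intro borel_measurable_times assms Suc.prems measurable_compose[OF _ measurable_disc_auto])
  moreover have "(\<lambda>x. rootderiv r (s x * u x j * z x)) \<in> borel_measurable N"
    by (intro borel_measurable_times assms Suc.prems measurable_compose[OF _ measurable_rootderiv])
  ultimately show ?case using Suc.IH by auto
qed simp

lemma cascade_nonneg: "\<bar>r\<bar> < 1 \<Longrightarrow> 0 \<le> cascade r s u v j z"
  by (induction j arbitrary: z) (auto simp: rootderiv_nonneg)

lemma reflection_cong:
  assumes "\<And>i. i \<ge> k \<Longrightarrow> u i = u' i" "\<And>i. i \<ge> k \<Longrightarrow> v i = v' i"
  shows "reflection r u v n k s = reflection r u' v' n k s"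
  using assms by (induction n arbitrary: k) auto

text \<open>\<open>v 0\<close> only rotates the last argument, and \<open>cascade\<close> over 0
  sites is constant. This absorbs the artificial value 1 of \<open>left_v\<close> at the
  source.\<close>

lemma cascade_cong:
  assumes "\<And>i. i < j \<Longrightarrow> u i = u' i" "\<And>i. 0 < i \<Longrightarrow> i < j \<Longrightarrow> v i = v' i"
  shows "cascade r s u v j z = cascade r s u' v' j z"
  using assms
proof (induction j arbitrary: z)
  case (Suc j)
  have "cascade r s u v j z' = cascade r s u' v' j z'" for z' by (rule Suc.IH) (use Suc.prems in auto)
  moreover have "j = 0 \<or> v j = v' j" using Suc.prems(2)[of j] by auto
  ultimately show ?case using Suc.prems(1)[of j] by auto
qed simp

section \<open>Reflection and transmission on a half line that ends in a total reflector\<close>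

locale half_line =
  fixes r :: real and u v :: "nat \<Rightarrow> complex" and M :: nat
  assumes r: "\<bar>r\<bar> < 1" and u: "\<And>i. norm (u i) = 1" and v: "\<And>i. norm (v i) = 1"
begin

abbreviation "R k s \<equiv> reflection r u v (M - k) k s"

lemma norm_reflection_le:
  assumes "norm s \<le> 1" shows "norm (reflection r u v n k s) \<le> 1"
proof (induction n arbitrary: k)
  case (Suc n)
  have "norm (s * u k * reflection r u v n (Suc k) s) \<le> 1"
    using assms Suc by (simp add: norm_mult u mult_le_one)
  from norm_disc_auto_le[OF r this] show ?case
    using assms by (simp add: norm_mult v mult_le_one)
qed simp

lemma norm_reflection:
  assumes "norm s = 1" shows "norm (reflection r u v n k s) = 1"
  by (induction n arbitrary: k) (simp_all add: norm_mult u v assms norm_disc_auto[OF r])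

lemma denom_nonzero:
  assumes "norm s \<le> 1" shows "1 + of_real r * (s * u i * reflection r u v n k s) \<noteq> 0"
  using assms norm_reflection_le[OF assms]
  by (intro disc_auto_denom_nonzero r) (simp add: norm_mult u mult_le_one)

lemma disc_algebra_reflection: "reflection r u v n k \<in> disc_algebra"
proof (induction n arbitrary: k)
  case 0
  have "reflection r u v 0 k = (\<lambda>s. 1)" by (rule ext) simp
  then show ?case by simp
next
  case (Suc n)
  have "reflection r u v (Suc n) k = (\<lambda>s. s * v k * ((of_real r + s * u k * reflection r u v n (Suc k) s) /
      (1 + of_real r * (s * u k * reflection r u v n (Suc k) s))))"
    by (rule ext) (simp add: disc_auto_def)
  also have "\<dots> \<in> disc_algebra"
    by (intro disc_algebra_intros disc_algebra_divide disc_algebra_const disc_algebra_ident Suc.IH denom_nonzero)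
  finally show ?case .
qed

lemma disc_algebra_amplitude: "amplitude r u v M p k \<in> disc_algebra"
proof -
  have "amplitude r u v M p k = (\<lambda>s. \<Prod>i<k. p i * (s * of_real (sqrt (1 - r\<^sup>2)) /
     (1 + of_real r * (s * u i * reflection r u v (M - Suc i) (Suc i) s))))"
    by (rule ext) (simp add: amplitude_def hop_def)
  also have "\<dots> \<in> disc_algebra"
    by (intro disc_algebra_intros disc_algebra_divide disc_algebra_const disc_algebra_ident
        disc_algebra_reflection denom_nonzero)
  finally show ?thesis .
qed

lemma amplitude_0 [simp]: "amplitude r u v M p 0 s = 1"
  by (simp add: amplitude_def)

lemma amplitude_Suc: "amplitude r u v M p (Suc k) s = amplitude r u v M p k s * (p k * hop r u v M k s)"
  by (simp add: amplitude_def)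

lemma amplitude_at_0: "k > 0 \<Longrightarrow> amplitude r u v M p k 0 = 0"
  by (auto simp: amplitude_def hop_def)

lemma reflection_unfold:
  assumes "k < M"
  shows "R k s = s * v k * disc_auto r (s * u k * R (Suc k) s)"
proof -
  have "M - k = Suc (M - Suc k)" using assms by simp
  then show ?thesis by simp
qed

text \<open>The wave leaving the source is \<open>amplitude\<close>, the returning one is
  \<open>R k s\<close> times it. Together with \<open>backward_equation\<close> this says that the
  pair is stationary under \<open>s\<close> times the walk.\<close>

lemma forward_equation:
  assumes "norm s \<le> 1"
  shows "amplitude r u v M u (Suc k) s =
    s * u k * (of_real (sqrt (1 - r\<^sup>2)) * amplitude r u v M u k s
      - of_real r * (R (Suc k) s * amplitude r u v M u (Suc k) s))"
proof -
  define d where "d = 1 + of_real r * (s * u k * R (Suc k) s)"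
  have d: "d \<noteq> 0" unfolding d_def by (rule denom_nonzero[OF assms])
  have "amplitude r u v M u (Suc k) s * d = amplitude r u v M u k s * (u k * (s * of_real (sqrt (1 - r\<^sup>2))))"
    using d by (simp add: amplitude_Suc hop_def d_def[symmetric])
  then show ?thesis unfolding d_def by algebra
qed

text \<open>This is the identity r + t^2 w / (1 + r w) = (r + w) / (1 + r w), multiplied by the
  incoming amplitude. The recursion for \<open>R\<close> stops at the reflector, hence
  \<open>k < M\<close>.\<close>

lemma backward_equation:
  assumes "norm s \<le> 1" "k < M"
  shows "R k s * amplitude r u v M u k s =
    s * v k * (of_real r * amplitude r u v M u k s
      + of_real (sqrt (1 - r\<^sup>2)) * (R (Suc k) s * amplitude r u v M u (Suc k) s))"
proof -
  define w where "w = s * u k * R (Suc k) s"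
  define d where "d = 1 + of_real r * w"
  have d: "d \<noteq> 0" unfolding d_def w_def by (rule denom_nonzero[OF assms(1)])
  define t where "t = complex_of_real (sqrt (1 - r\<^sup>2))"
  have "sqrt (1 - r\<^sup>2) * sqrt (1 - r\<^sup>2) = 1 - r * r"
    using r by (simp add: abs_square_le_1 power2_eq_square[of r, symmetric])
  then have t: "t * t = 1 - of_real r * of_real r"
    unfolding t_def of_real_mult[symmetric] by simp
  have 1: "R k s * d = s * v k * (of_real r + w)"
    using d unfolding reflection_unfold[OF assms(2)] w_def[symmetric] by (simp add: disc_auto_def d_def)
  have "R (Suc k) s * amplitude r u v M u (Suc k) s = amplitude r u v M u k s * (w * t / d)"
    by (simp add: amplitude_Suc hop_def w_def d_def t_def)
  moreover have "R k s = s * v k * (of_real r + t * (w * t / d))"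
  proof -
    have "(of_real r + t * (w * t / d)) * d = of_real r * d + (t * t) * w" using d by (simp add: algebra_simps)
    also have "\<dots> = of_real r + w" unfolding t d_def by (simp add: algebra_simps)
    finally have "s * v k * (of_real r + t * (w * t / d)) * d = R k s * d"
      using 1 by (simp add: mult.assoc)
    then show ?thesis using d by simp
  qed
  ultimately show ?thesis unfolding t_def[symmetric] by (simp add: algebra_simps)
qed

text \<open>On the unit circle the complex conjugate of the transmission amplitude is, up to the total
  reflection coefficient, the amplitude of the reversed path, hence again a boundary value of an
  analytic function.\<close>

lemma reciprocity:
  assumes s: "norm s = 1" and k: "k \<le> M"
  shows "cnj (amplitude r u v M u k s) * R 0 s = amplitude r u v M v k s * R k s"
  using k
proof (induction k)
  case (Suc k)
  then have k: "k < M" by simp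
  define w where "w = s * u k * R (Suc k) s"
  have w1: "norm w = 1" by (simp add: w_def norm_mult s u norm_reflection)
  define d where "d = 1 + of_real r * w"
  have "d \<noteq> 0" unfolding d_def using disc_auto_denom_nonzero[OF r, of w] w1 by simp
  then have d: "d \<noteq> 0" "cnj d \<noteq> 0" by simp_all
  define t where "t = complex_of_real (sqrt (1 - r\<^sup>2))"
  have hop: "hop r u v M k s = s * t / d" by (simp add: hop_def d_def w_def t_def)
  have ww: "w * cnj w = 1" using complex_norm_square[of w] w1 by simp
  have us: "cnj (u k) * cnj s * (u k * s) = 1"
    using complex_norm_square[of "u k * s"] s u by (simp add: norm_mult mult_ac)
  have Rk: "R k s = s * v k * (w * cnj d) / d"
  proof -
    have "w * cnj d = of_real r + w" unfolding d_def using ww by (simp add: algebra_simps)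
    then show ?thesis unfolding reflection_unfold[OF k] w_def[symmetric]
      by (simp add: disc_auto_def d_def)
  qed
  have "cnj (u k * hop r u v M k s) * R k s = (cnj (u k) * cnj s * w) * (s * v k * t / d)"
    unfolding hop Rk using d by (simp add: t_def)
  also have "cnj (u k) * cnj s * w = R (Suc k) s"
    using us unfolding w_def by (simp add: mult_ac)
  finally have *: "cnj (u k * hop r u v M k s) * R k s = (v k * hop r u v M k s) * R (Suc k) s"
    unfolding hop by (simp add: mult_ac)
  have "cnj (amplitude r u v M u (Suc k) s) * R 0 s
      = cnj (u k * hop r u v M k s) * (cnj (amplitude r u v M u k s) * R 0 s)"
    unfolding amplitude_Suc by (simp only: complex_cnj_mult mult_ac)
  also have "\<dots> = amplitude r u v M v k s * (cnj (u k * hop r u v M k s) * R k s)"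
    using Suc k by (simp only: mult_ac)
  also have "\<dots> = amplitude r u v M v (Suc k) s * R (Suc k) s"
    unfolding * amplitude_Suc by (simp only: mult_ac)
  finally show ?case .
qed simp

text \<open>On the circle the modulus of each \<open>hop\<close> is \<open>rootderiv\<close> at the
  wave reflected from behind. \<open>R k s\<close> determines every reflection coefficient nearer to
  the source, so a recursion that starts at the far end produces the whole product.\<close>

lemma norm_amplitude:
  assumes s: "norm s = 1" and k: "k \<le> M"
  shows "norm (amplitude r u v M u k s) = cascade r s u v k (R k s)"
  using k
proof (induction k)
  case (Suc k)
  have "norm (u k * hop r u v M k s) = rootderiv r (s * u k * R (Suc k) s)"
    using r by (simp add: hop_def rootderiv_def norm_mult norm_divide u s abs_square_le_1)
  then show ?case using Suc reflection_unfold[of k s]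
    by (simp add: amplitude_Suc norm_mult mult.commute)
qed simp

end

section \<open>The resolvent of the walk with one free phase\<close>

fun phase_walk :: "real \<Rightarrow> (spin \<times> int \<Rightarrow> complex) \<Rightarrow> wave \<Rightarrow> wave" where
  "phase_walk r \<xi> \<psi> (Up, n) =
     \<xi> (Up, n) * (of_real (sqrt (1 - r\<^sup>2)) * \<psi> (Up, n - 1) - of_real r * \<psi> (Down, n - 1))"
| "phase_walk r \<xi> \<psi> (Down, n) =
     \<xi> (Down, n) * (of_real r * \<psi> (Up, n + 1) + of_real (sqrt (1 - r\<^sup>2)) * \<psi> (Down, n + 1))"

lemma phase_walk_cmult: "phase_walk r \<xi> (\<lambda>y. c * \<psi> y) y = c * phase_walk r \<xi> \<psi> y"
  by (cases y rule: prod.exhaust, cases "fst y") (auto simp: algebra_simps)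

definition right_u :: "(spin \<times> int \<Rightarrow> complex) \<Rightarrow> int \<Rightarrow> nat \<Rightarrow> complex" where
  "right_u \<xi> n0 k = \<xi> (Up, n0 + 1 + int k)"

definition right_v :: "(spin \<times> int \<Rightarrow> complex) \<Rightarrow> int \<Rightarrow> nat \<Rightarrow> complex" where
  "right_v \<xi> n0 k = \<xi> (Down, n0 - 1 + int k)"

text \<open>In the mirror image the spins exchange roles, which replaces \<open>r\<close> by
  \<open>- r\<close>. The offset 2 arises because \<open>(Down, n0 - 1)\<close> is the last
  component of the right half line and feeds the left one.\<close>

definition left_u :: "(spin \<times> int \<Rightarrow> complex) \<Rightarrow> int \<Rightarrow> nat \<Rightarrow> complex" where
  "left_u \<xi> n0 k = \<xi> (Down, n0 - 2 - int k)"

text \<open>The phase at the source \<open>(Up, n0)\<close> is replaced by \<open>1\<close>; it stays a free parameter.\<close>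

definition left_v :: "(spin \<times> int \<Rightarrow> complex) \<Rightarrow> int \<Rightarrow> nat \<Rightarrow> complex" where
  "left_v \<xi> n0 k = (if k = 0 then 1 else \<xi> (Up, n0 - int k))"

section \<open>The Poisson kernel\<close>

definition poisson :: "complex \<Rightarrow> real" where
  "poisson w = (1 - (norm w)\<^sup>2) / (norm (1 - w))\<^sup>2"

lemma measurable_poisson [measurable]: "poisson \<in> borel_measurable borel"
  unfolding poisson_def[abs_def] by measurable

lemma poisson_nonneg: "norm w \<le> 1 \<Longrightarrow> 0 \<le> poisson w"
  by (auto simp: poisson_def abs_square_le_1)

text \<open>In powers of \<open>w\<close>, the kernel is the sum of w^n over n >= 0 plus the
  conjugate of the sum over n >= 1. The second sum is the antianalytic correction of the
  resolvent.\<close>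

lemma poisson_eq:
  assumes "norm w < 1"
  shows "1 / (1 - w) = of_real (poisson w) - cnj (w / (1 - w))"
proof -
  have n: "1 - w \<noteq> 0" "1 - cnj w \<noteq> 0" using assms by auto
  have "of_real (poisson w) = (1 - w * cnj w) / ((1 - w) * (1 - cnj w))"
    using complex_norm_square[of w] complex_norm_square[of "1 - w"] by (simp add: poisson_def)
  then show ?thesis using n by (simp add: divide_simps) (simp add: algebra_simps)
qed

lemma nn_integral_poisson:
  assumes \<rho>: "0 \<le> \<rho>" "\<rho> < 1" and c: "norm c = 1"
  shows "(\<integral>\<^sup>+l. ennreal (poisson (of_real \<rho> * l * c)) \<partial>haar) = 1"
proof -
  have lt: "norm (of_real \<rho> * l) < 1" if "norm l \<le> 1" for l :: complex
  proof -
    have "\<rho> * norm l \<le> \<rho> * 1" using \<rho> that by (intro mult_left_mono) auto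
    then show ?thesis using \<rho> by (simp add: norm_mult)
  qed
  have nz: "1 - of_real \<rho> * l \<noteq> 0" if "norm l \<le> 1" for l :: complex
    using lt[OF that] by auto
  let ?F = "\<lambda>l. 1 / (1 - of_real \<rho> * l)" and ?G = "\<lambda>l. of_real \<rho> * l / (1 - of_real \<rho> * l)"
  have F: "?F \<in> disc_algebra" and G: "?G \<in> disc_algebra"
    by (intro disc_algebra_intros disc_algebra_divide disc_algebra_const disc_algebra_ident nz; assumption)+
  have pe: "complex_of_real (poisson (of_real \<rho> * l)) = ?F l + cnj (?G l)" if "norm l = 1" for l
    using poisson_eq[OF lt, of l] that by simp
  have iP: "integrable haar (\<lambda>l. complex_of_real (poisson (of_real \<rho> * l)))"
  proof (subst integrable_cong_AE)
    show "AE l in haar. complex_of_real (poisson (of_real \<rho> * l)) = ?F l + cnj (?G l)"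
      using AE_haar_norm pe by (auto elim!: eventually_mono)
    show "integrable haar (\<lambda>l. ?F l + cnj (?G l))"
      using disc_algebra_integrable[OF F] disc_algebra_integrable[OF G]
      by (intro Bochner_Integration.integrable_add) (auto simp del: complex_cnj_divide complex_cnj_mult)
  qed auto
  have "complex_of_real (LINT l|haar. poisson (of_real \<rho> * l)) = (LINT l|haar. complex_of_real (poisson (of_real \<rho> * l)))"
    by (rule integral_complex_of_real[symmetric])
  also have "\<dots> = (LINT l|haar. ?F l + cnj (?G l))"
  proof (rule integral_cong_AE)
    show "AE l in haar. complex_of_real (poisson (of_real \<rho> * l)) = ?F l + cnj (?G l)"
      using AE_haar_norm pe by (auto elim!: eventually_mono)
  qed auto
  also have "\<dots> = (LINT l|haar. ?F l) + cnj (LINT l|haar. ?G l)"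
    using disc_algebra_integrable[OF F] disc_algebra_integrable[OF G]
    by (subst Bochner_Integration.integral_add) (auto simp del: complex_cnj_divide complex_cnj_mult)
  also have "\<dots> = 1"
    by (simp add: disc_algebra_mean_value[OF F] disc_algebra_mean_value[OF G])
  finally have I: "(LINT l|haar. poisson (of_real \<rho> * l)) = 1" by simp
  have "(\<integral>\<^sup>+l. ennreal (poisson (of_real \<rho> * l * c)) \<partial>haar) = (\<integral>\<^sup>+l. ennreal (poisson (of_real \<rho> * (c * l))) \<partial>haar)"
    by (simp add: mult_ac)
  also have "\<dots> = (\<integral>\<^sup>+l. ennreal (poisson (of_real \<rho> * l)) \<partial>haar)"
    by (rule nn_integral_haar_rotate[OF _ c]) measurable
  also have "\<dots> = ennreal (LINT l|haar. poisson (of_real \<rho> * l))"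
  proof (rule nn_integral_eq_integral)
    show "integrable haar (\<lambda>l. poisson (of_real \<rho> * l))"
      using iP by (simp add: complex_of_real_integrable_eq)
    show "AE l in haar. 0 \<le> poisson (of_real \<rho> * l)"
      using AE_haar_norm
    proof eventually_elim
      fix l :: complex assume "norm l = 1"
      then show "0 \<le> poisson (of_real \<rho> * l)" using lt[of l] by (intro poisson_nonneg) simp
    qed
  qed
  finally show ?thesis using I by simp
qed

section \<open>The stationary wave of the walk cut open at its source\<close>

locale walk_source =
  fixes r :: real and \<xi> :: "spin \<times> int \<Rightarrow> complex" and n0 :: int and M :: nat
  assumes r: "0 < r" "r < 1" and \<xi>: "\<And>y. norm (\<xi> y) = 1" and M: "0 < M"
begin

sublocale right: half_line r "right_u \<xi> n0" "right_v \<xi> n0" M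
  using r \<xi> by unfold_locales (auto simp: right_u_def right_v_def)

sublocale left: half_line "- r" "left_u \<xi> n0" "left_v \<xi> n0" M
  using r \<xi> by unfold_locales (auto simp: left_u_def left_v_def)

abbreviation "Rr \<equiv> right.R"
abbreviation "Rl \<equiv> left.R"
abbreviation "Ar \<equiv> amplitude r (right_u \<xi> n0) (right_v \<xi> n0) M (right_u \<xi> n0)"
abbreviation "Al \<equiv> amplitude (- r) (left_u \<xi> n0) (left_v \<xi> n0) M (left_u \<xi> n0)"
abbreviation "Br \<equiv> amplitude r (right_u \<xi> n0) (right_v \<xi> n0) M (right_v \<xi> n0)"
abbreviation "Bl \<equiv> amplitude (- r) (left_u \<xi> n0) (left_v \<xi> n0) M (left_v \<xi> n0)"

text \<open>The wave emitted by a unit source at \<open>(Up, n0)\<close> when nothing that returns to the source is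
  emitted again; \<open>loop\<close> is the amplitude of the returning wave.\<close>

fun wave_field :: "complex \<Rightarrow> wave" where
  "wave_field s (Up, m) =
     (if m \<ge> n0 then Ar (nat (m - n0)) s else Rr 0 s * (Rl (nat (n0 - m)) s * Al (nat (n0 - m)) s))"
| "wave_field s (Down, m) =
     (if m \<ge> n0 - 1 then Rr (nat (m - n0 + 1)) s * Ar (nat (m - n0 + 1)) s
      else Rr 0 s * Al (nat (n0 - 1 - m)) s)"

definition loop :: "complex \<Rightarrow> complex" where
  "loop s = Rr 0 s * Rl 0 s"

lemma position_cases:
  obtains (ru) k where "y = (Up, n0 + int k)" | (rd) k where "y = (Down, n0 - 1 + int k)"
  | (lu) k where "y = (Up, n0 - int (Suc k))" | (ld) k where "y = (Down, n0 - 2 - int k)"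
proof -
  obtain \<sigma> m where y: "y = (\<sigma>, m)" by (cases y)
  show ?thesis
  proof (cases \<sigma>)
    case Up
    show ?thesis
    proof (cases "m \<ge> n0")
      case True
      then have "m = n0 + int (nat (m - n0))" by simp
      then show ?thesis using ru y Up by blast
    next
      case False
      then have "m = n0 - int (Suc (nat (n0 - m - 1)))" by simp
      then show ?thesis using lu y Up by blast
    qed
  next
    case Down
    show ?thesis
    proof (cases "m \<ge> n0 - 1")
      case True
      then have "m = n0 - 1 + int (nat (m - n0 + 1))" by simp
      then show ?thesis using rd y Down by blast
    next
      case False
      then have "m = n0 - 2 - int (nat (n0 - 2 - m))" by simp
      then show ?thesis using ld y Down by blast
    qed
  qed
qed

lemma wave_field_simps:
  "wave_field s (Up, n0 + int k) = Ar k s"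
  "wave_field s (Down, n0 - 1 + int k) = Rr k s * Ar k s"
  "wave_field s (Up, n0 - int (Suc k)) = Rr 0 s * (Rl (Suc k) s * Al (Suc k) s)"
  "wave_field s (Down, n0 - 2 - int k) = Rr 0 s * Al (Suc k) s"
proof -
  have "nat (n0 - 1 - (n0 - 2 - int k)) = Suc k" by simp
  then show "wave_field s (Down, n0 - 2 - int k) = Rr 0 s * Al (Suc k) s" by simp
  have "nat (n0 - (n0 - int (Suc k))) = Suc k" by simp
  then show "wave_field s (Up, n0 - int (Suc k)) = Rr 0 s * (Rl (Suc k) s * Al (Suc k) s)" by simp
qed auto

text \<open>Away from the source these are the forward and backward equations of the two half lines.
  At the source the field has value 1 but receives \<open>\<zeta> * loop s\<close>; this single
  defect is repaired by \<open>emitted\<close>.\<close>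

lemma wave_field_equation:
  assumes s: "norm s \<le> 1" and m: "nat \<bar>snd y - n0\<bar> + 1 < M"
  shows "s * phase_walk r (\<xi>((Up, n0) := \<zeta>)) (wave_field s) y =
    (if y = (Up, n0) then \<zeta> * loop s else wave_field s y)"
proof (cases y rule: position_cases)
  case (ru k)
  show ?thesis
  proof (cases k)
    case 0
    have d: "wave_field s (Down, n0 - 1) = Rr 0 s"
      using wave_field_simps(2)[of s 0] by simp
    have u: "wave_field s (Up, n0 - 1) = Rr 0 s * (Rl 1 s * Al 1 s)"
      using wave_field_simps(3)[of s 0] by simp
    \<comment> \<open>The backward equation of the left half line at site 0; \<open>left_v\<close>
      is 1 there, so the source phase \<open>\<zeta>\<close> stays a separate factor.\<close>
    have "Rl 0 s = s * (- of_real r + of_real (sqrt (1 - r\<^sup>2)) * (Rl 1 s * Al 1 s))"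
      using left.backward_equation[OF s M] by (simp add: left_v_def)
    then show ?thesis unfolding ru 0 loop_def by (simp add: u d del: wave_field.simps) (simp add: algebra_simps)
  next
    case (Suc j)
    have e: "n0 + int (Suc j) - 1 = n0 + int j" "n0 + int j = n0 - 1 + int (Suc j)"
      "n0 + int (Suc j) = n0 + 1 + int j" by simp_all
    have u: "wave_field s (Up, n0 + int (Suc j) - 1) = Ar j s"
      unfolding e(1) by (rule wave_field_simps)
    have d: "wave_field s (Down, n0 + int (Suc j) - 1) = Rr (Suc j) s * Ar (Suc j) s"
      unfolding e(1) unfolding e(2) by (rule wave_field_simps)
    have x: "(\<xi>((Up, n0) := \<zeta>)) (Up, n0 + int (Suc j)) = right_u \<xi> n0 j"
      by (simp add: right_u_def add.assoc)
    have "(Up, n0 + int (Suc j)) \<noteq> (Up, n0)" by simp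
    then show ?thesis
      unfolding ru Suc phase_walk.simps u d x wave_field_simps
      using right.forward_equation[OF s, of j] by (simp only: mult.assoc if_False)
  qed
next
  case (rd k)
  then have k: "k < M" using m by auto
  have e: "n0 - 1 + int k + 1 = n0 + int k" "n0 + int k = n0 - 1 + int (Suc k)" by simp_all
  have u: "wave_field s (Up, n0 - 1 + int k + 1) = Ar k s"
    unfolding e(1) by (rule wave_field_simps)
  have d: "wave_field s (Down, n0 - 1 + int k + 1) = Rr (Suc k) s * Ar (Suc k) s"
    unfolding e(1) unfolding e(2) by (rule wave_field_simps)
  have x: "(\<xi>((Up, n0) := \<zeta>)) (Down, n0 - 1 + int k) = right_v \<xi> n0 k"
    by (simp add: right_v_def)
  have "(Down, n0 - 1 + int k) \<noteq> (Up, n0)" by simp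
  then show ?thesis
    unfolding rd phase_walk.simps u d x wave_field_simps
    using right.backward_equation[OF s k] by (simp only: mult.assoc if_False)
next
  case (lu k)
  then have k: "Suc k < M" using m by auto
  have e: "n0 - int (Suc k) - 1 = n0 - int (Suc (Suc k))" "n0 - int (Suc (Suc k)) = n0 - 2 - int k" by simp_all
  have u: "wave_field s (Up, n0 - int (Suc k) - 1) = Rr 0 s * (Rl (Suc (Suc k)) s * Al (Suc (Suc k)) s)"
    unfolding e(1) by (rule wave_field_simps)
  have d: "wave_field s (Down, n0 - int (Suc k) - 1) = Rr 0 s * Al (Suc k) s"
    unfolding e(1) unfolding e(2) by (rule wave_field_simps)
  have "Rr 0 s * (Rl (Suc k) s * Al (Suc k) s) = s * \<xi> (Up, n0 - int (Suc k)) *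
     (of_real (sqrt (1 - r\<^sup>2)) * (Rr 0 s * (Rl (Suc (Suc k)) s * Al (Suc (Suc k)) s)) - of_real r * (Rr 0 s * Al (Suc k) s))"
    unfolding left.backward_equation[OF s k] by (simp add: left_v_def algebra_simps)
  moreover have x: "(\<xi>((Up, n0) := \<zeta>)) (Up, n0 - int (Suc k)) = \<xi> (Up, n0 - int (Suc k))"
    by simp
  moreover have "(Up, n0 - int (Suc k)) \<noteq> (Up, n0)" by simp
  ultimately show ?thesis
    unfolding lu phase_walk.simps u d x wave_field_simps by (simp only: mult.assoc if_False)
next
  case (ld k)
  have e: "n0 - 2 - int k + 1 = n0 - int (Suc k)" by simp
  have u: "wave_field s (Up, n0 - 2 - int k + 1) = Rr 0 s * (Rl (Suc k) s * Al (Suc k) s)"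
    unfolding e by (rule wave_field_simps)
  \<comment> \<open>For \<open>k = 0\<close> the component entering the left half line is
    \<open>(Down, n0 - 1)\<close>, of value \<open>Rr 0 s\<close>. This is why the whole left branch
    carries that factor.\<close>
  have d: "wave_field s (Down, n0 - 2 - int k + 1) = Rr 0 s * Al k s"
  proof (cases k)
    case 0
    then show ?thesis using wave_field_simps(2)[of s 0] by simp
  next
    case (Suc j)
    have "n0 - 2 - int k + 1 = n0 - 2 - int j" by (simp add: Suc)
    then show ?thesis using wave_field_simps(4)[of s j] Suc by simp
  qed
  have "Rr 0 s * Al (Suc k) s = s * \<xi> (Down, n0 - 2 - int k) *
     (of_real r * (Rr 0 s * (Rl (Suc k) s * Al (Suc k) s)) + of_real (sqrt (1 - r\<^sup>2)) * (Rr 0 s * Al k s))"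
    by (subst left.forward_equation[OF s]) (simp add: left_u_def algebra_simps)
  moreover have x: "(\<xi>((Up, n0) := \<zeta>)) (Down, n0 - 2 - int k) = \<xi> (Down, n0 - 2 - int k)"
    by simp
  moreover have "(Down, n0 - 2 - int k) \<noteq> (Up, n0)" by simp
  ultimately show ?thesis
    unfolding ld phase_walk.simps u d x wave_field_simps by (simp only: mult.assoc if_False)
qed

lemma wave_field_source: "wave_field s (Up, n0) = 1"
  using wave_field_simps(1)[of s 0] by simp

lemma disc_algebra_loop: "loop \<in> disc_algebra"
  unfolding loop_def[abs_def]
  by (intro disc_algebra_intros right.disc_algebra_reflection left.disc_algebra_reflection)

lemma disc_algebra_wave_field: "(\<lambda>s. wave_field s y) \<in> disc_algebra"
  by (cases y rule: position_cases)
    (simp_all only: wave_field_simps, (intro disc_algebra_intros right.disc_algebra_reflection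
      left.disc_algebra_reflection right.disc_algebra_amplitude left.disc_algebra_amplitude)+)

lemma norm_loop_le: "norm s \<le> 1 \<Longrightarrow> norm (loop s) \<le> 1"
  unfolding loop_def norm_mult
  by (intro mult_le_one right.norm_reflection_le left.norm_reflection_le) auto

lemma norm_loop: "norm s = 1 \<Longrightarrow> norm (loop s) = 1"
  unfolding loop_def norm_mult by (simp add: right.norm_reflection left.norm_reflection)

text \<open>\<open>loop\<close> supplies the reflection coefficient that \<open>reciprocity\<close>
  needs to turn the conjugate amplitude into that of the reversed path; the other conjugate
  reflections are unimodular and cancel. The value at 0 vanishes through a surviving factor
  \<open>Rl 0\<close> to the right of the source and through \<open>Bl (Suc k)\<close> to the
  left.\<close>

lemma conj_field_analytic:
  assumes m: "nat \<bar>snd y - n0\<bar> + 1 < M"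
  shows "\<exists>G\<in>disc_algebra. G 0 = 0 \<and> (\<forall>s. norm s = 1 \<longrightarrow> cnj (wave_field s y) * loop s = G s)"
proof -
  note D = disc_algebra_intros right.disc_algebra_reflection left.disc_algebra_reflection
    right.disc_algebra_amplitude left.disc_algebra_amplitude
  have cc: "cnj z * z = 1" if "norm z = 1" for z using complex_norm_square[of z] that by (simp add: mult.commute)
  have R0: "reflection (- r) (left_u \<xi> n0) (left_v \<xi> n0) M 0 0 = 0" using M by (cases M) auto
  show ?thesis
  proof (cases y rule: position_cases)
    case (ru k)
    then have k: "k \<le> M" using m by auto
    show ?thesis
    proof (intro bexI conjI allI impI)
      show "(\<lambda>s. Br k s * Rr k s * Rl 0 s) \<in> disc_algebra" by (intro D)
      fix s :: complex assume s: "norm s = 1"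
      show "cnj (wave_field s y) * loop s = Br k s * Rr k s * Rl 0 s"
        unfolding ru wave_field_simps loop_def right.reciprocity[OF s k, symmetric] by (simp only: mult_ac)
    qed (simp add: R0)
  next
    case (rd k)
    then have k: "k \<le> M" using m by auto
    show ?thesis
    proof (intro bexI conjI allI impI)
      show "(\<lambda>s. Br k s * Rl 0 s) \<in> disc_algebra" by (intro D)
      fix s :: complex assume s: "norm s = 1"
      have "cnj (wave_field s y) * loop s = (cnj (Rr k s) * (cnj (Ar k s) * Rr 0 s)) * Rl 0 s"
        unfolding rd wave_field_simps loop_def complex_cnj_mult by (simp only: mult_ac)
      also have "\<dots> = (cnj (Rr k s) * Rr k s) * (Br k s * Rl 0 s)"
        unfolding right.reciprocity[OF s k] by (simp only: mult_ac)
      finally show "cnj (wave_field s y) * loop s = Br k s * Rl 0 s"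
        using cc[OF right.norm_reflection[OF s]] by simp
    qed (simp add: R0)
  next
    case (lu k)
    then have k: "Suc k \<le> M" using m by auto
    show ?thesis
    proof (intro bexI conjI allI impI)
      show "Bl (Suc k) \<in> disc_algebra" by (intro D)
      fix s :: complex assume s: "norm s = 1"
      have "cnj (wave_field s y) * loop s
          = (cnj (Rr 0 s) * Rr 0 s) * (cnj (Rl (Suc k) s) * (cnj (Al (Suc k) s) * Rl 0 s))"
        unfolding lu wave_field_simps loop_def complex_cnj_mult by (simp only: mult_ac)
      also have "\<dots> = (cnj (Rr 0 s) * Rr 0 s) * ((cnj (Rl (Suc k) s) * Rl (Suc k) s) * Bl (Suc k) s)"
        unfolding left.reciprocity[OF s k] by (simp only: mult_ac)
      finally show "cnj (wave_field s y) * loop s = Bl (Suc k) s"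
        using cc[OF right.norm_reflection[OF s]] cc[OF left.norm_reflection[OF s]] by simp
    qed (simp add: left.amplitude_at_0)
  next
    case (ld k)
    then have k: "Suc k \<le> M" using m by auto
    show ?thesis
    proof (intro bexI conjI allI impI)
      show "(\<lambda>s. Bl (Suc k) s * Rl (Suc k) s) \<in> disc_algebra" by (intro D)
      fix s :: complex assume s: "norm s = 1"
      have "cnj (wave_field s y) * loop s = (cnj (Rr 0 s) * Rr 0 s) * (cnj (Al (Suc k) s) * Rl 0 s)"
        unfolding ld wave_field_simps loop_def complex_cnj_mult by (simp only: mult_ac)
      then show "cnj (wave_field s y) * loop s = Bl (Suc k) s * Rl (Suc k) s"
        unfolding left.reciprocity[OF s k] using cc[OF right.norm_reflection[OF s]] by simp
    qed (simp add: left.amplitude_at_0)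
  qed
qed

end

section \<open>Powers of the walk as Taylor coefficients of the resolvent\<close>

lemma phase_walk_cong:
  assumes "\<And>z. \<bar>snd z - snd y\<bar> \<le> 1 \<Longrightarrow> \<phi> z = \<psi> z"
  shows "phase_walk r \<xi> \<phi> y = phase_walk r \<xi> \<psi> y"
  using assms by (cases y rule: prod.exhaust, cases "fst y") auto

lemma phase_walk_integral:
  assumes "\<And>y. integrable haar (\<lambda>s. \<phi> s y)"
  shows "(LINT s|haar. phase_walk r \<xi> (\<phi> s) y) = phase_walk r \<xi> (\<lambda>y. LINT s|haar. \<phi> s y) y"
  using assms by (cases y rule: prod.exhaust, cases "fst y") auto

lemma continuous_phase_walk_power:
  "continuous_on UNIV (\<lambda>\<zeta>. (phase_walk r (\<xi>(x := \<zeta>)) ^^ n) \<psi> y)"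
proof (induction n arbitrary: y)
  case (Suc n)
  have c: "continuous_on UNIV (\<lambda>\<zeta>. (\<xi>(x := \<zeta>)) z)" for z
    by (cases "z = x") auto
  obtain \<sigma> m where y: "y = (\<sigma>, m)" by (cases y)
  show ?case unfolding y
    by (cases \<sigma>) (auto simp del: fun_upd_apply intro!: continuous_intros c Suc)
qed simp

context walk_source
begin

text \<open>The geometric series over the number of returns to the source, each of which contributes
  \<open>\<zeta> * loop s\<close>.\<close>

definition emitted :: "complex \<Rightarrow> complex \<Rightarrow> wave" where
  "emitted \<zeta> s y = wave_field s y / (1 - \<zeta> * loop s)"

lemma one_minus_loop_nonzero:
  assumes "norm \<zeta> < 1" "norm s \<le> 1" shows "1 - \<zeta> * loop s \<noteq> 0"
proof
  assume "1 - \<zeta> * loop s = 0"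
  then have "norm (\<zeta> * loop s) = 1" by simp
  moreover have "norm \<zeta> * norm (loop s) \<le> norm \<zeta> * 1"
    using norm_loop_le[OF assms(2)] by (intro mult_left_mono) auto
  ultimately show False using assms(1) by (simp add: norm_mult)
qed

lemma disc_algebra_emitted:
  assumes "norm \<zeta> < 1" shows "(\<lambda>s. emitted \<zeta> s y) \<in> disc_algebra"
  unfolding emitted_def
  by (intro disc_algebra_divide disc_algebra_intros disc_algebra_wave_field disc_algebra_loop
      disc_algebra_const one_minus_loop_nonzero assms)

lemma emitted_equation:
  assumes \<zeta>: "norm \<zeta> < 1" and s: "norm s \<le> 1" and m: "nat \<bar>snd y - n0\<bar> + 1 < M"
  shows "emitted \<zeta> s y = ket Up n0 y + s * phase_walk r (\<xi>((Up, n0) := \<zeta>)) (emitted \<zeta> s) y"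
proof -
  define d where "d = 1 - \<zeta> * loop s"
  have d: "d \<noteq> 0" unfolding d_def by (rule one_minus_loop_nonzero[OF \<zeta> s])
  have "emitted \<zeta> s = (\<lambda>y. (1 / d) * wave_field s y)" by (auto simp: emitted_def d_def)
  then have "s * phase_walk r (\<xi>((Up, n0) := \<zeta>)) (emitted \<zeta> s) y
      = s * phase_walk r (\<xi>((Up, n0) := \<zeta>)) (wave_field s) y / d"
    by (simp only: phase_walk_cmult) simp
  also have "\<dots> = (if y = (Up, n0) then \<zeta> * loop s else wave_field s y) / d"
    by (simp only: wave_field_equation[OF s m])
  finally have e: "s * phase_walk r (\<xi>((Up, n0) := \<zeta>)) (emitted \<zeta> s) y
      = (if y = (Up, n0) then \<zeta> * loop s else wave_field s y) / d" .
  have "1 / d = 1 + \<zeta> * loop s / d" using d by (simp add: field_simps) (simp add: d_def)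
  then show ?thesis unfolding e
    using wave_field_source[of s] by (auto simp: emitted_def d_def[symmetric] ket_def)
qed

lemma integrable_cnj_power_mult:
  assumes "F \<in> disc_algebra" shows "integrable haar (\<lambda>s. cnj s ^ n * F s)"
proof -
  note [measurable] = disc_algebra_measurable[OF assms]
  obtain B where "\<forall>z. norm z \<le> 1 \<longrightarrow> norm (F z) \<le> B" using disc_algebra_bounded[OF assms] by blast
  then show ?thesis
    by (intro integrable_haar_bounded[of _ B]) (auto simp: norm_mult norm_power)
qed

lemma integral_haar_cnj_power: "n > 0 \<Longrightarrow> (LINT s|haar. cnj s ^ n) = 0"
proof -
  assume n: "n > 0"
  have "(LINT s|haar. cnj s ^ n) = cnj (LINT s|haar. s ^ n)"
    unfolding complex_cnj_power[symmetric] by (rule Bochner_Integration.integral_cnj)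
  then show ?thesis using n disc_algebra_mean_value[OF disc_algebra_power[OF disc_algebra_ident], of n]
    by simp
qed

text \<open>\<open>emitted\<close> solves the resolvent equation only before the reflectors. Hence
  induction on the coefficients: on the circle \<open>cnj s\<close> inverts \<open>s\<close>, so the
  walk takes one coefficient to the next. Each application looks one site further, which accounts
  for \<open>+ n < M\<close>.\<close>

lemma walk_power_eq_integral:
  assumes \<zeta>: "norm \<zeta> < 1" and m: "nat \<bar>snd y - n0\<bar> + 1 + n < M"
  shows "(phase_walk r (\<xi>((Up, n0) := \<zeta>)) ^^ n) (ket Up n0) y = (LINT s|haar. cnj s ^ n * emitted \<zeta> s y)"
  using m
proof (induction n arbitrary: y)
  case 0
  have "(LINT s|haar. emitted \<zeta> s y) = emitted \<zeta> 0 y"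
    by (rule disc_algebra_mean_value[OF disc_algebra_emitted[OF \<zeta>]])
  then show ?case using emitted_equation[OF \<zeta>, of 0 y] 0 by simp
next
  case (Suc n)
  let ?W = "phase_walk r (\<xi>((Up, n0) := \<zeta>))"
  note i = integrable_cnj_power_mult[OF disc_algebra_emitted[OF \<zeta>]]
  have "(?W ^^ Suc n) (ket Up n0) y = ?W (\<lambda>y. LINT s|haar. cnj s ^ n * emitted \<zeta> s y) y"
    unfolding funpow.simps o_apply
  proof (rule phase_walk_cong)
    fix z :: "spin \<times> int" assume "\<bar>snd z - snd y\<bar> \<le> 1"
    then have "nat \<bar>snd z - n0\<bar> + 1 + n < M" using Suc.prems by linarith
    then show "(?W ^^ n) (ket Up n0) z = (LINT s|haar. cnj s ^ n * emitted \<zeta> s z)" by (rule Suc.IH)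
  qed
  also have "\<dots> = (LINT s|haar. ?W (\<lambda>y. cnj s ^ n * emitted \<zeta> s y) y)"
    by (rule phase_walk_integral[symmetric]) (rule i)
  also have "\<dots> = (LINT s|haar. cnj s ^ Suc n * emitted \<zeta> s y - ket Up n0 y * cnj s ^ Suc n)"
  proof (rule integral_cong_AE)
    show "AE s in haar. ?W (\<lambda>y. cnj s ^ n * emitted \<zeta> s y) y
        = cnj s ^ Suc n * emitted \<zeta> s y - ket Up n0 y * cnj s ^ Suc n"
      using AE_haar_norm
    proof eventually_elim
      fix s :: complex assume s: "norm s = 1"
      have m': "nat \<bar>snd y - n0\<bar> + 1 < M" using Suc.prems by simp
      have ss: "cnj s * s = 1" using complex_norm_square[of s] s by (simp add: mult.commute)
      have "cnj s ^ Suc n * emitted \<zeta> s y = ket Up n0 y * cnj s ^ Suc n + (cnj s * s) * (cnj s ^ n * ?W (emitted \<zeta> s) y)"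
        unfolding emitted_equation[OF \<zeta> order.refl[THEN ord_eq_le_trans[OF s]] m'] by (simp add: algebra_simps)
      then show "?W (\<lambda>y. cnj s ^ n * emitted \<zeta> s y) y
        = cnj s ^ Suc n * emitted \<zeta> s y - ket Up n0 y * cnj s ^ Suc n"
        by (simp add: phase_walk_cmult ss)
    qed
    have [measurable]: "(\<lambda>s. emitted \<zeta> s y) \<in> borel_measurable borel" for y
      by (rule disc_algebra_measurable[OF disc_algebra_emitted[OF \<zeta>]])
    show "(\<lambda>s. cnj s ^ Suc n * emitted \<zeta> s y - ket Up n0 y * cnj s ^ Suc n) \<in> borel_measurable haar"
      by measurable
    obtain \<sigma> k where y: "y = (\<sigma>, k)" by (cases y)
    show "(\<lambda>s. ?W (\<lambda>y. cnj s ^ n * emitted \<zeta> s y) y) \<in> borel_measurable haar"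
      unfolding y by (cases \<sigma>) (simp_all del: fun_upd_apply)
  qed
  also have "\<dots> = (LINT s|haar. cnj s ^ Suc n * emitted \<zeta> s y) - ket Up n0 y * (LINT s|haar. cnj s ^ Suc n)"
    using integrable_cnj_power_mult[OF disc_algebra_const[of 1], of "Suc n"] i
    by (subst Bochner_Integration.integral_diff) (auto simp del: power_Suc)
  finally show ?case unfolding integral_haar_cnj_power[OF zero_less_Suc] by (simp only: mult_zero_right diff_zero)
qed

text \<open>Adding the boundary values of an antianalytic function without constant term changes the
  resolvent into its Poisson counterpart, which is positive and has mean one in the phase.\<close>

lemma norm_walk_power_le:
  assumes \<zeta>: "norm \<zeta> < 1" and m: "nat \<bar>snd y - n0\<bar> + 1 + n < M"
  shows "ennreal (norm ((phase_walk r (\<xi>((Up, n0) := \<zeta>)) ^^ n) (ket Up n0) y))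
    \<le> (\<integral>\<^sup>+s. ennreal (norm (wave_field s y) * poisson (\<zeta> * loop s)) \<partial>haar)"
proof -
  have "nat \<bar>snd y - n0\<bar> + 1 < M" using m by simp
  from conj_field_analytic[OF this] obtain G where G: "G \<in> disc_algebra" "G 0 = 0"
    "\<And>s. norm s = 1 \<Longrightarrow> cnj (wave_field s y) * loop s = G s" by blast
  \<comment> \<open>Chosen so that on the circle \<open>cnj (H s)\<close> is
    \<open>cnj s ^ n * wave_field s y\<close> times the conjugate of w / (1 - w), w =
    \<open>\<zeta> * loop s\<close>: exactly what \<open>poisson_eq\<close> subtracts from the
    kernel.\<close>
  define H where "H s = s ^ n * (G s * (\<zeta> / (1 - \<zeta> * loop s)))" for s
  have H: "H \<in> disc_algebra" unfolding H_def[abs_def]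
    by (intro disc_algebra_divide disc_algebra_intros G disc_algebra_loop disc_algebra_const
        disc_algebra_ident one_minus_loop_nonzero \<zeta>)
  have H0: "(LINT s|haar. cnj (H s)) = 0"
  proof -
    have "(LINT s|haar. cnj (H s)) = cnj (LINT s|haar. H s)" by (rule Bochner_Integration.integral_cnj)
    also have "(LINT s|haar. H s) = H 0" by (rule disc_algebra_mean_value[OF H])
    finally show ?thesis by (simp add: H_def G(2))
  qed
  have iH: "integrable haar (\<lambda>s. cnj (H s))" using disc_algebra_integrable[OF H] by simp
  note iE = integrable_cnj_power_mult[OF disc_algebra_emitted[OF \<zeta>], of n y]
  define Q where "Q s = cnj s ^ n * emitted \<zeta> s y + cnj (H s)" for s
  have iQ: "integrable haar Q" unfolding Q_def[abs_def] using iE iH by (rule Bochner_Integration.integrable_add)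
  have Q: "norm (Q s) = norm (wave_field s y) * poisson (\<zeta> * loop s)" if s: "norm s = 1" for s
  proof -
    define w where "w = \<zeta> * loop s"
    have w: "norm w < 1" using \<zeta> norm_loop[OF s] by (simp add: w_def norm_mult)
    have cH: "cnj (H s) = cnj s ^ n * (wave_field s y * cnj (w / (1 - w)))"
      unfolding H_def G(3)[OF s, symmetric] w_def by simp
    have em: "emitted \<zeta> s y = wave_field s y * (1 / (1 - w))" by (simp add: emitted_def w_def)
    have "a * (b * (p - c)) + a * (b * c) = a * (b * p)" for a b c p :: complex
      by (simp add: algebra_simps)
    then have "Q s = cnj s ^ n * (wave_field s y * of_real (poisson w))"
      unfolding Q_def cH em poisson_eq[OF w] .
    moreover have "0 \<le> poisson w" using w by (intro poisson_nonneg) simp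
    ultimately show ?thesis by (simp add: norm_mult norm_power s w_def)
  qed
  have "(phase_walk r (\<xi>((Up, n0) := \<zeta>)) ^^ n) (ket Up n0) y = (LINT s|haar. Q s)"
    unfolding walk_power_eq_integral[OF \<zeta> m] Q_def using iE iH H0 by simp
  also have "ennreal (norm \<dots>) \<le> (\<integral>\<^sup>+s. ennreal (norm (Q s)) \<partial>haar)"
    by (rule integral_norm_bound_ennreal[OF iQ])
  also have "\<dots> = (\<integral>\<^sup>+s. ennreal (norm (wave_field s y) * poisson (\<zeta> * loop s)) \<partial>haar)"
    by (rule nn_integral_haar_cong) (simp add: Q)
  finally show ?thesis .
qed

text \<open>The bound of \<open>norm_walk_power_le\<close> does not contain \<open>n\<close>, so the
  supremum costs nothing. After Fubini the kernel integrates to one, \<open>loop s\<close> being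
  unimodular on the circle.\<close>

lemma mean_sup_walk_power_damped:
  assumes m: "nat \<bar>snd y - n0\<bar> + 1 + N < M" and \<rho>: "0 \<le> \<rho>" "\<rho> < 1"
  shows "(\<integral>\<^sup>+l. (SUP n\<in>{..N}. ennreal (norm ((phase_walk r (\<xi>((Up, n0) := of_real \<rho> * l)) ^^ n) (ket Up n0) y))) \<partial>haar)
    \<le> (\<integral>\<^sup>+s. ennreal (norm (wave_field s y)) \<partial>haar)"
proof -
  interpret hh: pair_sigma_finite haar haar ..
  note [measurable] = disc_algebra_measurable[OF disc_algebra_wave_field] disc_algebra_measurable[OF disc_algebra_loop]
  have "(\<integral>\<^sup>+l. (SUP n\<in>{..N}. ennreal (norm ((phase_walk r (\<xi>((Up, n0) := of_real \<rho> * l)) ^^ n) (ket Up n0) y))) \<partial>haar)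
    \<le> (\<integral>\<^sup>+l. (\<integral>\<^sup>+s. ennreal (norm (wave_field s y) * poisson (of_real \<rho> * l * loop s)) \<partial>haar) \<partial>haar)"
  proof (rule nn_integral_mono_AE, use AE_haar_norm in eventually_elim)
    fix l :: complex assume "norm l = 1"
    then show "(SUP n\<in>{..N}. ennreal (norm ((phase_walk r (\<xi>((Up, n0) := of_real \<rho> * l)) ^^ n) (ket Up n0) y)))
        \<le> (\<integral>\<^sup>+s. ennreal (norm (wave_field s y) * poisson (of_real \<rho> * l * loop s)) \<partial>haar)"
      using \<rho> m by (intro SUP_least norm_walk_power_le) (auto simp: norm_mult)
  qed
  also have "\<dots> = (\<integral>\<^sup>+s. (\<integral>\<^sup>+l. ennreal (norm (wave_field s y) * poisson (of_real \<rho> * l * loop s)) \<partial>haar) \<partial>haar)"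
    by (rule hh.Fubini') measurable
  also have "\<dots> = (\<integral>\<^sup>+s. ennreal (norm (wave_field s y)) * (\<integral>\<^sup>+l. ennreal (poisson (of_real \<rho> * l * loop s)) \<partial>haar) \<partial>haar)"
    by (rule nn_integral_cong) (simp add: ennreal_mult' nn_integral_cmult)
  also have "\<dots> = (\<integral>\<^sup>+s. ennreal (norm (wave_field s y)) \<partial>haar)"
    by (rule nn_integral_haar_cong) (simp add: nn_integral_poisson[OF \<rho> norm_loop])
  finally show ?thesis .
qed

text \<open>Radial limit by Fatou's lemma: for fixed \<open>n\<close> the entry depends continuously
  on the source phase, up to the circle, although the resolvent does not stay bounded there.\<close>

lemma mean_sup_walk_power:
  assumes m: "nat \<bar>snd y - n0\<bar> + 1 + N < M"
  shows "(\<integral>\<^sup>+l. (SUP n\<in>{..N}. ennreal (norm ((phase_walk r (\<xi>((Up, n0) := l)) ^^ n) (ket Up n0) y))) \<partial>haar)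
    \<le> (\<integral>\<^sup>+s. ennreal (norm (wave_field s y)) \<partial>haar)"
proof -
  define g where "g n \<zeta> = ennreal (norm ((phase_walk r (\<xi>((Up, n0) := \<zeta>)) ^^ n) (ket Up n0) y))" for n \<zeta>
  define \<rho> where "\<rho> j = 1 - 1 / real (Suc j)" for j
  have cg: "continuous_on UNIV (g n)" for n
    unfolding g_def[abs_def] by (intro continuous_intros continuous_on_ennreal continuous_phase_walk_power)
  then have [measurable]: "g n \<in> borel_measurable borel" for n
    by (rule borel_measurable_continuous_onI)
  have \<rho>: "0 \<le> \<rho> j" "\<rho> j < 1" for j by (auto simp: \<rho>_def)
  have "\<rho> \<longlonglongrightarrow> 1 - 0" unfolding \<rho>_def[abs_def] by (intro tendsto_intros LIMSEQ_Suc[OF lim_1_over_n])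
  then have lim: "(\<lambda>j. of_real (\<rho> j) * l) \<longlonglongrightarrow> l" for l :: complex
    by (auto intro!: tendsto_eq_intros)
  have "(\<integral>\<^sup>+l. (SUP n\<in>{..N}. g n l) \<partial>haar)
      \<le> (\<integral>\<^sup>+l. liminf (\<lambda>j. SUP n\<in>{..N}. g n (of_real (\<rho> j) * l)) \<partial>haar)"
  proof (intro nn_integral_mono SUP_least)
    fix l :: complex and n assume n: "n \<in> {..N}"
    have "(\<lambda>j. g n (of_real (\<rho> j) * l)) \<longlonglongrightarrow> g n l"
      using cg[of n] lim[of l] by (rule continuous_on_tendsto_compose) auto
    then have "g n l = liminf (\<lambda>j. g n (of_real (\<rho> j) * l))"
      by (rule lim_imp_Liminf[OF sequentially_bot, symmetric])
    also have "\<dots> \<le> liminf (\<lambda>j. SUP n\<in>{..N}. g n (of_real (\<rho> j) * l))"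
      using n by (intro Liminf_mono always_eventually allI SUP_upper)
    finally show "g n l \<le> liminf (\<lambda>j. SUP n\<in>{..N}. g n (of_real (\<rho> j) * l))" .
  qed
  also have "\<dots> \<le> liminf (\<lambda>j. \<integral>\<^sup>+l. (SUP n\<in>{..N}. g n (of_real (\<rho> j) * l)) \<partial>haar)"
    by (rule nn_integral_liminf) measurable
  also have "\<dots> \<le> liminf (\<lambda>j. \<integral>\<^sup>+s. ennreal (norm (wave_field s y)) \<partial>haar)"
    unfolding g_def by (intro Liminf_mono always_eventually allI mean_sup_walk_power_damped m \<rho>)
  also have "\<dots> = (\<integral>\<^sup>+s. ennreal (norm (wave_field s y)) \<partial>haar)"
    by (rule Liminf_const) simp
  finally show ?thesis unfolding g_def .
qed

lemma norm_wave_field: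
  assumes s: "norm s = 1"
  shows "k \<le> M \<Longrightarrow> norm (wave_field s (Up, n0 + int k)) = cascade r s (right_u \<xi> n0) (right_v \<xi> n0) k (Rr k s)"
    "k \<le> M \<Longrightarrow> norm (wave_field s (Down, n0 - 1 + int k)) = cascade r s (right_u \<xi> n0) (right_v \<xi> n0) k (Rr k s)"
    "Suc k \<le> M \<Longrightarrow> norm (wave_field s (Up, n0 - int (Suc k)))
      = cascade (- r) s (left_u \<xi> n0) (left_v \<xi> n0) (Suc k) (Rl (Suc k) s)"
    "Suc k \<le> M \<Longrightarrow> norm (wave_field s (Down, n0 - 2 - int k))
      = cascade (- r) s (left_u \<xi> n0) (left_v \<xi> n0) (Suc k) (Rl (Suc k) s)"
  unfolding wave_field_simps norm_mult
  using right.norm_amplitude[OF s] left.norm_amplitude[OF s] s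
  by (simp_all add: right.norm_reflection left.norm_reflection del: cascade.simps reflection.simps)

end

section \<open>Averaging over the random phases\<close>

lemma circle_phase_circle_of: "circle_phase (circle_of x) = exp (- (\<i> * of_real x))"
  by (simp add: circle_phase.abs_eq)

lemma measurable_circle_phase [measurable]: "circle_phase \<in> borel_measurable borel"
proof (rule borel_measurable_continuous_onI)
  have "open (circle_phase -` V)" if "open V" for V
  proof -
    have "circle_of -` circle_phase -` V = (\<lambda>x. exp (- (\<i> * complex_of_real x))) -` V"
      by (auto simp: circle_phase_circle_of)
    moreover have "continuous_on UNIV (\<lambda>x. exp (- (\<i> * complex_of_real x)))"
      by (intro continuous_intros)
    ultimately show ?thesis
      unfolding open_circle_def using that by (simp add: open_vimage)
  qed
  then show "continuous_on UNIV circle_phase" by (simp add: continuous_on_open_vimage)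
qed

text \<open>The factor 2 pi compares the total mass of \<open>circle_lebesgue\<close> with that of
  \<open>haar\<close>. The phase is exp (- i x), so the uniform law appears conjugated, which leaves
  it unchanged.\<close>

lemma circle_law_density:
  assumes "prob_space \<mu>"
    and [measurable]: "\<tau> \<in> borel_measurable circle_lebesgue"
    and B: "AE x in circle_lebesgue. \<bar>\<tau> x\<bar> \<le> B"
    and \<mu>: "\<mu> = density circle_lebesgue (\<lambda>x. ennreal (\<tau> x))"
  shows "circle_law (distr \<mu> borel circle_phase) (2 * pi * B)"
proof -
  interpret \<mu>: prob_space \<mu> by fact
  have s [measurable_cong]: "sets \<mu> = sets borel" by (simp add: \<mu>)
  interpret D: prob_space "distr \<mu> borel circle_phase" by (rule \<mu>.prob_space_distr) measurable
  show ?thesis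
  proof unfold_locales
    fix F :: "complex \<Rightarrow> ennreal" assume [measurable]: "F \<in> borel_measurable borel"
    have "(\<integral>\<^sup>+z. F z \<partial>distr \<mu> borel circle_phase) = (\<integral>\<^sup>+a. F (circle_phase a) \<partial>\<mu>)"
      by (rule nn_integral_distr) measurable
    also have "\<dots> = (\<integral>\<^sup>+a. ennreal (\<tau> a) * F (circle_phase a) \<partial>circle_lebesgue)"
      unfolding \<mu> by (rule nn_integral_density) measurable
    also have "\<dots> \<le> (\<integral>\<^sup>+a. ennreal B * F (circle_phase a) \<partial>circle_lebesgue)"
      using B by (intro nn_integral_mono_AE) (auto elim!: eventually_mono intro!: mult_right_mono ennreal_leI)
    also have "\<dots> = ennreal B * (\<integral>\<^sup>+a. F (circle_phase a) \<partial>circle_lebesgue)"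
      by (rule nn_integral_cmult) measurable
    also have "(\<integral>\<^sup>+a. F (circle_phase a) \<partial>circle_lebesgue)
        = (\<integral>\<^sup>+x. F (exp (- (\<i> * complex_of_real x))) \<partial>restrict_space lborel {0..<2 * pi})"
      unfolding circle_lebesgue_def
      by (subst nn_integral_distr) (auto intro!: measurable_restrict_space1 simp: circle_phase_circle_of)
    also have "\<dots> = (\<integral>\<^sup>+x. F (exp (- (\<i> * complex_of_real x))) * indicator {0..<2 * pi} x \<partial>lborel)"
      by (subst nn_integral_restrict_space) auto
    also have "\<dots> = ennreal (2 * pi) *
        (\<integral>\<^sup>+x. F (exp (- (\<i> * complex_of_real (0 + 2 * pi * x)))) * indicator {0..<2 * pi} (0 + 2 * pi * x) \<partial>lborel)"
      by (subst nn_integral_real_affine[where c = "2 * pi" and t = 0]) auto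
    also have "(\<integral>\<^sup>+x. F (exp (- (\<i> * complex_of_real (0 + 2 * pi * x)))) * indicator {0..<2 * pi} (0 + 2 * pi * x) \<partial>lborel)
        = (\<integral>\<^sup>+x. F (cnj (cis (2 * pi * x))) * indicator {0..<1} x \<partial>lborel)"
    proof (rule nn_integral_cong)
      fix x :: real
      have "exp (- (\<i> * complex_of_real (0 + 2 * pi * x))) = cnj (cis (2 * pi * x))"
        by (simp add: cis_conv_exp exp_cnj)
      moreover have "0 + 2 * pi * x \<in> {0..<2 * pi} \<longleftrightarrow> x \<in> {0..<1}"
      proof -
        have "\<not> pi \<le> 0" using pi_gt_zero by linarith
        then show ?thesis by (auto simp: zero_le_mult_iff)
      qed
      ultimately show "F (exp (- (\<i> * complex_of_real (0 + 2 * pi * x)))) * indicator {0..<2 * pi} (0 + 2 * pi * x)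
          = F (cnj (cis (2 * pi * x))) * indicator {0..<1} x"
        by (simp only: indicator_def)
    qed
    also have "\<dots> = (\<integral>\<^sup>+z. F (cnj z) \<partial>haar)"
      by (rule nn_integral_haar[symmetric]) measurable
    also have "\<dots> = (\<integral>\<^sup>+z. F z \<partial>haar)"
      by (rule nn_integral_haar_cnj) measurable
    finally have le: "(\<integral>\<^sup>+z. F z \<partial>distr \<mu> borel circle_phase)
        \<le> ennreal B * (ennreal (2 * pi) * (\<integral>\<^sup>+z. F z \<partial>haar))" .
    have "ennreal (2 * pi * B) = ennreal (2 * pi) * ennreal B" by (rule ennreal_mult') simp
    with le show "(\<integral>\<^sup>+z. F z \<partial>distr \<mu> borel circle_phase) \<le> ennreal (2 * pi * B) * (\<integral>\<^sup>+z. F z \<partial>haar)"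
      by (simp only: mult_ac)
  qed simp
qed

section \<open>Phases as independent coordinates, and integration over one of them\<close>

fun phase_index :: "spin \<times> int \<Rightarrow> int" where
  "phase_index (Up, n) = 2 * (n - 1)"
| "phase_index (Down, n) = 2 * (n + 1) + 1"

lemma phase_index_eq_iff [simp]: "phase_index y = phase_index z \<longleftrightarrow> y = z"
proof
  assume "phase_index y = phase_index z"
  then show "y = z"
    by (cases y rule: phase_index.cases; cases z rule: phase_index.cases) (simp_all, presburger+)
qed simp

definition phases :: "(int \<Rightarrow> circle) \<Rightarrow> spin \<times> int \<Rightarrow> complex" where
  "phases \<omega> y = circle_phase (\<omega> (phase_index y))"

lemma norm_phases [simp]: "norm (phases \<omega> y) = 1"
  by (simp add: phases_def)

lemma phases_upd: "phases (\<omega> (phase_index y := a)) = (phases \<omega>)(y := circle_phase a)"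
  by (auto simp: phases_def)

lemma walk_eq_phase_walk:
  "walk r (sqrt (1 - r\<^sup>2)) \<omega> = phase_walk r (phases \<omega>)"
proof (intro ext)
  fix \<psi> and y :: "spin \<times> int"
  obtain \<sigma> n where "y = (\<sigma>, n)" by (cases y)
  then show "walk r (sqrt (1 - r\<^sup>2)) \<omega> \<psi> y = phase_walk r (phases \<omega>) \<psi> y"
    by (cases \<sigma>) (simp_all add: phases_def)
qed

lemma measurable_phase_walk_power:
  assumes "\<And>z. (\<lambda>x. \<xi> x z) \<in> borel_measurable N"
  shows "(\<lambda>x. (phase_walk r (\<xi> x) ^^ n) \<psi> y) \<in> borel_measurable N"
proof (induction n arbitrary: y)
  case (Suc n)
  note [measurable] = assms Suc
  obtain \<sigma> m where y: "y = (\<sigma>, m)" by (cases y)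
  show ?case unfolding y by (cases \<sigma>) simp_all
qed simp

locale random_phases = \<mu>: prob_space \<mu> for \<mu> :: "circle measure" +
  fixes r K :: real
  assumes sets_mu [measurable_cong]: "sets \<mu> = sets borel"
    and law: "circle_law (distr \<mu> borel circle_phase) K"
    and r: "0 < r" "r < 1"
begin

sublocale law: circle_law "distr \<mu> borel circle_phase" K by (rule law)

abbreviation "\<nu> \<equiv> distr \<mu> borel circle_phase"
abbreviation "P \<equiv> phase_space \<mu>"

sublocale P: prob_space P
  unfolding phase_space_def by (rule prob_space_PiM) (rule \<mu>.prob_space_axioms)

lemma space_P [simp]: "space P = UNIV"
  using sets_eq_imp_space_eq[OF sets_mu] by (simp add: phase_space_def space_PiM PiE_def extensional_def)

lemma measurable_phases [measurable]: "(\<lambda>\<omega>. phases \<omega> y) \<in> borel_measurable P"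
proof -
  have "(\<lambda>\<omega>. \<omega> (phase_index y)) \<in> measurable P \<mu>"
    unfolding phase_space_def by (rule measurable_component_singleton) simp
  then have "(\<lambda>\<omega>. \<omega> (phase_index y)) \<in> measurable P borel"
    by (simp add: measurable_cong_sets[OF refl sets_mu])
  then show ?thesis unfolding phases_def by measurable
qed

text \<open>Redrawing one coordinate independently preserves the product measure, and
  \<open>G\<close> does not notice it. All uses of independence below go through this step.\<close>

lemma nn_integral_resample:
  assumes [measurable]: "case_prod G \<in> borel_measurable (P \<Otimes>\<^sub>M borel)"
    and indep: "\<And>\<omega> a. G (\<omega> (phase_index y := a)) = G \<omega>"
  shows "(\<integral>\<^sup>+\<omega>. G \<omega> (phases \<omega> y) \<partial>P) = (\<integral>\<^sup>+\<omega>. (\<integral>\<^sup>+z. G \<omega> z \<partial>\<nu>) \<partial>P)"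
proof -
  interpret \<mu>P: pair_sigma_finite \<mu> P ..
  have P: "distr (\<mu> \<Otimes>\<^sub>M P) P (\<lambda>(x, X). X(phase_index y := x)) = P"
    using distr_pair_PiM_eq_PiM[of UNIV "\<lambda>_. \<mu>" "phase_index y"] \<mu>.prob_space_axioms
    by (simp add: phase_space_def)
  have [measurable]: "(\<lambda>(x, X). X(phase_index y := x)) \<in> measurable (\<mu> \<Otimes>\<^sub>M P) P"
    unfolding phase_space_def case_prod_beta
    by (rule measurable_fun_upd[where J = UNIV, OF _ measurable_snd measurable_fst]) simp
  have "(\<integral>\<^sup>+\<omega>. G \<omega> (phases \<omega> y) \<partial>P)
      = (\<integral>\<^sup>+\<omega>. G \<omega> (phases \<omega> y) \<partial>distr (\<mu> \<Otimes>\<^sub>M P) P (\<lambda>(x, X). X(phase_index y := x)))"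
    by (simp only: P)
  also have "\<dots> = (\<integral>\<^sup>+p. G (snd p) (circle_phase (fst p)) \<partial>(\<mu> \<Otimes>\<^sub>M P))"
    by (subst nn_integral_distr) (auto simp: phases_upd indep case_prod_beta)
  also have "\<dots> = (\<integral>\<^sup>+\<omega>. (\<integral>\<^sup>+a. G \<omega> (circle_phase a) \<partial>\<mu>) \<partial>P)"
    by (subst \<mu>P.nn_integral_snd[symmetric]) auto
  also have "\<dots> = (\<integral>\<^sup>+\<omega>. (\<integral>\<^sup>+z. G \<omega> z \<partial>\<nu>) \<partial>P)"
    by (rule nn_integral_cong, subst nn_integral_distr) auto
  finally show ?thesis .
qed

text \<open>Peeling off site \<open>j\<close> moves one \<open>rootderiv\<close> into
  \<open>Y\<close> and one scattering step into \<open>Z\<close>. Both then depend on the phases of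
  site \<open>j\<close> but not on those of smaller index, which the induction hypothesis integrates
  first; hence the general \<open>Y\<close> and \<open>Z\<close>.\<close>

lemma expected_cascade:
  assumes \<rho>: "\<bar>\<rho>\<bar> < 1" and s: "norm s = 1"
    and p: "inj pu" "inj pv" "\<And>i j. pu i \<noteq> pv j"
    and "Y \<in> borel_measurable P" "Z \<in> borel_measurable P" "\<And>\<omega>. norm (Z \<omega>) = 1"
    and "\<And>i \<omega> a. i < j \<Longrightarrow> Y (\<omega> (phase_index (pu i) := a)) = Y \<omega>"
    and "\<And>i \<omega> a. i < j \<Longrightarrow> Y (\<omega> (phase_index (pv i) := a)) = Y \<omega>"
    and "\<And>i \<omega> a. i < j \<Longrightarrow> Z (\<omega> (phase_index (pu i) := a)) = Z \<omega>"
    and "\<And>i \<omega> a. i < j \<Longrightarrow> Z (\<omega> (phase_index (pv i) := a)) = Z \<omega>"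
  shows "(\<integral>\<^sup>+\<omega>. Y \<omega> * ennreal (cascade \<rho> s (\<lambda>i. phases \<omega> (pu i)) (\<lambda>i. phases \<omega> (pv i)) j (Z \<omega>)) \<partial>P)
    = (\<integral>\<^sup>+\<omega>. Y \<omega> * ennreal (law.moment \<rho> s j (Z \<omega>)) \<partial>P)"
  using assms(6-)
proof (induction j arbitrary: Y Z)
  case (Suc j)
  note [measurable] = Suc.prems(1,2)
  note Y = Suc.prems(4,5) and Z = Suc.prems(6,7)
  let ?m = "law.moment \<rho> s j"
  obtain B where m: "nonneg_bdd B ?m" using law.moment_bdd[OF \<rho> s] by blast
  note w = law.nonneg_bdd_weighted[OF m \<rho> s]
  note [measurable] = nonneg_bddD(1)[OF m] nonneg_bddD(1)[OF w]
  define W where "W \<omega> = s * phases \<omega> (pu j) * Z \<omega>" for \<omega>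
  have W1: "norm (W \<omega>) = 1" for \<omega> using Suc.prems(3) s by (simp add: W_def norm_mult)
  have [measurable]: "W \<in> borel_measurable P" unfolding W_def[abs_def] by measurable
  define Y' where "Y' \<omega> = Y \<omega> * ennreal (rootderiv \<rho> (W \<omega>))" for \<omega>
  have [measurable]: "Y' \<in> borel_measurable P" unfolding Y'_def[abs_def] by measurable
  define Z' where "Z' \<omega> = s * phases \<omega> (pv j) * disc_auto \<rho> (W \<omega>)" for \<omega>
  have [measurable]: "Z' \<in> borel_measurable P" unfolding Z'_def[abs_def] by measurable
  have ne: "pu i \<noteq> pu j" "pv i \<noteq> pv j" if "i < j" for i
    using p(1,2) that by (auto simp: inj_def)
  have Wu: "W (\<omega> (phase_index (pu i) := a)) = W \<omega>" if "i < j" for i \<omega> a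
  proof -
    have "Z (\<omega> (phase_index (pu i) := a)) = Z \<omega>" using that by (intro Z) simp
    moreover have "phases (\<omega> (phase_index (pu i) := a)) (pu j) = phases \<omega> (pu j)"
      using ne(1)[OF that] by (simp add: phases_upd)
    ultimately show ?thesis unfolding W_def by (simp only:)
  qed
  have Wv: "W (\<omega> (phase_index (pv i) := a)) = W \<omega>" if "i < Suc j" for i \<omega> a
  proof -
    have "Z (\<omega> (phase_index (pv i) := a)) = Z \<omega>" using that by (intro Z)
    moreover have "phases (\<omega> (phase_index (pv i) := a)) (pu j) = phases \<omega> (pu j)"
      using p(3)[of j i] by (simp add: phases_upd)
    ultimately show ?thesis unfolding W_def by (simp only:)
  qed
  have "(\<integral>\<^sup>+\<omega>. Y \<omega> * ennreal (cascade \<rho> s (\<lambda>i. phases \<omega> (pu i)) (\<lambda>i. phases \<omega> (pv i)) (Suc j) (Z \<omega>)) \<partial>P)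
    = (\<integral>\<^sup>+\<omega>. Y' \<omega> * ennreal (cascade \<rho> s (\<lambda>i. phases \<omega> (pu i)) (\<lambda>i. phases \<omega> (pv i)) j (Z' \<omega>)) \<partial>P)"
    by (rule nn_integral_cong)
      (simp add: Y'_def Z'_def W_def ennreal_mult rootderiv_nonneg[OF \<rho>] cascade_nonneg[OF \<rho>] mult.assoc)
  also have "\<dots> = (\<integral>\<^sup>+\<omega>. Y' \<omega> * ennreal (?m (Z' \<omega>)) \<partial>P)"
  proof (rule Suc.IH)
    show "norm (Z' \<omega>) = 1" for \<omega> using s by (simp add: Z'_def norm_mult norm_disc_auto[OF \<rho> W1])
    fix i \<omega> a assume i: "i < j"
    have "Y (\<omega> (phase_index (pu i) := a)) = Y \<omega>" "Y (\<omega> (phase_index (pv i) := a)) = Y \<omega>"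
      using i by (intro Y; simp)+
    moreover have "W (\<omega> (phase_index (pu i) := a)) = W \<omega>" "W (\<omega> (phase_index (pv i) := a)) = W \<omega>"
      using i by (auto intro: Wu Wv)
    ultimately show "Y' (\<omega> (phase_index (pu i) := a)) = Y' \<omega>" "Y' (\<omega> (phase_index (pv i) := a)) = Y' \<omega>"
      unfolding Y'_def by (simp_all only:)
    show "Z' (\<omega> (phase_index (pu i) := a)) = Z' \<omega>" "Z' (\<omega> (phase_index (pv i) := a)) = Z' \<omega>"
      using i ne[OF i] p(3)[of i j] by (auto simp: Z'_def Wu Wv phases_upd)
  qed measurable
  \<comment> \<open>\<open>pv j\<close> occurs only in the argument of the moment and becomes the
    \<open>avg\<close> inside \<open>weighted\<close>. \<open>pu j\<close> also occurs in the
    weight, so it is integrated last.\<close>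
  also have "\<dots> = (\<integral>\<^sup>+\<omega>. (\<integral>\<^sup>+b. Y' \<omega> * ennreal (?m (s * b * disc_auto \<rho> (W \<omega>))) \<partial>\<nu>) \<partial>P)"
    unfolding Z'_def
  proof (rule nn_integral_resample[where G = "\<lambda>\<omega> b. Y' \<omega> * ennreal (?m (s * b * disc_auto \<rho> (W \<omega>)))"])
    show "(\<lambda>b. Y' (\<omega> (phase_index (pv j) := a)) * ennreal (?m (s * b * disc_auto \<rho> (W (\<omega> (phase_index (pv j) := a))))))
        = (\<lambda>b. Y' \<omega> * ennreal (?m (s * b * disc_auto \<rho> (W \<omega>))))" for \<omega> a
    proof -
      have "Y (\<omega> (phase_index (pv j) := a)) = Y \<omega>" "W (\<omega> (phase_index (pv j) := a)) = W \<omega>"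
        by (auto intro: Y Wv)
      then show ?thesis unfolding Y'_def by (simp only:)
    qed
  qed measurable
  also have "\<dots> = (\<integral>\<^sup>+\<omega>. Y \<omega> * ennreal (law.weighted \<rho> s ?m (W \<omega>)) \<partial>P)"
  proof (rule nn_integral_cong)
    fix \<omega>
    have n: "norm (s * disc_auto \<rho> (W \<omega>)) = 1" using s by (simp add: norm_mult norm_disc_auto[OF \<rho> W1])
    have "(\<integral>\<^sup>+b. Y' \<omega> * ennreal (?m (s * b * disc_auto \<rho> (W \<omega>))) \<partial>\<nu>)
        = Y' \<omega> * (\<integral>\<^sup>+b. ennreal (?m (b * (s * disc_auto \<rho> (W \<omega>)))) \<partial>\<nu>)"
      by (subst nn_integral_cmult) (auto simp: mult_ac)
    also have "\<dots> = Y \<omega> * ennreal (law.weighted \<rho> s ?m (W \<omega>))"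
      unfolding law.ennreal_avg[OF m n, symmetric]
      by (simp add: Y'_def law.weighted_def ennreal_mult rootderiv_nonneg[OF \<rho>]
          nonneg_bddD(2)[OF law.nonneg_bdd_avg[OF m]] mult.assoc)
    finally show "(\<integral>\<^sup>+b. Y' \<omega> * ennreal (?m (s * b * disc_auto \<rho> (W \<omega>))) \<partial>\<nu>)
        = Y \<omega> * ennreal (law.weighted \<rho> s ?m (W \<omega>))" .
  qed
  also have "\<dots> = (\<integral>\<^sup>+\<omega>. (\<integral>\<^sup>+a. Y \<omega> * ennreal (law.weighted \<rho> s ?m (s * a * Z \<omega>)) \<partial>\<nu>) \<partial>P)"
    unfolding W_def
  proof (rule nn_integral_resample[where G = "\<lambda>\<omega> a. Y \<omega> * ennreal (law.weighted \<rho> s ?m (s * a * Z \<omega>))"])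
    show "(\<lambda>b. Y (\<omega> (phase_index (pu j) := a)) * ennreal (law.weighted \<rho> s ?m (s * b * Z (\<omega> (phase_index (pu j) := a)))))
        = (\<lambda>b. Y \<omega> * ennreal (law.weighted \<rho> s ?m (s * b * Z \<omega>)))" for \<omega> a
    proof -
      have "Y (\<omega> (phase_index (pu j) := a)) = Y \<omega>" "Z (\<omega> (phase_index (pu j) := a)) = Z \<omega>"
        by (auto intro: Y Z)
      then show ?thesis by (simp only:)
    qed
  qed measurable
  also have "\<dots> = (\<integral>\<^sup>+\<omega>. Y \<omega> * ennreal (law.moment \<rho> s (Suc j) (Z \<omega>)) \<partial>P)"
  proof (rule nn_integral_cong)
    fix \<omega>
    have n: "norm (s * Z \<omega>) = 1" using s Suc.prems(3) by (simp add: norm_mult)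
    have "(\<integral>\<^sup>+a. Y \<omega> * ennreal (law.weighted \<rho> s ?m (s * a * Z \<omega>)) \<partial>\<nu>)
        = Y \<omega> * (\<integral>\<^sup>+a. ennreal (law.weighted \<rho> s ?m (a * (s * Z \<omega>))) \<partial>\<nu>)"
      by (subst nn_integral_cmult) (auto simp: mult_ac)
    then show "(\<integral>\<^sup>+a. Y \<omega> * ennreal (law.weighted \<rho> s ?m (s * a * Z \<omega>)) \<partial>\<nu>)
        = Y \<omega> * ennreal (law.moment \<rho> s (Suc j) (Z \<omega>))"
      unfolding law.ennreal_avg[OF w n, symmetric] by simp
  qed
  finally show ?case .
qed simp

text \<open>Both signs of \<open>r\<close> occur, one for each half line. The 1/2 keeps
  \<open>q\<close> positive, so that one can divide by it.\<close>

definition q :: real where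
  "q = max (1 / 2) (max (law.rate r) (law.rate (- r)))"

lemma q_bounds: "0 < q" "q < 1" "law.rate r \<le> q" "law.rate (- r) \<le> q"
  using r law.rate_bounds(2)[of r] law.rate_bounds(2)[of "- r"] by (auto simp: q_def)

text \<open>\<open>moment_le\<close> yields the exponent \<open>k - 1\<close>, while a component
  with \<open>k\<close> hops may lie at distance \<open>k + 1\<close>; the division by
  \<open>q\<^sup>2\<close> bridges the difference and also covers \<open>k = 0\<close>.\<close>

lemma expected_cascade_le:
  assumes \<rho>: "\<rho> = r \<or> \<rho> = - r" and s: "norm s = 1"
    and p: "inj pu" "inj pv" "\<And>i j. pu i \<noteq> pv j"
  shows "(\<integral>\<^sup>+\<omega>. ennreal (cascade \<rho> s (\<lambda>i. phases \<omega> (pu i)) (\<lambda>i. phases \<omega> (pv i)) k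
      (reflection \<rho> (\<lambda>i. phases \<omega> (pu i)) (\<lambda>i. phases \<omega> (pv i)) n k s)) \<partial>P) \<le> ennreal (K / q\<^sup>2 * q ^ Suc k)"
proof -
  have \<rho>1: "\<bar>\<rho>\<bar> < 1" "\<rho> \<noteq> 0" and rate: "law.rate \<rho> \<le> q" using \<rho> r q_bounds by auto
  define Z where "Z \<omega> = reflection \<rho> (\<lambda>i. phases \<omega> (pu i)) (\<lambda>i. phases \<omega> (pv i)) n k s" for \<omega>
  have Z1: "norm (Z \<omega>) = 1" for \<omega>
  proof -
    interpret half_line \<rho> "\<lambda>i. phases \<omega> (pu i)" "\<lambda>i. phases \<omega> (pv i)" 0
      by unfold_locales (use \<rho>1 in auto)
    show ?thesis unfolding Z_def by (rule norm_reflection[OF s])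
  qed
  have "(\<integral>\<^sup>+\<omega>. 1 * ennreal (cascade \<rho> s (\<lambda>i. phases \<omega> (pu i)) (\<lambda>i. phases \<omega> (pv i)) k (Z \<omega>)) \<partial>P)
    = (\<integral>\<^sup>+\<omega>. 1 * ennreal (law.moment \<rho> s k (Z \<omega>)) \<partial>P)"
  proof (rule expected_cascade[OF \<rho>1(1) s p _ _ Z1])
    show "Z \<in> borel_measurable P" unfolding Z_def[abs_def] by measurable
    fix i \<omega> a assume i: "i < k"
    have ne: "pu j \<noteq> pu i" "pv j \<noteq> pv i" "pv j \<noteq> pu i" "pu j \<noteq> pv i" if "j \<ge> k" for j
      using i that injD[OF p(1), of j i] injD[OF p(2), of j i] p(3)[of i j] p(3)[of j i] by auto
    show "Z (\<omega> (phase_index (pu i) := a)) = Z \<omega>" "Z (\<omega> (phase_index (pv i) := a)) = Z \<omega>"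
      unfolding Z_def using ne by (auto simp: phases_upd intro!: reflection_cong)
  qed auto
  also have "\<dots> \<le> (\<integral>\<^sup>+\<omega>. ennreal (K / q\<^sup>2 * q ^ Suc k) \<partial>P)"
  proof (rule nn_integral_mono)
    fix \<omega>
    have "law.moment \<rho> s k (Z \<omega>) \<le> K / q\<^sup>2 * q ^ Suc k"
    proof (cases k)
      case 0
      have "1 \<le> K / q" using law.K_ge_1 q_bounds(1,2) by (simp add: field_simps)
      then show ?thesis using 0 q_bounds(1) by (simp add: power2_eq_square)
    next
      case (Suc i)
      have "law.moment \<rho> s (Suc i) (Z \<omega>) \<le> K * law.rate \<rho> ^ i" by (rule law.moment_le[OF \<rho>1 s Z1])
      also have "\<dots> \<le> K * q ^ i"
        using law.K_ge_1 law.rate_bounds(1)[OF \<rho>1] rate by (intro mult_left_mono power_mono) auto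
      also have "\<dots> = K / q\<^sup>2 * q ^ Suc k" using Suc q_bounds(1) by (simp add: power2_eq_square)
      finally show ?thesis using Suc by simp
    qed
    then show "1 * ennreal (law.moment \<rho> s k (Z \<omega>)) \<le> ennreal (K / q\<^sup>2 * q ^ Suc k)"
      by (simp add: ennreal_leI)
  qed
  finally show ?thesis unfolding Z_def by (simp add: P.emeasure_space_1[simplified])
qed

text \<open>The four families of components are put into one form, so that the expectation is
  estimated once. The sites and \<open>k\<close> are independent of the phases and of
  \<open>s\<close>.\<close>

lemma wave_field_cascade:
  assumes M: "nat \<bar>snd y - n0\<bar> + 1 \<le> M"
  shows "\<exists>\<rho> pu pv k. (\<rho> = r \<or> \<rho> = - r) \<and> inj pu \<and> inj pv \<and> (\<forall>i j. pu i \<noteq> pv j) \<and> nat \<bar>snd y - n0\<bar> \<le> Suc k \<and>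
    (\<forall>\<omega> s. norm s = 1 \<longrightarrow> norm (walk_source.wave_field r (phases \<omega>) n0 M s y) =
      cascade \<rho> s (\<lambda>i. phases \<omega> (pu i)) (\<lambda>i. phases \<omega> (pv i)) k
        (reflection \<rho> (\<lambda>i. phases \<omega> (pu i)) (\<lambda>i. phases \<omega> (pv i)) (M - k) k s))"
proof -
  have ws: "walk_source r (phases \<omega>) M" for \<omega>
    by unfold_locales (use r M in auto)
  let ?ru = "\<lambda>i. (Up, n0 + 1 + int i)" and ?rv = "\<lambda>i. (Down, n0 - 1 + int i)"
    and ?lu = "\<lambda>i. (Down, n0 - 2 - int i)" and ?lv = "\<lambda>i. (Up, n0 - int i)"
  have R: "right_u (phases \<omega>) n0 = (\<lambda>i. phases \<omega> (?ru i))" "right_v (phases \<omega>) n0 = (\<lambda>i. phases \<omega> (?rv i))"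
    "left_u (phases \<omega>) n0 = (\<lambda>i. phases \<omega> (?lu i))" for \<omega>
    by (auto simp: right_u_def right_v_def left_u_def)
  \<comment> \<open>\<open>left_v\<close> has 1 in place of the source phase. Restoring the phase at
    index 0 gives a family of independent phases without changing either value.\<close>
  have L: "cascade (- r) s (left_u (phases \<omega>) n0) (left_v (phases \<omega>) n0) (Suc k)
        (reflection (- r) (left_u (phases \<omega>) n0) (left_v (phases \<omega>) n0) m (Suc k) s) =
      cascade (- r) s (\<lambda>i. phases \<omega> (?lu i)) (\<lambda>i. phases \<omega> (?lv i)) (Suc k)
        (reflection (- r) (\<lambda>i. phases \<omega> (?lu i)) (\<lambda>i. phases \<omega> (?lv i)) m (Suc k) s)" for \<omega> s k m
  proof -
    have "reflection (- r) (left_u (phases \<omega>) n0) (left_v (phases \<omega>) n0) m (Suc k) s =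
        reflection (- r) (\<lambda>i. phases \<omega> (?lu i)) (\<lambda>i. phases \<omega> (?lv i)) m (Suc k) s"
      by (rule reflection_cong) (auto simp: left_u_def left_v_def)
    then show ?thesis
      by (simp only:) (rule cascade_cong, auto simp: left_u_def left_v_def)
  qed
  show ?thesis
  proof (cases y rule: walk_source.position_cases[OF ws[of undefined], where ?n0.0 = n0, case_names ru rd lu ld])
    case (ru k)
    then show ?thesis using M walk_source.norm_wave_field(1)[OF ws, where k = k and ?n0.0 = n0]
      by (intro exI[of _ r] exI[of _ ?ru] exI[of _ ?rv] exI[of _ k]) (auto simp: inj_def R)
  next
    case (rd k)
    then show ?thesis using M walk_source.norm_wave_field(2)[OF ws, where k = k and ?n0.0 = n0]
      by (intro exI[of _ r] exI[of _ ?ru] exI[of _ ?rv] exI[of _ k]) (auto simp: inj_def R)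
  next
    case (lu k)
    then show ?thesis using M walk_source.norm_wave_field(3)[OF ws, where k = k and ?n0.0 = n0]
      by (intro exI[of _ "- r"] exI[of _ ?lu] exI[of _ ?lv] exI[of _ "Suc k"])
        (auto simp: inj_def L simp del: cascade.simps reflection.simps)
  next
    case (ld k)
    then show ?thesis using M walk_source.norm_wave_field(4)[OF ws, where k = k and ?n0.0 = n0]
      by (intro exI[of _ "- r"] exI[of _ ?lu] exI[of _ ?lv] exI[of _ "Suc k"])
        (auto simp: inj_def L simp del: cascade.simps reflection.simps)
  qed
qed

text \<open>One factor \<open>K\<close> replaces the law of the source phase by the uniform one, the
  other comes from \<open>moment_le\<close>. The field does not contain the source phase, so the two
  averages can be taken one after the other.\<close>

lemma expected_sup_finite:
  "(\<integral>\<^sup>+\<omega>. (SUP n\<in>{..N}. ennreal (norm ((phase_walk r (phases \<omega>) ^^ n) (ket Up n0) y))) \<partial>P)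
    \<le> ennreal (K\<^sup>2 / q\<^sup>2 * q ^ nat \<bar>snd y - n0\<bar>)"
proof -
  \<comment> \<open>The reflectors are placed just out of reach of \<open>N\<close> steps. The bound
    does not contain \<open>M\<close>, so \<open>N\<close> may later tend to infinity.\<close>
  define M where "M = nat \<bar>snd y - n0\<bar> + N + 2"
  have M_ge: "nat \<bar>snd y - n0\<bar> + 1 \<le> M" "nat \<bar>snd y - n0\<bar> + 1 + N < M" by (auto simp: M_def)
  obtain \<rho> pu pv k where c': "(\<rho> = r \<or> \<rho> = - r) \<and> inj pu \<and> inj pv \<and> (\<forall>i j. pu i \<noteq> pv j) \<and>
    nat \<bar>snd y - n0\<bar> \<le> Suc k \<and>
    (\<forall>\<omega> s. norm s = 1 \<longrightarrow> norm (walk_source.wave_field r (phases \<omega>) n0 M s y) =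
      cascade \<rho> s (\<lambda>i. phases \<omega> (pu i)) (\<lambda>i. phases \<omega> (pv i)) k
        (reflection \<rho> (\<lambda>i. phases \<omega> (pu i)) (\<lambda>i. phases \<omega> (pv i)) (M - k) k s))"
    using wave_field_cascade[OF M_ge(1)] by (elim exE) (rule that)
  then have c: "\<rho> = r \<or> \<rho> = - r" "inj pu" "inj pv" "\<And>i j. pu i \<noteq> pv j" "nat \<bar>snd y - n0\<bar> \<le> Suc k"
    "\<And>\<omega> s. norm s = 1 \<Longrightarrow> norm (walk_source.wave_field r (phases \<omega>) n0 M s y) =
      cascade \<rho> s (\<lambda>i. phases \<omega> (pu i)) (\<lambda>i. phases \<omega> (pv i)) k
        (reflection \<rho> (\<lambda>i. phases \<omega> (pu i)) (\<lambda>i. phases \<omega> (pv i)) (M - k) k s)"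
    by simp_all
  let ?c = "\<lambda>\<omega> s. cascade \<rho> s (\<lambda>i. phases \<omega> (pu i)) (\<lambda>i. phases \<omega> (pv i)) k
      (reflection \<rho> (\<lambda>i. phases \<omega> (pu i)) (\<lambda>i. phases \<omega> (pv i)) (M - k) k s)"
  interpret Ph: pair_sigma_finite P haar ..
  let ?f = "\<lambda>\<xi>. SUP n\<in>{..N}. ennreal (norm ((phase_walk r \<xi> ^^ n) (ket Up n0) y))"
  define G where "G \<omega> z = ?f ((phases \<omega>)((Up, n0) := z))" for \<omega> z
  have G [measurable]: "case_prod G \<in> borel_measurable (P \<Otimes>\<^sub>M borel)"
  proof -
    have [measurable]: "(\<lambda>p. (phase_walk r ((phases (fst p))((Up, n0) := snd p)) ^^ n) (ket Up n0) y)
        \<in> borel_measurable (P \<Otimes>\<^sub>M borel)" for n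
      by (rule measurable_phase_walk_power) (simp add: fun_upd_def)
    show ?thesis unfolding G_def case_prod_beta by measurable
  qed
  have "(\<integral>\<^sup>+\<omega>. ?f (phases \<omega>) \<partial>P) = (\<integral>\<^sup>+\<omega>. G \<omega> (phases \<omega> (Up, n0)) \<partial>P)"
    by (simp add: G_def fun_upd_triv)
  also have "\<dots> = (\<integral>\<^sup>+\<omega>. (\<integral>\<^sup>+z. G \<omega> z \<partial>\<nu>) \<partial>P)"
    by (rule nn_integral_resample[OF G], rule ext) (simp only: G_def phases_upd fun_upd_upd)
  also have "\<dots> \<le> (\<integral>\<^sup>+\<omega>. ennreal K * (\<integral>\<^sup>+s. ennreal (norm (walk_source.wave_field r (phases \<omega>) n0 M s y)) \<partial>haar) \<partial>P)"
  proof (rule nn_integral_mono)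
    fix \<omega>
    interpret walk_source r "phases \<omega>" n0 M by unfold_locales (use r M_ge in auto)
    have "(\<integral>\<^sup>+z. G \<omega> z \<partial>\<nu>) \<le> ennreal K * (\<integral>\<^sup>+z. G \<omega> z \<partial>haar)"
      by (rule law.law_le) measurable
    also have "\<dots> \<le> ennreal K * (\<integral>\<^sup>+s. ennreal (norm (wave_field s y)) \<partial>haar)"
      unfolding G_def by (intro mult_left_mono mean_sup_walk_power) (use M_ge in simp_all)
    finally show "(\<integral>\<^sup>+z. G \<omega> z \<partial>\<nu>) \<le> ennreal K * (\<integral>\<^sup>+s. ennreal (norm (wave_field s y)) \<partial>haar)" .
  qed
  also have "\<dots> = (\<integral>\<^sup>+\<omega>. ennreal K * (\<integral>\<^sup>+s. ennreal (?c \<omega> s) \<partial>haar) \<partial>P)"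
    by (intro nn_integral_cong arg_cong2[where f = times] nn_integral_haar_cong refl) (simp only: c(6))
  also have "\<dots> = ennreal K * (\<integral>\<^sup>+\<omega>. (\<integral>\<^sup>+s. ennreal (?c \<omega> s) \<partial>haar) \<partial>P)"
    by (rule nn_integral_cmult) measurable
  also have "(\<integral>\<^sup>+\<omega>. (\<integral>\<^sup>+s. ennreal (?c \<omega> s) \<partial>haar) \<partial>P)
    = (\<integral>\<^sup>+s. (\<integral>\<^sup>+\<omega>. ennreal (?c \<omega> s) \<partial>P) \<partial>haar)"
    by (rule Ph.Fubini'[symmetric]) measurable
  also have "ennreal K * \<dots> \<le> ennreal K * (\<integral>\<^sup>+s. ennreal (K / q\<^sup>2 * q ^ Suc k) \<partial>haar)"
  proof (intro mult_left_mono nn_integral_mono_AE)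
    show "AE s in haar. (\<integral>\<^sup>+\<omega>. ennreal (?c \<omega> s) \<partial>P)
      \<le> ennreal (K / q\<^sup>2 * q ^ Suc k)"
      using AE_haar_norm by eventually_elim (rule expected_cascade_le[OF c(1) _ c(2-4)])
  qed simp
  also have "\<dots> = ennreal (K\<^sup>2 / q\<^sup>2 * q ^ Suc k)"
    using law.K_ge_1 haar.emeasure_space_1 by (simp add: ennreal_mult'[symmetric] power2_eq_square mult.assoc)
  also have "\<dots> \<le> ennreal (K\<^sup>2 / q\<^sup>2 * q ^ nat \<bar>snd y - n0\<bar>)"
    using q_bounds(1,2) c(5) by (intro ennreal_leI mult_left_mono power_decreasing) auto
  finally show ?thesis .
qed

lemma expected_sup:
  "(\<integral>\<^sup>+\<omega>. (SUP n. ennreal (norm ((phase_walk r (phases \<omega>) ^^ n) (ket Up n0) y))) \<partial>P)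
    \<le> ennreal (K\<^sup>2 / q\<^sup>2 * q ^ nat \<bar>snd y - n0\<bar>)"
proof -
  let ?g = "\<lambda>n \<omega>. ennreal (norm ((phase_walk r (phases \<omega>) ^^ n) (ket Up n0) y))"
  have [measurable]: "?g n \<in> borel_measurable P" for n
    using measurable_phase_walk_power[OF measurable_phases] by measurable
  have "(SUP n. ?g n \<omega>) = (SUP N. SUP n\<in>{..N}. ?g n \<omega>)" for \<omega>
    by (intro antisym SUP_least) (auto intro: SUP_upper SUP_upper2)
  then have "(\<integral>\<^sup>+\<omega>. (SUP n. ?g n \<omega>) \<partial>P) = (\<integral>\<^sup>+\<omega>. (SUP N. SUP n\<in>{..N}. ?g n \<omega>) \<partial>P)"
    by simp
  also have "\<dots> = (SUP N. \<integral>\<^sup>+\<omega>. (SUP n\<in>{..N}. ?g n \<omega>) \<partial>P)"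
    by (rule nn_integral_monotone_convergence_SUP)
      (auto intro!: incseq_SucI le_funI SUP_subset_mono)
  also have "\<dots> \<le> ennreal (K\<^sup>2 / q\<^sup>2 * q ^ nat \<bar>snd y - n0\<bar>)"
    by (intro SUP_least expected_sup_finite)
  finally show ?thesis .
qed

end

section \<open>From expectations to almost sure bounds\<close>

lemma AE_geometric_bound:
  fixes S :: "'b \<Rightarrow> 'a \<Rightarrow> ennreal" and D :: "nat \<Rightarrow> 'b set" and C q :: real
  assumes D: "\<And>j. finite (D j)" "\<And>j. card (D j) \<le> c" and C: "0 \<le> C"
    and S [measurable]: "\<And>b. S b \<in> borel_measurable M"
    and le: "\<And>j b. b \<in> D j \<Longrightarrow> (\<integral>\<^sup>+x. S b x \<partial>M) \<le> ennreal (C * q ^ j)"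
    and q: "0 < q" "q < 1"
  shows "AE x in M. \<exists>C'::real. \<forall>j. \<forall>b\<in>D j. S b x \<le> ennreal (C' * sqrt q ^ j)"
proof -
  \<comment> \<open>The decay q^j is split as p^j p^j: one factor makes the expectations of the
    \<open>f j\<close> summable over j, the other survives in the almost sure bound.\<close>
  define p where "p = sqrt q"
  have p: "0 < p" "p < 1" "p * p = q" using q by (auto simp: p_def)
  define f where "f j x = (\<Sum>b\<in>D j. S b x * ennreal (1 / p ^ j))" for j x
  have [measurable]: "f j \<in> borel_measurable M" for j unfolding f_def[abs_def] by measurable
  have f: "(\<integral>\<^sup>+x. f j x \<partial>M) \<le> ennreal (c * C * p ^ j)" for j
  proof -
    have "(\<integral>\<^sup>+x. f j x \<partial>M) = (\<Sum>b\<in>D j. (\<integral>\<^sup>+x. S b x \<partial>M) * ennreal (1 / p ^ j))"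
      unfolding f_def by (simp add: nn_integral_sum nn_integral_multc)
    also have "\<dots> \<le> (\<Sum>b\<in>D j. ennreal (C * q ^ j) * ennreal (1 / p ^ j))"
      by (intro sum_mono mult_right_mono le) auto
    also have "\<dots> = of_nat (card (D j)) * ennreal (C * p ^ j)"
    proof -
      have "C * q ^ j * (1 / p ^ j) = C * p ^ j"
        unfolding p(3)[symmetric] power_mult_distrib using p by simp
      then show ?thesis using C q by (simp add: ennreal_mult'[symmetric])
    qed
    also have "\<dots> \<le> of_nat c * ennreal (C * p ^ j)" by (intro mult_right_mono of_nat_mono D) simp
    also have "\<dots> = ennreal (c * C * p ^ j)"
      using C p by (simp add: ennreal_of_nat_eq_real_of_nat ennreal_mult'[symmetric] mult.assoc)
    finally show ?thesis .
  qed
  have "(\<integral>\<^sup>+x. (\<Sum>j. f j x) \<partial>M) = (\<Sum>j. \<integral>\<^sup>+x. f j x \<partial>M)"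
    by (rule nn_integral_suminf) measurable
  also have "\<dots> \<le> (\<Sum>j. ennreal (c * C * p ^ j))" by (intro suminf_le f) auto
  also have "\<dots> = ennreal (\<Sum>j. c * C * p ^ j)"
    using C p by (intro suminf_ennreal2) (auto intro!: summable_mult summable_geometric)
  finally have "(\<integral>\<^sup>+x. (\<Sum>j. f j x) \<partial>M) \<noteq> \<infinity>" by (auto simp: top_unique)
  then have "AE x in M. (\<Sum>j. f j x) \<noteq> \<infinity>" by (intro nn_integral_noteq_infinite) measurable
  then show ?thesis
  proof eventually_elim
    fix x assume fin: "(\<Sum>j. f j x) \<noteq> \<infinity>"
    define C' where "C' = enn2real (\<Sum>j. f j x)"
    have C': "(\<Sum>j. f j x) = ennreal C'" using fin by (simp add: C'_def less_top)
    have "S b x \<le> ennreal (C' * p ^ j)" if b: "b \<in> D j" for j b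
    proof -
      have "S b x * ennreal (1 / p ^ j) \<le> f j x"
        unfolding f_def using b D by (intro member_le_sum) auto
      also have "\<dots> \<le> (\<Sum>j. f j x)"
        using sum_le_suminf[of "\<lambda>j. f j x" "{j}"] by (simp add: summableI)
      finally have "S b x * ennreal (1 / p ^ j) * ennreal (p ^ j) \<le> ennreal C' * ennreal (p ^ j)"
        unfolding C' by (rule mult_right_mono) simp
      moreover have "ennreal (1 / p ^ j) * ennreal (p ^ j) = 1"
        using p by (simp add: ennreal_mult'[symmetric])
      ultimately show ?thesis using p by (simp add: mult.assoc ennreal_mult'')
    qed
    then show "\<exists>C'::real. \<forall>j. \<forall>b\<in>D j. S b x \<le> ennreal (C' * sqrt q ^ j)"
      unfolding p_def by blast
  qed
qed

context random_phases
begin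

text \<open>The random constant depends on the source in the first clause and on the target in the
  second. Inverse powers exchange source and target, so positive and negative times draw on
  different clauses.\<close>

definition localized :: "(int \<Rightarrow> circle) \<Rightarrow> bool" where
  "localized \<omega> \<longleftrightarrow>
    (\<forall>n0. \<exists>C. \<forall>y n. norm ((phase_walk r (phases \<omega>) ^^ n) (ket Up n0) y) \<le> C * sqrt q ^ nat \<bar>snd y - n0\<bar>) \<and>
    (\<forall>\<sigma> m. \<exists>C. \<forall>n0 n. norm ((phase_walk r (phases \<omega>) ^^ n) (ket Up n0) (\<sigma>, m)) \<le> C * sqrt q ^ nat \<bar>m - n0\<bar>)"

lemma localization_AE:
  "AE \<omega> in P. localized \<omega>"
proof -
  define S where "S n0 y \<omega> = (SUP n. ennreal (norm ((phase_walk r (phases \<omega>) ^^ n) (ket Up n0) y)))" for n0 y \<omega>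
  have [measurable]: "S n0 y \<in> borel_measurable P" for n0 y
  proof -
    have [measurable]: "(\<lambda>\<omega>. (phase_walk r (phases \<omega>) ^^ n) (ket Up n0) y) \<in> borel_measurable P" for n
      by (rule measurable_phase_walk_power[OF measurable_phases])
    show ?thesis unfolding S_def[abs_def] by measurable
  qed
  have S: "(\<integral>\<^sup>+\<omega>. S n0 y \<omega> \<partial>P) \<le> ennreal (K\<^sup>2 / q\<^sup>2 * q ^ nat \<bar>snd y - n0\<bar>)" for n0 y
    unfolding S_def by (rule expected_sup)
  have K: "0 \<le> K\<^sup>2 / q\<^sup>2" by simp
  have norm_le: "norm ((phase_walk r (phases \<omega>) ^^ n) (ket Up n0) y) \<le> max C 0 * sqrt q ^ j"
    if "S n0 y \<omega> \<le> ennreal (C * sqrt q ^ j)" for n0 y \<omega> C j n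
  proof -
    have "ennreal (norm ((phase_walk r (phases \<omega>) ^^ n) (ket Up n0) y)) \<le> S n0 y \<omega>"
      unfolding S_def by (rule SUP_upper) simp
    also have "\<dots> \<le> ennreal (C * sqrt q ^ j)" by (rule that)
    also have "\<dots> \<le> ennreal (max C 0 * sqrt q ^ j)"
      using q_bounds by (intro ennreal_leI mult_right_mono) auto
    finally show ?thesis using q_bounds by (subst (asm) ennreal_le_iff) auto
  qed
  have 1: "AE \<omega> in P. \<forall>n0. \<exists>C. \<forall>j. \<forall>y\<in>{y. nat \<bar>snd y - n0\<bar> = j}. S n0 y \<omega> \<le> ennreal (C * sqrt q ^ j)"
    unfolding AE_all_countable
  proof (intro allI AE_geometric_bound[OF _ _ K])
    fix n0 :: int and j :: nat
    let ?A = "{Up, Down} \<times> {n0 + int j, n0 - int j}"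
    have sub: "{y. nat \<bar>snd y - n0\<bar> = j} \<subseteq> ?A"
    proof
      fix y :: "spin \<times> int" assume "y \<in> {y. nat \<bar>snd y - n0\<bar> = j}"
      then have "snd y \<in> {n0 + int j, n0 - int j}" by auto
      moreover have "fst y \<in> {Up, Down}" by (cases "fst y") auto
      ultimately show "y \<in> ?A" by (cases y) auto
    qed
    then show "finite {y::spin \<times> int. nat \<bar>snd y - n0\<bar> = j}" by (rule finite_subset) simp
    have "card {y::spin \<times> int. nat \<bar>snd y - n0\<bar> = j} \<le> card ?A" by (rule card_mono[OF _ sub]) simp
    also have "\<dots> \<le> 2 * 2"
      unfolding card_cartesian_product by (intro mult_mono) (auto simp: card_insert_if)
    finally show "card {y::spin \<times> int. nat \<bar>snd y - n0\<bar> = j} \<le> 4" by simp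
  qed (use S q_bounds in auto)
  have 2: "AE \<omega> in P. \<forall>m. \<exists>C. \<forall>j. \<forall>n0\<in>{n0. nat \<bar>m - n0\<bar> = j}. S n0 (\<sigma>, m) \<omega> \<le> ennreal (C * sqrt q ^ j)" for \<sigma>
    unfolding AE_all_countable
  proof (intro allI AE_geometric_bound[OF _ _ K])
    fix m :: int and j :: nat
    have sub: "{n0. nat \<bar>m - n0\<bar> = j} \<subseteq> {m + int j, m - int j}" by auto
    then show "finite {n0. nat \<bar>m - n0\<bar> = j}" by (rule finite_subset) simp
    have "card {n0. nat \<bar>m - n0\<bar> = j} \<le> card {m + int j, m - int j}" by (rule card_mono[OF _ sub]) simp
    also have "\<dots> \<le> 2" by (simp add: card_insert_if)
    finally show "card {n0. nat \<bar>m - n0\<bar> = j} \<le> 2" .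
  next
    show "(\<integral>\<^sup>+\<omega>. S b (\<sigma>, m) \<omega> \<partial>P) \<le> ennreal (K\<^sup>2 / q\<^sup>2 * q ^ j)" if "b \<in> {n0. nat \<bar>m - n0\<bar> = j}" for m j b
      using S[of b "(\<sigma>, m)"] that by simp
  qed (use q_bounds in auto)
  from 1 2[of Up] 2[of Down] show ?thesis
  proof eventually_elim
    fix \<omega>
    assume 1: "\<forall>n0. \<exists>C. \<forall>j. \<forall>y\<in>{y. nat \<bar>snd y - n0\<bar> = j}. S n0 y \<omega> \<le> ennreal (C * sqrt q ^ j)"
      and U: "\<forall>m. \<exists>C. \<forall>j. \<forall>n0\<in>{n0. nat \<bar>m - n0\<bar> = j}. S n0 (Up, m) \<omega> \<le> ennreal (C * sqrt q ^ j)"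
      and D: "\<forall>m. \<exists>C. \<forall>j. \<forall>n0\<in>{n0. nat \<bar>m - n0\<bar> = j}. S n0 (Down, m) \<omega> \<le> ennreal (C * sqrt q ^ j)"
    have A: "\<exists>C. \<forall>y n. norm ((phase_walk r (phases \<omega>) ^^ n) (ket Up n0) y) \<le> C * sqrt q ^ nat \<bar>snd y - n0\<bar>" for n0
    proof -
      from 1 obtain C where "\<forall>j. \<forall>y\<in>{y. nat \<bar>snd y - n0\<bar> = j}. S n0 y \<omega> \<le> ennreal (C * sqrt q ^ j)" by blast
      then have "S n0 y \<omega> \<le> ennreal (C * sqrt q ^ nat \<bar>snd y - n0\<bar>)" for y by (cases y) simp
      then show ?thesis by (intro exI[of _ "max C 0"] allI norm_le)
    qed
    have B: "\<exists>C. \<forall>n0 n. norm ((phase_walk r (phases \<omega>) ^^ n) (ket Up n0) (\<sigma>, m)) \<le> C * sqrt q ^ nat \<bar>m - n0\<bar>" for \<sigma> m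
    proof -
      have "\<exists>C. \<forall>j. \<forall>n0\<in>{n0. nat \<bar>m - n0\<bar> = j}. S n0 (\<sigma>, m) \<omega> \<le> ennreal (C * sqrt q ^ j)"
        using U D by (cases \<sigma>) auto
      then obtain C where "\<forall>j. \<forall>n0\<in>{n0. nat \<bar>m - n0\<bar> = j}. S n0 (\<sigma>, m) \<omega> \<le> ennreal (C * sqrt q ^ j)" by blast
      then have "S n0 (\<sigma>, m) \<omega> \<le> ennreal (C * sqrt q ^ nat \<bar>m - n0\<bar>)" for n0 by simp
      then show ?thesis by (intro exI[of _ "max C 0"] allI norm_le)
    qed
    from A B show "localized \<omega>" unfolding localized_def by blast
  qed
qed

end

section \<open>Moments of the position\<close>

lemma power_nat_abs_shift:
  fixes p :: real
  assumes p: "0 < p" "p < 1" and "\<bar>a\<bar> \<le> \<bar>b\<bar> + int i"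
  shows "p ^ nat \<bar>b\<bar> \<le> (1 / p ^ i) * p ^ nat \<bar>a\<bar>"
proof -
  have "p ^ (nat \<bar>b\<bar> + i) \<le> p ^ nat \<bar>a\<bar>" using assms by (intro power_decreasing) auto
  then show ?thesis using p by (simp add: power_add field_simps)
qed

lemma walk_funpow_linear:
  "(walk r t \<omega> ^^ n) (\<lambda>x. a * \<phi> x + b * \<psi> x) =
    (\<lambda>x. a * (walk r t \<omega> ^^ n) \<phi> x + b * (walk r t \<omega> ^^ n) \<psi> x)"
proof (induction n)
  case (Suc n)
  have "walk r t \<omega> (\<lambda>x. a * \<phi> x + b * \<psi> x) = (\<lambda>x. a * walk r t \<omega> \<phi> x + b * walk r t \<omega> \<psi> x)" for \<phi> \<psi>
  proof
    fix y :: "spin \<times> int"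
    obtain \<sigma> m where "y = (\<sigma>, m)" by (cases y)
    then show "walk r t \<omega> (\<lambda>x. a * \<phi> x + b * \<psi> x) y = a * walk r t \<omega> \<phi> y + b * walk r t \<omega> \<psi> y"
      by (cases \<sigma>) (auto simp: algebra_simps)
  qed
  then show ?case using Suc by simp
qed simp

text \<open>The image of \<open>ket Up (m + 1)\<close> is a combination of \<open>ket Up (m + 2)\<close> and \<open>ket Down m\<close>, which
  reduces a spin down source to spin up sources.\<close>

lemma norm_walk_ket_Down_le:
  assumes r: "0 < r" and t: "\<bar>t\<bar> \<le> 1"
  shows "norm ((walk r t \<omega> ^^ n) (ket Down m) y) \<le>
    (1 / r) * (norm ((walk r t \<omega> ^^ Suc n) (ket Up (m + 1)) y) + norm ((walk r t \<omega> ^^ n) (ket Up (m + 2)) y))"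
proof -
  define a b where "a = circle_phase (\<omega> (2 * (m + 1))) * t" and "b = circle_phase (\<omega> (2 * (m + 1) + 1)) * r"
  have "walk r t \<omega> (ket Up (m + 1)) = (\<lambda>x. a * ket Up (m + 2) x + b * ket Down m x)"
    unfolding walk_ket_Up a_def b_def by (simp add: add.commute)
  then have "(walk r t \<omega> ^^ Suc n) (ket Up (m + 1)) y
      = a * (walk r t \<omega> ^^ n) (ket Up (m + 2)) y + b * (walk r t \<omega> ^^ n) (ket Down m) y"
    by (simp only: funpow_Suc_right o_apply walk_funpow_linear)
  then have "b * (walk r t \<omega> ^^ n) (ket Down m) y
      = (walk r t \<omega> ^^ Suc n) (ket Up (m + 1)) y - a * (walk r t \<omega> ^^ n) (ket Up (m + 2)) y"
    by (simp only: add_diff_cancel_left')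
  then have "norm b * norm ((walk r t \<omega> ^^ n) (ket Down m) y)
      \<le> norm ((walk r t \<omega> ^^ Suc n) (ket Up (m + 1)) y) + norm (a * (walk r t \<omega> ^^ n) (ket Up (m + 2)) y)"
    by (metis norm_mult norm_triangle_ineq4)
  also have "norm (a * (walk r t \<omega> ^^ n) (ket Up (m + 2)) y) \<le> 1 * norm ((walk r t \<omega> ^^ n) (ket Up (m + 2)) y)"
    unfolding norm_mult using t by (intro mult_right_mono) (auto simp: a_def norm_mult)
  finally show ?thesis using r by (simp add: b_def norm_mult field_simps del: funpow.simps)
qed

lemma l2_inner_ket_right: "l2_inner \<phi> (ket \<sigma> k) = cnj (\<phi> (\<sigma>, k))"
proof -
  have "(\<Sum>\<^sub>\<infinity>x. cnj (\<phi> x) * ket \<sigma> k x) = (\<Sum>\<^sub>\<infinity>x\<in>{(\<sigma>, k)}. cnj (\<phi> x) * ket \<sigma> k x)"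
    by (rule infsum_cong_neutral) (auto simp: ket_def)
  then show ?thesis by (simp add: l2_inner_def ket_def)
qed

lemma walk_power_duality:
  assumes "r\<^sup>2 + t\<^sup>2 = 1"
  shows "walk_power r t \<omega> n (ket \<sigma> k) (\<sigma>', k') = cnj (walk_power r t \<omega> (- n) (ket \<sigma>' k') (\<sigma>, k))"
  using l2_inner_walk_power[OF assms ket_l2 ket_l2, of \<sigma>' k' \<omega> "- n" \<sigma> k]
  by (simp add: l2_inner_ket l2_inner_ket_right)

lemma position_moment_eq_sum:
  assumes rt: "r\<^sup>2 + t\<^sup>2 = 1" and \<psi>: "finite_support \<psi>"
  shows "position_moment r t \<omega> L \<psi> n =
    (\<Sum>x | walk_power r t \<omega> n \<psi> x \<noteq> 0. \<bar>of_int (snd x)\<bar> powr L * (norm (walk_power r t \<omega> n \<psi> x))\<^sup>2)"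
proof -
  let ?\<phi> = "walk_power r t \<omega> n \<psi>"
  have "l2_inner \<psi> (walk_power r t \<omega> (- n) (abs_position_powr L ?\<phi>)) = l2_inner ?\<phi> (abs_position_powr L ?\<phi>)"
    by (intro l2_inner_walk_power rt finite_support_l2 finite_support_abs_position_powr
        finite_support_walk_power \<psi>)
  also have "\<dots> = (\<Sum>\<^sub>\<infinity>x\<in>{x. ?\<phi> x \<noteq> 0}. of_real (\<bar>of_int (snd x)\<bar> powr L * (norm (?\<phi> x))\<^sup>2))"
    unfolding l2_inner_def
  proof (rule infsum_cong_neutral)
    fix x :: "spin \<times> int"
    show "cnj (?\<phi> x) * abs_position_powr L ?\<phi> x = of_real (\<bar>of_int (snd x)\<bar> powr L * (norm (?\<phi> x))\<^sup>2)"
      using complex_norm_square[of "?\<phi> x"] by (cases x) (simp add: abs_position_powr_def mult_ac)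
  qed auto
  also have "\<dots> = of_real (\<Sum>x | ?\<phi> x \<noteq> 0. \<bar>of_int (snd x)\<bar> powr L * (norm (?\<phi> x))\<^sup>2)"
    using finite_support_walk_power[OF rt \<psi>, of \<omega> n] by (simp add: finite_support_iff)
  finally show ?thesis unfolding position_moment_def by simp
qed

text \<open>The constant comes from x <= exp x at x = c k / L with c = - ln p, raised to the power
  L.\<close>

lemma powr_times_geometric_bounded:
  assumes p: "0 < p" "p < 1" and L: "0 < L"
  shows "real k powr L * p ^ k \<le> (L / - ln p) powr L"
proof -
  define c where "c = - ln p"
  have c: "0 < c" using p by (simp add: c_def)
  have "c * k / L \<le> exp (c * k / L)" using exp_ge_add_one_self[of "c * k / L"] by linarith
  then have "real k \<le> (L / c) * exp (c * k / L)" using c L by (simp add: field_simps)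
  then have "real k powr L \<le> ((L / c) * exp (c * k / L)) powr L" using L by (intro powr_mono2) auto
  also have "\<dots> = (L / c) powr L * exp (c * k)"
  proof -
    have "exp (c * k / L) powr L = exp (c * k)" using L by (simp add: powr_def)
    moreover have "((L / c) * exp (c * k / L)) powr L = (L / c) powr L * exp (c * k / L) powr L"
      by (rule powr_mult)
    ultimately show ?thesis by simp
  qed
  finally have "real k powr L * p ^ k \<le> (L / c) powr L * exp (c * k) * p ^ k"
    using p by (intro mult_right_mono) auto
  also have "\<dots> = (L / c) powr L"
  proof -
    have "p ^ k = exp (k * ln p)" using p by (simp add: exp_of_nat_mult)
    then have "exp (c * k) * p ^ k = 1" by (simp add: c_def exp_add[symmetric] mult.commute)
    then show ?thesis by (simp only: mult.assoc mult_1_right)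
  qed
  finally show ?thesis unfolding c_def .
qed

text \<open>Two spins and two signs of the position give four geometric series, with position 0
  counted twice.\<close>

lemma sum_geometric_abs_le:
  fixes p :: real
  assumes p: "0 < p" "p < 1" and F: "finite (F :: (spin \<times> int) set)"
  shows "(\<Sum>x\<in>F. p ^ nat \<bar>snd x\<bar>) \<le> 4 / (1 - p)"
proof -
  define A where "A = ({Up, Down} \<times> {True, False}) \<times> {..Max ((\<lambda>x. nat \<bar>snd x\<bar>) ` F)}"
  let ?h = "\<lambda>((\<sigma>, b), j). (\<sigma>, if b then int j else - int j)"
  have sub: "F \<subseteq> ?h ` A"
  proof
    fix x assume x: "x \<in> F"
    obtain \<sigma> m where xm: "x = (\<sigma>, m)" by (cases x)
    have "nat \<bar>m\<bar> \<le> Max ((\<lambda>x. nat \<bar>snd x\<bar>) ` F)" using F x xm by (intro Max_ge) force+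
    moreover have "\<sigma> \<in> {Up, Down}" by (cases \<sigma>) auto
    ultimately have A: "((\<sigma>, 0 \<le> m), nat \<bar>m\<bar>) \<in> A" by (auto simp: A_def)
    have h: "x = ?h ((\<sigma>, 0 \<le> m), nat \<bar>m\<bar>)" by (auto simp: xm)
    show "x \<in> ?h ` A" by (rule image_eqI[where f = ?h, OF h A])
  qed
  have "(\<Sum>x\<in>F. p ^ nat \<bar>snd x\<bar>) \<le> (\<Sum>x\<in>?h ` A. p ^ nat \<bar>snd x\<bar>)"
    using p by (intro sum_mono2 sub) (auto simp: A_def)
  also have "\<dots> \<le> (\<Sum>a\<in>A. p ^ nat \<bar>snd (?h a)\<bar>)"
    using p sum_image_le[of A "\<lambda>x. p ^ nat \<bar>snd x\<bar>" ?h] by (auto simp: A_def)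
  also have "\<dots> = (\<Sum>a\<in>A. p ^ snd a)"
    by (rule sum.cong) (auto split: if_splits)
  also have "\<dots> = (\<Sum>a\<in>{Up, Down} \<times> {True, False}. \<Sum>j\<in>{..Max ((\<lambda>x. nat \<bar>snd x\<bar>) ` F)}. p ^ j)"
    unfolding A_def by (subst sum.cartesian_product) (auto intro!: sum.cong)
  also have "\<dots> \<le> (\<Sum>a\<in>{Up, Down} \<times> {True, False}. 1 / (1 - p))"
  proof (rule sum_mono)
    show "(\<Sum>j\<in>{..m}. p ^ j) \<le> 1 / (1 - p)" for m
      using p sum_le_suminf[of "\<lambda>j. p ^ j" "{..m}"] suminf_geometric[of p] summable_geometric[of p] by simp
  qed
  also have "\<dots> = 4 / (1 - p)" by simp
  finally show ?thesis .
qed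

text \<open>Down sources are reduced to the Up sources at \<open>m + 1\<close> and
  \<open>m + 2\<close>, and negative times to positive ones by duality. A finitely supported state
  then decays exponentially, uniformly in time, and every power of the position is summable against
  it.\<close>

lemma position_moment_bounded:
  assumes r: "0 < r" and rt: "r\<^sup>2 + t\<^sup>2 = 1" and p: "0 < p" "p < 1" and L: "0 < L" and \<Psi>: "finite_support \<Psi>"
    and source: "\<And>n0. \<exists>C. \<forall>y n. norm ((walk r t \<omega> ^^ n) (ket Up n0) y) \<le> C * p ^ nat \<bar>snd y - n0\<bar>"
    and target: "\<And>\<sigma> m. \<exists>C. \<forall>n0 n. norm ((walk r t \<omega> ^^ n) (ket Up n0) (\<sigma>, m)) \<le> C * p ^ nat \<bar>m - n0\<bar>"
  shows "\<exists>B. \<forall>n. position_moment r t \<omega> L \<Psi> n \<le> B"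
proof -
  have t1: "\<bar>t\<bar> \<le> 1" using rt_le_one[OF rt] by simp
  have shift: "(1 / r) * (x + y) \<le> (1 / r) * (\<bar>C\<bar> / p + \<bar>C'\<bar> / p\<^sup>2) * p ^ nat \<bar>k - m\<bar>"
    if "x \<le> C * p ^ nat \<bar>k - (m + 1)\<bar>" "y \<le> C' * p ^ nat \<bar>k - (m + 2)\<bar>" for x y C C' k m
  proof -
    have "x \<le> \<bar>C\<bar> * p ^ nat \<bar>k - (m + 1)\<bar>" using p by (intro order_trans[OF that(1)] mult_right_mono) auto
    also have "\<dots> \<le> \<bar>C\<bar> * (1 / p ^ 1 * p ^ nat \<bar>k - m\<bar>)"
      by (intro mult_left_mono power_nat_abs_shift p) auto
    finally have 1: "x \<le> \<bar>C\<bar> / p * p ^ nat \<bar>k - m\<bar>" by simp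
    have "y \<le> \<bar>C'\<bar> * p ^ nat \<bar>k - (m + 2)\<bar>" using p by (intro order_trans[OF that(2)] mult_right_mono) auto
    also have "\<dots> \<le> \<bar>C'\<bar> * (1 / p ^ 2 * p ^ nat \<bar>k - m\<bar>)"
      by (intro mult_left_mono power_nat_abs_shift p) auto
    finally have 2: "y \<le> \<bar>C'\<bar> / p\<^sup>2 * p ^ nat \<bar>k - m\<bar>" by simp
    from 1 2 have "x + y \<le> (\<bar>C\<bar> / p + \<bar>C'\<bar> / p\<^sup>2) * p ^ nat \<bar>k - m\<bar>" by (simp add: distrib_right)
    then show ?thesis using r by (simp add: divide_right_mono)
  qed
  have source': "\<exists>C. \<forall>y n. norm ((walk r t \<omega> ^^ n) (ket \<sigma> m) y) \<le> C * p ^ nat \<bar>snd y - m\<bar>" for \<sigma> m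
  proof (cases \<sigma>)
    case Up then show ?thesis using source by simp
  next
    case Down
    obtain C where C: "\<And>y n. norm ((walk r t \<omega> ^^ n) (ket Up (m + 1)) y) \<le> C * p ^ nat \<bar>snd y - (m + 1)\<bar>"
      using source[of "m + 1"] by blast
    obtain C' where C': "\<And>y n. norm ((walk r t \<omega> ^^ n) (ket Up (m + 2)) y) \<le> C' * p ^ nat \<bar>snd y - (m + 2)\<bar>"
      using source[of "m + 2"] by blast
    have "norm ((walk r t \<omega> ^^ n) (ket Down m) y) \<le> (1 / r) * (\<bar>C\<bar> / p + \<bar>C'\<bar> / p\<^sup>2) * p ^ nat \<bar>snd y - m\<bar>" for y n
      by (intro order_trans[OF norm_walk_ket_Down_le[OF r t1] shift] C C')
    then show ?thesis unfolding Down by blast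
  qed
  have target': "\<exists>C. \<forall>\<sigma> m n. norm ((walk r t \<omega> ^^ n) (ket \<sigma> m) (\<sigma>', k)) \<le> C * p ^ nat \<bar>k - m\<bar>" for \<sigma>' k
  proof -
    obtain C where C: "\<And>m n. norm ((walk r t \<omega> ^^ n) (ket Up m) (\<sigma>', k)) \<le> C * p ^ nat \<bar>k - m\<bar>"
      using target[of \<sigma>' k] by blast
    define C' where "C' = max C ((1 / r) * (\<bar>C\<bar> / p + \<bar>C\<bar> / p\<^sup>2))"
    have U: "norm ((walk r t \<omega> ^^ n) (ket Up m) (\<sigma>', k)) \<le> C' * p ^ nat \<bar>k - m\<bar>" for m n
      using p by (intro order_trans[OF C] mult_right_mono) (auto simp: C'_def)
    have D: "norm ((walk r t \<omega> ^^ n) (ket Down m) (\<sigma>', k)) \<le> C' * p ^ nat \<bar>k - m\<bar>" for m n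
    proof -
      have "norm ((walk r t \<omega> ^^ n) (ket Down m) (\<sigma>', k)) \<le> (1 / r) * (\<bar>C\<bar> / p + \<bar>C\<bar> / p\<^sup>2) * p ^ nat \<bar>k - m\<bar>"
        by (intro order_trans[OF norm_walk_ket_Down_le[OF r t1] shift] C)
      also have "\<dots> \<le> C' * p ^ nat \<bar>k - m\<bar>" using p by (intro mult_right_mono) (auto simp: C'_def)
      finally show ?thesis .
    qed
    have "norm ((walk r t \<omega> ^^ n) (ket \<sigma> m) (\<sigma>', k)) \<le> C' * p ^ nat \<bar>k - m\<bar>" for \<sigma> m n
      using U D by (cases \<sigma>) auto
    then show ?thesis by blast
  qed
  \<comment> \<open>With the target fixed, nonnegative times use \<open>target'\<close>; for
    negative times \<open>walk_power_duality\<close> makes the target a source, and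
    \<open>source'\<close> applies.\<close>
  have dual: "\<exists>C\<ge>0. \<forall>\<sigma> m n. norm (walk_power r t \<omega> n (ket \<sigma> m) (\<sigma>', k)) \<le> C * p ^ nat \<bar>m - k\<bar>" for \<sigma>' k
  proof -
    obtain C where C: "\<And>\<sigma> m n. norm ((walk r t \<omega> ^^ n) (ket \<sigma> m) (\<sigma>', k)) \<le> C * p ^ nat \<bar>k - m\<bar>"
      using target'[of \<sigma>' k] by blast
    obtain C' where C': "\<And>y n. norm ((walk r t \<omega> ^^ n) (ket \<sigma>' k) y) \<le> C' * p ^ nat \<bar>snd y - k\<bar>"
      using source'[of \<sigma>' k] by blast
    define C'' where "C'' = max 0 (max C C')"
    have "norm (walk_power r t \<omega> n (ket \<sigma> m) (\<sigma>', k)) \<le> C'' * p ^ nat \<bar>m - k\<bar>" for \<sigma> m n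
    proof (cases "n \<ge> 0")
      case True
      then have "norm (walk_power r t \<omega> n (ket \<sigma> m) (\<sigma>', k)) \<le> C * p ^ nat \<bar>m - k\<bar>"
        using C[of "nat n" \<sigma> m] by (simp add: walk_power_def abs_minus_commute)
      also have "\<dots> \<le> C'' * p ^ nat \<bar>m - k\<bar>" using p by (intro mult_right_mono) (auto simp: C''_def)
      finally show ?thesis .
    next
      case False
      then have "norm (walk_power r t \<omega> n (ket \<sigma> m) (\<sigma>', k)) \<le> C' * p ^ nat \<bar>m - k\<bar>"
        unfolding walk_power_duality[OF rt, of \<omega> n] complex_mod_cnj
        using C'[of "nat (- n)" "(\<sigma>, m)"] by (simp add: walk_power_def)
      also have "\<dots> \<le> C'' * p ^ nat \<bar>m - k\<bar>" using p by (intro mult_right_mono) (auto simp: C''_def)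
      finally show ?thesis .
    qed
    then show ?thesis by (intro exI[of _ C'']) (auto simp: C''_def)
  qed
  then obtain c where c0: "\<And>x. 0 \<le> c x"
    and c: "\<And>x \<sigma> m n. norm (walk_power r t \<omega> n (ket \<sigma> m) x) \<le> c x * p ^ nat \<bar>m - snd x\<bar>"
  proof -
    have "\<forall>x. \<exists>C\<ge>0. \<forall>\<sigma> m n. norm (walk_power r t \<omega> n (ket \<sigma> m) x) \<le> C * p ^ nat \<bar>m - snd x\<bar>"
      using dual by auto
    then show thesis using that by metis
  qed
  define F where "F = {x. \<Psi> x \<noteq> 0}"
  have F: "finite F" using \<Psi> by (simp add: F_def finite_support_iff)
  define C where "C = (\<Sum>x\<in>F. c x * (1 / p ^ nat \<bar>snd x\<bar>) * norm (\<Psi> x))"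
  have \<Psi>_bound: "norm (walk_power r t \<omega> n \<Psi> y) \<le> C * p ^ nat \<bar>snd y\<bar>" for n y
  proof -
    obtain \<sigma> m where y: "y = (\<sigma>, m)" by (cases y)
    \<comment> \<open>Moving the power onto the basis vector at \<open>y\<close> leaves a finite sum
      over the support of \<open>\<Psi>\<close>, whose points are now the targets of
      \<open>dual\<close>.\<close>
    have "walk_power r t \<omega> n \<Psi> y = l2_inner (ket \<sigma> m) (walk_power r t \<omega> (- (- n)) \<Psi>)"
      by (simp add: l2_inner_ket y)
    also have "\<dots> = l2_inner (walk_power r t \<omega> (- n) (ket \<sigma> m)) \<Psi>"
      by (rule l2_inner_walk_power[OF rt ket_l2 finite_support_l2[OF \<Psi>]])
    also have "\<dots> = (\<Sum>\<^sub>\<infinity>x\<in>F. cnj (walk_power r t \<omega> (- n) (ket \<sigma> m) x) * \<Psi> x)"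
      unfolding l2_inner_def by (rule infsum_cong_neutral) (auto simp: F_def)
    also have "\<dots> = (\<Sum>x\<in>F. cnj (walk_power r t \<omega> (- n) (ket \<sigma> m) x) * \<Psi> x)"
      using F by simp
    finally have "norm (walk_power r t \<omega> n \<Psi> y) \<le> (\<Sum>x\<in>F. norm (walk_power r t \<omega> (- n) (ket \<sigma> m) x) * norm (\<Psi> x))"
      by (metis (no_types, lifting) complex_mod_cnj norm_mult norm_sum sum.cong)
    also have "\<dots> \<le> (\<Sum>x\<in>F. c x * (1 / p ^ nat \<bar>snd x\<bar> * p ^ nat \<bar>m\<bar>) * norm (\<Psi> x))"
    proof (intro sum_mono mult_right_mono)
      fix x :: "spin \<times> int"
      have "p ^ nat \<bar>m - snd x\<bar> \<le> 1 / p ^ nat \<bar>snd x\<bar> * p ^ nat \<bar>m\<bar>"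
        by (rule power_nat_abs_shift[OF p]) auto
      then have "c x * p ^ nat \<bar>m - snd x\<bar> \<le> c x * (1 / p ^ nat \<bar>snd x\<bar> * p ^ nat \<bar>m\<bar>)"
        by (intro mult_left_mono c0)
      with c show "norm (walk_power r t \<omega> (- n) (ket \<sigma> m) x) \<le> c x * (1 / p ^ nat \<bar>snd x\<bar> * p ^ nat \<bar>m\<bar>)"
        by (rule order_trans)
    qed simp
    also have "\<dots> = C * p ^ nat \<bar>snd y\<bar>"
      unfolding C_def sum_distrib_right by (rule sum.cong) (auto simp: y)
    finally show ?thesis .
  qed
  define D where "D = (L / - ln p) powr L"
  have "position_moment r t \<omega> L \<Psi> n \<le> C\<^sup>2 * D * (4 / (1 - p))" for n
  proof -
    let ?\<phi> = "walk_power r t \<omega> n \<Psi>"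
    have fin: "finite {x. ?\<phi> x \<noteq> 0}"
      using finite_support_walk_power[OF rt \<Psi>] by (simp add: finite_support_iff)
    have "position_moment r t \<omega> L \<Psi> n \<le> (\<Sum>x | ?\<phi> x \<noteq> 0. C\<^sup>2 * D * p ^ nat \<bar>snd x\<bar>)"
      unfolding position_moment_eq_sum[OF rt \<Psi>]
    proof (rule sum_mono)
      fix x :: "spin \<times> int"
      define k where "k = nat \<bar>snd x\<bar>"
      have k: "\<bar>of_int (snd x)\<bar> = real k" by (simp add: k_def)
      have "(norm (?\<phi> x))\<^sup>2 \<le> (C * p ^ k)\<^sup>2"
        unfolding k_def by (intro power_mono \<Psi>_bound) simp
      then have "real k powr L * (norm (?\<phi> x))\<^sup>2 \<le> real k powr L * (C * p ^ k)\<^sup>2"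
        by (intro mult_left_mono) auto
      \<comment> \<open>One of the two factors \<open>p ^ k\<close> absorbs the power of the
        position, the other makes the sum over positions converge.\<close>
      also have "\<dots> = C\<^sup>2 * (real k powr L * p ^ k) * p ^ k" by (simp add: power2_eq_square)
      also have "\<dots> \<le> C\<^sup>2 * D * p ^ k"
        unfolding D_def using p L by (intro mult_right_mono mult_left_mono powr_times_geometric_bounded) auto
      finally show "\<bar>of_int (snd x)\<bar> powr L * (norm (?\<phi> x))\<^sup>2 \<le> C\<^sup>2 * D * p ^ nat \<bar>snd x\<bar>"
        unfolding k by (simp add: k_def)
    qed
    also have "\<dots> = C\<^sup>2 * D * (\<Sum>x | ?\<phi> x \<noteq> 0. p ^ nat \<bar>snd x\<bar>)" by (simp add: sum_distrib_left)
    also have "\<dots> \<le> C\<^sup>2 * D * (4 / (1 - p))"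
      by (intro mult_left_mono sum_geometric_abs_le p fin) (simp add: D_def)
    finally show ?thesis .
  qed
  then show ?thesis by blast
qed

theorem corollary2p3:
  fixes r t :: real and \<mu> :: "circle measure" and \<tau> :: "circle \<Rightarrow> real"
  assumes "0 < r" "r < 1" "t = sqrt (1 - r\<^sup>2)"
    and "prob_space \<mu>"
    and "\<tau> \<in> borel_measurable circle_lebesgue"
    and "AE x in circle_lebesgue. 0 \<le> \<tau> x"
    and "\<exists>B. AE x in circle_lebesgue. \<bar>\<tau> x\<bar> \<le> B"
    and "\<mu> = density circle_lebesgue (\<lambda>x. ennreal (\<tau> x))"
    and "\<exists>V. open V \<and> V \<noteq> {} \<and> V \<subseteq> measure_support \<mu>"
  shows "\<exists>\<Omega>\<^sub>0 \<in> sets (phase_space \<mu>). emeasure (phase_space \<mu>) \<Omega>\<^sub>0 = 1 \<and>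
    (\<forall>\<omega>\<in>\<Omega>\<^sub>0. \<forall>L>0. \<forall>\<Psi>. finite_support \<Psi> \<longrightarrow>
      (\<exists>C::real. (SUP n::int. ereal (position_moment r t \<omega> L \<Psi> n)) < ereal C))"
proof -
  obtain B where B: "AE x in circle_lebesgue. \<bar>\<tau> x\<bar> \<le> B" using assms(7) by blast
  interpret random_phases \<mu> r "2 * pi * B"
  proof (intro random_phases.intro random_phases_axioms.intro)
    show "sets \<mu> = sets borel" by (simp add: assms(8))
    show "circle_law (distr \<mu> borel circle_phase) (2 * pi * B)"
      by (rule circle_law_density[OF assms(4,5) B assms(8)])
  qed (use assms in auto)
  have rt: "r\<^sup>2 + t\<^sup>2 = 1" using assms(1-3) by (simp add: abs_square_le_1)
  define p where "p = sqrt q"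
  have p: "0 < p" "p < 1" using q_bounds by (auto simp: p_def)
  \<comment> \<open>The exceptional set is fixed before \<open>L\<close> and \<open>\<Psi>\<close>,
    neither of which occurs in \<open>localized\<close>.\<close>
  from localization_AE obtain N where N: "{\<omega> \<in> space P. \<not> localized \<omega>} \<subseteq> N" "emeasure P N = 0" "N \<in> sets P"
    by (rule AE_E)
  have bounded: "\<exists>C::real. (SUP n::int. ereal (position_moment r t \<omega> L \<Psi> n)) < ereal C"
    if "\<omega> \<in> space P - N" "0 < L" "finite_support \<Psi>" for \<omega> L \<Psi>
  proof -
    have "localized \<omega>" using that(1) N(1) by blast
    then have "\<exists>B. \<forall>n. position_moment r t \<omega> L \<Psi> n \<le> B"
      unfolding localized_def p_def[symmetric] walk_eq_phase_walk[symmetric] assms(3)[symmetric]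
      by (intro position_moment_bounded[OF assms(1) rt p that(2,3)]) blast+
    then obtain B where "\<And>n. position_moment r t \<omega> L \<Psi> n \<le> B" by blast
    then have "(SUP n::int. ereal (position_moment r t \<omega> L \<Psi> n)) \<le> ereal B"
      by (intro SUP_least) simp
    also have "\<dots> < ereal (B + 1)" by simp
    finally show ?thesis by blast
  qed
  have "emeasure P (space P - N) = 1"
    using emeasure_Diff_null_set[OF null_setsI[OF N(2,3)] sets.top] P.emeasure_space_1 by (rule trans)
  moreover have "space P - N \<in> sets P" using N(3) by (rule sets.compl_sets)
  ultimately show ?thesis using bounded by blast
qed

end
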